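(* For all $p,q>-1$, the wave operators $W_{\pm}(J_q,J_p)=\operatorname{s-lim}_{t\to\pm\infty}e^{iJ_q t}e^{-iJ_p t}$ exist, and $$W_{\pm}(J_q,J_p)=e^{\pm i(q-p)\pi/2}\,\Phi_q^{*}\Phi_p .$$
   Context: $\mathbb Z_+=\{0,1,2,\dots\}$, $\mathbb R_+=(0,\infty)$; $\operatorname{s-lim}$ is the strong limit. For $p>-1$ put $a_n^{(p)}=\sqrt{(n+1)(n+1+p)}$, $b_n^{(p)}=2n+p+1$. The Laguerre operator $J_p$ acts in $\ell^2(\mathbb Z_+)$ by $(J_pf)_n=a_{n-1}^{(p)}f_{n-1}+b_n^{(p)}f_n+a_n^{(p)}f_{n+1}$, $n\in\mathbb Z_+$, $a_{-1}^{(p)}=0$; it is essentially self-adjoint on the set $\mathcal D$ of sequences with finitely many non-zero components, and $J_p$ denotes its self-adjoint closure. The orthonormal Laguerre polynomials $L_n^{(p)}$ are defined by $a_{n-1}^{(p)}L_{n-1}^{(p)}(z)+b_n^{(p)}L_n^{(p)}(z)+a_n^{(p)}L_{n+1}^{(p)}(z)=zL_n^{(p)}(z)$, $L_{-1}^{(p)}=0$, $L_0^{(p)}=1$; they are orthonormal in $L^2(\mathbb R_+;\tau_p(\lambda)d\lambda)$ with $\tau_p(\lambda)=\Gamma(p+1)^{-1}\lambda^pe^{-\lambda}$. Put $\varphi_n^{(p)}(\lambda)=\sqrt{\tau_p(\lambda)}\,L_n^{(p)}(\lambda)$, $\lambda\in\mathbb R_+$. The operator $\Phi_p:\ell^2(\mathbb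 Z_+)\to L^2(\mathbb R_+)$ is the unitary operator defined by $(\Phi_pf)(\lambda)=\sum_{n=0}^\infty\varphi_n^{(p)}(\lambda)f_n$ for $f\in\mathcal D$ (and extended by continuity). *)

theory Defs
  imports "HOL-Analysis.Analysis"
begin

section \<open>Complex inner product spaces\<close>

text \<open>The inner product is linear in the first argument. Norm and topology are those of the
  underlying real inner product space.\<close>

class complex_inner = real_inner +
  fixes scaleC :: "complex \<Rightarrow> 'a \<Rightarrow> 'a" (infixr "*\<^sub>C" 75)
    and cinner :: "'a \<Rightarrow> 'a \<Rightarrow> complex"
  assumes scaleC_add_right: "a *\<^sub>C (x + y) = a *\<^sub>C x + a *\<^sub>C y"
    and scaleC_add_left: "(a + b) *\<^sub>C x = a *\<^sub>C x + b *\<^sub>C x"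
    and scaleC_scaleC: "a *\<^sub>C (b *\<^sub>C x) = (a * b) *\<^sub>C x"
    and scaleC_of_real: "complex_of_real r *\<^sub>C x = r *\<^sub>R x"
    and cinner_commute: "cinner x y = cnj (cinner y x)"
    and cinner_add_left: "cinner (x + y) z = cinner x z + cinner y z"
    and cinner_scaleC_left: "cinner (a *\<^sub>C x) y = a * cinner x y"
    and inner_eq_Re_cinner: "inner x y = Re (cinner x y)"

definition clinear :: "('a::complex_inner \<Rightarrow> 'b::complex_inner) \<Rightarrow> bool" where
  "clinear T \<longleftrightarrow> (\<forall>x y. T (x + y) = T x + T y) \<and> (\<forall>a x. T (a *\<^sub>C x) = a *\<^sub>C T x)"

definition unitary :: "('a::complex_inner \<Rightarrow> 'b::complex_inner) \<Rightarrow> bool" where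
  "unitary T \<longleftrightarrow> clinear T \<and> surj T \<and> (\<forall>x y. cinner (T x) (T y) = cinner x y)"

definition cadjoint :: "('a::complex_inner \<Rightarrow> 'b::complex_inner) \<Rightarrow> 'b \<Rightarrow> 'a" where
  "cadjoint T = (THE S. \<forall>x y. cinner (T x) y = cinner x (S y))"


section \<open>Unbounded operators, unitary groups and wave operators\<close>

text \<open>An unbounded operator is represented by its graph, so that the closure of an operator is the
  topological closure of its graph.\<close>

type_synonym 'a operator = "('a \<times> 'a) set"

definition unitary_group :: "(real \<Rightarrow> 'a::complex_inner \<Rightarrow> 'a) \<Rightarrow> bool" where
  "unitary_group U \<longleftrightarrow>
     (\<forall>t. unitary (U t)) \<and> U 0 = id \<and> (\<forall>s t. U (s + t) = U s \<circ> U t) \<and>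
     (\<forall>f. continuous_on UNIV (\<lambda>t. U t f))"

text \<open>The self-adjoint generator of \<open>U\<close>, with its full domain: \<open>f\<close> is in the domain
  iff \<open>(U t f - f) / (\<i> t)\<close> converges as \<open>t\<close> tends to 0.\<close>

definition generator :: "(real \<Rightarrow> 'a::complex_inner \<Rightarrow> 'a) \<Rightarrow> 'a operator" where
  "generator U = {(f, g). ((\<lambda>t. (1 / (\<i> * complex_of_real t)) *\<^sub>C (U t f - f)) \<longlongrightarrow> g) (at 0)}"

text \<open>\<open>exp_i A t\<close> is the operator \<open>e\<^sup>i\<^sup>A\<^sup>t\<close> for self-adjoint \<open>A\<close>: by Stone's theorem there is exactly
  one strongly continuous unitary group with generator \<open>A\<close>.\<close>

definition exp_i :: "'a::complex_inner operator \<Rightarrow> real \<Rightarrow> 'a \<Rightarrow> 'a" where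
  "exp_i A = (THE U. unitary_group U \<and> generator U = A)"

definition strongly_convergent ::
    "('c \<Rightarrow> 'a \<Rightarrow> 'b::topological_space) \<Rightarrow> 'c filter \<Rightarrow> bool" where
  "strongly_convergent T F \<longleftrightarrow> (\<forall>f. \<exists>g. ((\<lambda>t. T t f) \<longlongrightarrow> g) F)"

definition s_lim :: "'c filter \<Rightarrow> ('c \<Rightarrow> 'a \<Rightarrow> 'b::t2_space) \<Rightarrow> 'a \<Rightarrow> 'b" where
  "s_lim F T = (\<lambda>f. Lim F (\<lambda>t. T t f))"

definition wave_family :: "'a::complex_inner operator \<Rightarrow> 'a operator \<Rightarrow> real \<Rightarrow> 'a \<Rightarrow> 'a" where
  "wave_family B A t = exp_i B t \<circ> exp_i A (- t)"

definition wave_plus :: "'a::complex_inner operator \<Rightarrow> 'a operator \<Rightarrow> 'a \<Rightarrow> 'a" where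
  "wave_plus B A = s_lim at_top (wave_family B A)"

definition wave_minus :: "'a::complex_inner operator \<Rightarrow> 'a operator \<Rightarrow> 'a \<Rightarrow> 'a" where
  "wave_minus B A = s_lim at_bot (wave_family B A)"


section \<open>The space of square-summable sequences\<close>

lemma norm_add_sq: "(norm (x + y :: complex))\<^sup>2 \<le> 2 * (norm x)\<^sup>2 + 2 * (norm y)\<^sup>2"
proof -
  have "(norm (x + y))\<^sup>2 \<le> (norm x + norm y)\<^sup>2"
    by (intro power_mono norm_triangle_ineq norm_ge_zero)
  also have "\<dots> \<le> 2 * (norm x)\<^sup>2 + 2 * (norm y)\<^sup>2"
    using sum_squares_bound[of "norm x" "norm y"] by (simp add: power2_sum)
  finally show ?thesis .
qed

lemma norm_mult_cnj_le: "norm (x * cnj y :: complex) \<le> (norm x)\<^sup>2 + (norm y)\<^sup>2"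
proof -
  have "2 * (norm x * norm y) \<le> (norm x)\<^sup>2 + (norm y)\<^sup>2"
    using sum_squares_bound[of "norm x" "norm y"] by simp
  moreover have "0 \<le> norm x * norm y" by simp
  ultimately have "norm x * norm y \<le> (norm x)\<^sup>2 + (norm y)\<^sup>2" by linarith
  then show ?thesis by (simp add: norm_mult)
qed

typedef ell2 = "{f :: nat \<Rightarrow> complex. summable (\<lambda>n. (norm (f n))\<^sup>2)}"
  morphisms ell2_nth Abs_ell2
  by (rule exI[of _ "\<lambda>_. 0"]) simp

setup_lifting type_definition_ell2

lemma summable_ell2: "summable (\<lambda>n. (norm (ell2_nth f n))\<^sup>2)"
  using ell2_nth[of f] by simp

lemma summable_cinner_ell2: "summable (\<lambda>n. ell2_nth f n * cnj (ell2_nth g n))"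
  by (rule summable_comparison_test'[OF summable_add[OF summable_ell2 summable_ell2], of 0])
    (rule norm_mult_cnj_le)

instantiation ell2 :: ab_group_add
begin

lift_definition zero_ell2 :: ell2 is "\<lambda>_. 0" by simp

lift_definition plus_ell2 :: "ell2 \<Rightarrow> ell2 \<Rightarrow> ell2" is "\<lambda>f g n. f n + g n"
  subgoal for f g
    by (rule summable_comparison_test'[of "\<lambda>n. 2 * (norm (f n))\<^sup>2 + 2 * (norm (g n))\<^sup>2" 0])
      (auto intro!: summable_add summable_mult simp: norm_add_sq)
  done

lift_definition uminus_ell2 :: "ell2 \<Rightarrow> ell2" is "\<lambda>f n. - f n" by simp

definition minus_ell2 :: "ell2 \<Rightarrow> ell2 \<Rightarrow> ell2" where "f - g = f + (- g :: ell2)"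

instance
proof
  fix a b c :: ell2
  show "a + b + c = a + (b + c)" by transfer (simp add: algebra_simps)
  show "a + b = b + a" by transfer (simp add: algebra_simps)
  show "0 + a = a" by transfer simp
  show "- a + a = 0" by transfer simp
  show "a - b = a + - b" by (simp add: minus_ell2_def)
qed

end

instantiation ell2 :: real_vector
begin

lift_definition scaleR_ell2 :: "real \<Rightarrow> ell2 \<Rightarrow> ell2" is "\<lambda>r f n. complex_of_real r * f n"
  by (simp add: norm_mult power_mult_distrib summable_mult)

instance
proof
  fix r s :: real and x y :: ell2
  show "r *\<^sub>R (x + y) = r *\<^sub>R x + r *\<^sub>R y" by transfer (simp add: algebra_simps)
  show "(r + s) *\<^sub>R x = r *\<^sub>R x + s *\<^sub>R x" by transfer (simp add: algebra_simps)
  show "r *\<^sub>R s *\<^sub>R x = (r * s) *\<^sub>R x" by transfer (simp add: algebra_simps)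
  show "1 *\<^sub>R x = x" by transfer simp
qed

end

instantiation ell2 :: complex_inner
begin

lift_definition scaleC_ell2 :: "complex \<Rightarrow> ell2 \<Rightarrow> ell2" is "\<lambda>a f n. a * f n"
  by (simp add: norm_mult power_mult_distrib summable_mult)

definition cinner_ell2 :: "ell2 \<Rightarrow> ell2 \<Rightarrow> complex" where
  "cinner_ell2 f g = (\<Sum>n. ell2_nth f n * cnj (ell2_nth g n))"

definition inner_ell2 :: "ell2 \<Rightarrow> ell2 \<Rightarrow> real" where
  "inner_ell2 f g = Re (cinner f g)"

definition norm_ell2 :: "ell2 \<Rightarrow> real" where
  "norm_ell2 f = sqrt (inner f f)"

definition dist_ell2 :: "ell2 \<Rightarrow> ell2 \<Rightarrow> real" where
  "dist_ell2 f g = norm (f - g)"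

definition sgn_ell2 :: "ell2 \<Rightarrow> ell2" where
  "sgn_ell2 f = inverse (norm f) *\<^sub>R f"

definition uniformity_ell2 :: "(ell2 \<times> ell2) filter" where
  "uniformity_ell2 = (INF e\<in>{0<..}. principal {(x, y). dist x y < e})"

definition open_ell2 :: "ell2 set \<Rightarrow> bool" where
  "open_ell2 U \<longleftrightarrow> (\<forall>x\<in>U. eventually (\<lambda>(x', y). x' = x \<longrightarrow> y \<in> U) uniformity)"

instance
proof
  fix x y z :: ell2 and a b :: complex and r s :: real
  have nth_add: "ell2_nth (u + v) n = ell2_nth u n + ell2_nth v n" for u v n
    by transfer simp
  have nth_scaleC: "ell2_nth (c *\<^sub>C u) n = c * ell2_nth u n" for c u n
    by transfer simp
  show "a *\<^sub>C (x + y) = a *\<^sub>C x + a *\<^sub>C y" for a and x y :: ell2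
    by transfer (simp add: algebra_simps)
  show "(a + b) *\<^sub>C x = a *\<^sub>C x + b *\<^sub>C x" for a b and x :: ell2
    by transfer (simp add: algebra_simps)
  show "a *\<^sub>C (b *\<^sub>C x) = (a * b) *\<^sub>C x" for a b and x :: ell2
    by transfer (simp add: algebra_simps)
  show of_real: "complex_of_real r *\<^sub>C x = r *\<^sub>R x" for r and x :: ell2
    by transfer simp
  show comm: "cinner x y = cnj (cinner y x)" for x y :: ell2
    unfolding cinner_ell2_def
    by (rule sums_unique[symmetric], rule sums_cnj[THEN iffD1])
      (simp add: mult.commute[of "cnj _"] summable_sums[OF summable_cinner_ell2])
  show add: "cinner (x + y) z = cinner x z + cinner y z" for x y z :: ell2
    unfolding cinner_ell2_def
    by (simp add: nth_add distrib_right suminf_add summable_cinner_ell2)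
  show scal: "cinner (a *\<^sub>C x) y = a * cinner x y" for a and x y :: ell2
    unfolding cinner_ell2_def
    by (simp add: nth_scaleC mult.assoc suminf_mult summable_cinner_ell2)
  show "inner x y = Re (cinner x y)"
    by (simp add: inner_ell2_def)
  show "dist x y = norm (x - y)" by (simp add: dist_ell2_def)
  show "sgn x = x /\<^sub>R norm x" by (simp add: sgn_ell2_def)
  show "uniformity = (INF e\<in>{0<..}. principal {(x :: ell2, y). dist x y < e})"
    by (simp add: uniformity_ell2_def)
  show "open U \<longleftrightarrow> (\<forall>x\<in>U. eventually (\<lambda>(x', y). x' = x \<longrightarrow> y \<in> U) uniformity)"
    for U :: "ell2 set"
    by (simp add: open_ell2_def)
  show "inner x y = inner y x"
    unfolding inner_ell2_def by (subst comm) simp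
  show "inner (x + y) z = inner x z + inner y z"
    by (simp add: inner_ell2_def add)
  show "inner (r *\<^sub>R x) y = r * inner x y"
    by (simp add: inner_ell2_def scal flip: of_real)
  have sq: "inner x x = (\<Sum>n. (norm (ell2_nth x n))\<^sup>2)"
    unfolding inner_ell2_def cinner_ell2_def
    by (subst Re_suminf[OF summable_cinner_ell2]) (simp add: cmod_power2 flip: power2_eq_square)
  show "0 \<le> inner x x"
    unfolding sq by (rule suminf_nonneg[OF summable_ell2]) simp
  show "inner x x = 0 \<longleftrightarrow> x = 0"
    unfolding sq suminf_eq_zero_iff[OF summable_ell2, simplified] by transfer auto
  show "norm x = sqrt (inner x x)"
    by (simp add: norm_ell2_def)
qed

end


section \<open>The space of square-integrable functions on the half-line\<close>

abbreviation half_line :: "real measure" where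
  "half_line \<equiv> restrict_space lborel {0<..}"

definition sq_integrable :: "(real \<Rightarrow> complex) \<Rightarrow> bool" where
  "sq_integrable f \<longleftrightarrow>
     f \<in> borel_measurable half_line \<and> integrable half_line (\<lambda>x. (norm (f x))\<^sup>2)"

definition L2_rel :: "(real \<Rightarrow> complex) \<Rightarrow> (real \<Rightarrow> complex) \<Rightarrow> bool" where
  "L2_rel f g \<longleftrightarrow> sq_integrable f \<and> sq_integrable g \<and> (AE x in half_line. f x = g x)"

lemma sq_integrable_add:
  assumes "sq_integrable f" "sq_integrable g"
  shows "sq_integrable (\<lambda>x. f x + g x)"
proof -
  have [measurable]: "f \<in> borel_measurable half_line" "g \<in> borel_measurable half_line"
    using assms by (auto simp: sq_integrable_def)
  have "integrable half_line (\<lambda>x. (norm (f x + g x))\<^sup>2)"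
    by (rule Bochner_Integration.integrable_bound
          [of _ "\<lambda>x. 2 * (norm (f x))\<^sup>2 + 2 * (norm (g x))\<^sup>2"])
      (use assms in \<open>auto simp: sq_integrable_def norm_add_sq
         intro!: Bochner_Integration.integrable_add\<close>)
  then show ?thesis by (auto simp: sq_integrable_def)
qed

lemma sq_integrable_cmult:
  assumes "sq_integrable f"
  shows "sq_integrable (\<lambda>x. a * f x)"
  using assms by (auto simp: sq_integrable_def norm_mult power_mult_distrib)

lemma borel_measurable_mult_cnj:
  assumes "f \<in> borel_measurable M" "g \<in> borel_measurable M"
  shows "(\<lambda>x. f x * cnj (g x :: complex)) \<in> borel_measurable M"
  using assms
  by (intro borel_measurable_times measurable_compose[OF assms(2)]
      borel_measurable_continuous_onI continuous_intros) auto

lemma integrable_cinner_L2: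
  assumes "sq_integrable f" "sq_integrable g"
  shows "integrable half_line (\<lambda>x. f x * cnj (g x))"
proof -
  have [measurable]: "f \<in> borel_measurable half_line" "g \<in> borel_measurable half_line"
    using assms by (auto simp: sq_integrable_def)
  show ?thesis
    by (rule Bochner_Integration.integrable_bound
          [of _ "\<lambda>x. (norm (f x))\<^sup>2 + (norm (g x))\<^sup>2"])
      (use assms norm_mult_cnj_le in \<open>auto simp: sq_integrable_def
         intro!: Bochner_Integration.integrable_add borel_measurable_mult_cnj\<close>)
qed

quotient_type L2_half_line = "real \<Rightarrow> complex" / partial: L2_rel
  morphisms L2_fun L2_class
proof (rule part_equivpI)
  show "\<exists>x. L2_rel x x"
    by (rule exI[of _ "\<lambda>_. 0"]) (simp add: L2_rel_def sq_integrable_def)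
  show "symp L2_rel"
    by (auto simp: symp_def L2_rel_def)
  show "transp L2_rel"
    by (auto simp: transp_def L2_rel_def elim: AE_mp)
qed

instantiation L2_half_line :: ab_group_add
begin

lift_definition zero_L2_half_line :: L2_half_line is "\<lambda>_. 0"
  by (simp add: L2_rel_def sq_integrable_def)

lift_definition plus_L2_half_line :: "L2_half_line \<Rightarrow> L2_half_line \<Rightarrow> L2_half_line"
  is "\<lambda>f g x. f x + g x"
  by (auto simp: L2_rel_def intro!: sq_integrable_add)

lift_definition uminus_L2_half_line :: "L2_half_line \<Rightarrow> L2_half_line" is "\<lambda>f x. - f x"
  by (auto simp: L2_rel_def sq_integrable_def)

definition minus_L2_half_line :: "L2_half_line \<Rightarrow> L2_half_line \<Rightarrow> L2_half_line" where
  "f - g = f + (- g :: L2_half_line)"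

instance
proof
  fix a b c :: L2_half_line
  show "a + b + c = a + (b + c)"
    by transfer (simp add: L2_rel_def add_ac sq_integrable_add)
  show "a + b = b + a"
    by transfer (simp add: L2_rel_def add_ac sq_integrable_add)
  show "0 + a = a" by transfer (simp add: L2_rel_def)
  show "- a + a = 0" by transfer (simp add: L2_rel_def sq_integrable_def)
  show "a - b = a + - b" by (simp add: minus_L2_half_line_def)
qed

end

instantiation L2_half_line :: real_vector
begin

lift_definition scaleR_L2_half_line :: "real \<Rightarrow> L2_half_line \<Rightarrow> L2_half_line"
  is "\<lambda>r f x. complex_of_real r * f x"
  by (auto simp: L2_rel_def intro!: sq_integrable_cmult)

instance
proof
  fix r s :: real and x y :: L2_half_line
  show "r *\<^sub>R (x + y) = r *\<^sub>R x + r *\<^sub>R y"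
    by transfer (simp add: distrib_left L2_rel_def sq_integrable_add sq_integrable_cmult)
  show "(r + s) *\<^sub>R x = r *\<^sub>R x + s *\<^sub>R x"
    by transfer (simp add: distrib_right L2_rel_def sq_integrable_add sq_integrable_cmult)
  show "r *\<^sub>R s *\<^sub>R x = (r * s) *\<^sub>R x"
    by transfer (simp add: mult.assoc L2_rel_def sq_integrable_cmult)
  show "1 *\<^sub>R x = x" by transfer simp
qed

end

instantiation L2_half_line :: complex_inner
begin

lift_definition scaleC_L2_half_line :: "complex \<Rightarrow> L2_half_line \<Rightarrow> L2_half_line"
  is "\<lambda>a f x. a * f x"
  by (auto simp: L2_rel_def intro!: sq_integrable_cmult)

lift_definition cinner_L2_half_line :: "L2_half_line \<Rightarrow> L2_half_line \<Rightarrow> complex"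
  is "\<lambda>f g. \<integral>x. f x * cnj (g x) \<partial>half_line"
  by (rule integral_cong_AE)
    (auto simp: L2_rel_def sq_integrable_def intro!: borel_measurable_mult_cnj)

definition inner_L2_half_line :: "L2_half_line \<Rightarrow> L2_half_line \<Rightarrow> real" where
  "inner_L2_half_line f g = Re (cinner f g)"

definition norm_L2_half_line :: "L2_half_line \<Rightarrow> real" where
  "norm_L2_half_line f = sqrt (inner f f)"

definition dist_L2_half_line :: "L2_half_line \<Rightarrow> L2_half_line \<Rightarrow> real" where
  "dist_L2_half_line f g = norm (f - g)"

definition sgn_L2_half_line :: "L2_half_line \<Rightarrow> L2_half_line" where
  "sgn_L2_half_line f = inverse (norm f) *\<^sub>R f"

definition uniformity_L2_half_line :: "(L2_half_line \<times> L2_half_line) filter" where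
  "uniformity_L2_half_line = (INF e\<in>{0<..}. principal {(x, y). dist x y < e})"

definition open_L2_half_line :: "L2_half_line set \<Rightarrow> bool" where
  "open_L2_half_line U \<longleftrightarrow> (\<forall>x\<in>U. eventually (\<lambda>(x', y). x' = x \<longrightarrow> y \<in> U) uniformity)"

instance
proof
  fix x y z :: L2_half_line and a b :: complex and r s :: real
  show "a *\<^sub>C (x + y) = a *\<^sub>C x + a *\<^sub>C y" for a and x y :: L2_half_line
    by transfer (simp add: distrib_left L2_rel_def sq_integrable_add sq_integrable_cmult)
  show "(a + b) *\<^sub>C x = a *\<^sub>C x + b *\<^sub>C x" for a b and x :: L2_half_line
    by transfer (simp add: distrib_right L2_rel_def sq_integrable_add sq_integrable_cmult)
  show "a *\<^sub>C (b *\<^sub>C x) = (a * b) *\<^sub>C x" for a b and x :: L2_half_line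
    by transfer (simp add: mult.assoc L2_rel_def sq_integrable_cmult)
  show of_real: "complex_of_real r *\<^sub>C x = r *\<^sub>R x" for r and x :: L2_half_line
    by transfer (simp add: L2_rel_def sq_integrable_cmult)
  show comm: "cinner x y = cnj (cinner y x)" for x y :: L2_half_line
    by transfer (simp add: mult.commute flip: Bochner_Integration.integral_cnj)
  show add: "cinner (x + y) z = cinner x z + cinner y z" for x y z :: L2_half_line
    by transfer (simp add: distrib_right L2_rel_def integrable_cinner_L2)
  show scal: "cinner (a *\<^sub>C x) y = a * cinner x y" for a and x y :: L2_half_line
    by transfer (simp add: mult.assoc)
  show "inner x y = Re (cinner x y)"
    by (simp add: inner_L2_half_line_def)
  show "dist x y = norm (x - y)" by (simp add: dist_L2_half_line_def)
  show "sgn x = x /\<^sub>R norm x" by (simp add: sgn_L2_half_line_def)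
  show "uniformity = (INF e\<in>{0<..}. principal {(x :: L2_half_line, y). dist x y < e})"
    by (simp add: uniformity_L2_half_line_def)
  show "open U \<longleftrightarrow> (\<forall>x\<in>U. eventually (\<lambda>(x', y). x' = x \<longrightarrow> y \<in> U) uniformity)"
    for U :: "L2_half_line set"
    by (simp add: open_L2_half_line_def)
  show "inner x y = inner y x"
    unfolding inner_L2_half_line_def by (subst comm) simp
  show "inner (x + y) z = inner x z + inner y z"
    by (simp add: inner_L2_half_line_def add)
  show "inner (r *\<^sub>R x) y = r * inner x y"
    by (simp add: inner_L2_half_line_def scal flip: of_real)
  have sq: "Re (\<integral>t. f t * cnj (f t) \<partial>half_line) = (\<integral>t. (norm (f t))\<^sup>2 \<partial>half_line)"
    if "sq_integrable f" for f
  proof -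
    have "(\<integral>t. f t * cnj (f t) \<partial>half_line) = (\<integral>t. complex_of_real ((norm (f t))\<^sup>2) \<partial>half_line)"
      by (simp only: complex_norm_square)
    then show ?thesis by (simp only: integral_complex_of_real Re_complex_of_real)
  qed
  show "0 \<le> inner x x"
    unfolding inner_L2_half_line_def by transfer (simp add: L2_rel_def sq)
  show "inner x x = 0 \<longleftrightarrow> x = 0"
    unfolding inner_L2_half_line_def
  proof transfer
    fix f assume "L2_rel f f"
    then have f: "sq_integrable f" by (simp add: L2_rel_def)
    then have i: "integrable half_line (\<lambda>t. (norm (f t))\<^sup>2)" by (simp add: sq_integrable_def)
    have z: "sq_integrable (\<lambda>_. 0)" by (simp add: sq_integrable_def)
    show "Re (\<integral>t. f t * cnj (f t) \<partial>half_line) = 0 \<longleftrightarrow> L2_rel f (\<lambda>_. 0)"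
      unfolding sq[OF f] L2_rel_def
      using integral_nonneg_eq_0_iff_AE[OF i] f z by simp
  qed
  show "norm x = sqrt (inner x x)"
    by (simp add: norm_L2_half_line_def)
qed

end


section \<open>Laguerre operators, Laguerre polynomials and the operators \<open>\<Phi>\<close>\<close>

definition lag_a :: "real \<Rightarrow> nat \<Rightarrow> real" where
  "lag_a p n = sqrt ((real n + 1) * (real n + 1 + p))"

definition lag_b :: "real \<Rightarrow> nat \<Rightarrow> real" where
  "lag_b p n = 2 * real n + p + 1"

definition finite_support :: "ell2 set" where
  "finite_support = {f. finite {n. ell2_nth f n \<noteq> 0}}"

text \<open>The Laguerre operator on finitely supported sequences, and its closure.\<close>

definition laguerre_operator_min :: "real \<Rightarrow> ell2 operator" where
  "laguerre_operator_min p = {(f, g). f \<in> finite_support \<and>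
     (\<forall>n. ell2_nth g n =
        (if n = 0 then 0 else complex_of_real (lag_a p (n - 1)) * ell2_nth f (n - 1))
        + complex_of_real (lag_b p n) * ell2_nth f n
        + complex_of_real (lag_a p n) * ell2_nth f (n + 1))}"

definition laguerre_operator :: "real \<Rightarrow> ell2 operator" where
  "laguerre_operator p = closure (laguerre_operator_min p)"

text \<open>The three-term recurrence, solved for the polynomial of highest index (\<open>lag_a p n > 0\<close> for
  \<open>p > -1\<close>).\<close>

fun laguerre :: "real \<Rightarrow> nat \<Rightarrow> real \<Rightarrow> real" where
  "laguerre p 0 z = 1"
| "laguerre p (Suc 0) z = (z - lag_b p 0) / lag_a p 0"
| "laguerre p (Suc (Suc n)) z =
     ((z - lag_b p (Suc n)) * laguerre p (Suc n) z - lag_a p n * laguerre p n z) / lag_a p (Suc n)"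

definition laguerre_weight :: "real \<Rightarrow> real \<Rightarrow> real" where
  "laguerre_weight p x = x powr p * exp (- x) / Gamma (p + 1)"

definition laguerre_fun :: "real \<Rightarrow> nat \<Rightarrow> real \<Rightarrow> real" where
  "laguerre_fun p n x = sqrt (laguerre_weight p x) * laguerre p n x"

text \<open>The continuous extension of \<open>f \<mapsto> (\<Sum>n. laguerre_fun p n x * f\<^sub>n)\<close> from the dense set of
  finitely supported sequences, on which the sum has finitely many non-zero terms.\<close>

definition Phi :: "real \<Rightarrow> ell2 \<Rightarrow> L2_half_line" where
  "Phi p = (THE T. continuous_on UNIV T \<and>
     (\<forall>f\<in>finite_support. T f = L2_class
        (\<lambda>x. \<Sum>n. complex_of_real (laguerre_fun p n x) * ell2_nth f n)))"

end

theory Submission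
  imports Defs "HOL-Probability.Probability"
begin

text \<open>\<open>\<Phi>\<close> diagonalises \<open>J\<close>: since polynomials times the square root of the weight are dense in \<open>L\<^sup>2\<close> with
  respect to \<open>(1 + \<lambda>\<^sup>2) d\<lambda>\<close>, the closure of the Laguerre operator is unitarily equivalent to
  multiplication by \<open>\<lambda>\<close>, and \<open>e\<^sup>i\<^sup>J\<^sup>t\<close> to multiplication by \<open>e\<^sup>i\<^sup>\<lambda>\<^sup>t\<close>. For the first basis vector \<open>e\<close>,
  the components of \<open>e\<^sup>-\<^sup>i\<^sup>J\<^sup>t e\<close> are Laplace transforms of Laguerre polynomials,
  \<open>c\<^sub>n z\<^sup>-\<^sup>p\<^sup>-\<^sup>1 (1/z - 1)\<^sup>n\<close> with \<open>z = 1 + i t\<close> and \<open>c\<^sub>n\<^sup>2 = (p+1)\<^sub>n / n!\<close>. Hence the matrix elements of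
  \<open>e\<^sup>i\<^sup>J\<^sup>q\<^sup>t e\<^sup>-\<^sup>i\<^sup>J\<^sup>p\<^sup>t\<close> between the orbits of \<open>e\<close>, which span dense subspaces, are power series at a point tending
  to \<open>1\<close> within a Stolz angle. An Abelian theorem gives their limits, the phase
  \<open>e\<^sup>\<plusminus>\<^sup>i\<^sup>(\<^sup>q\<^sup>-\<^sup>p\<^sup>)\<^sup>\<pi>\<^sup>/\<^sup>2\<close> being that of \<open>z\<^sup>-\<^sup>p\<^sup>-\<^sup>1 (cnj z)\<^sup>-\<^sup>q\<^sup>-\<^sup>1\<close>, and weak convergence of unitary operators to an
  isometry is strong.\<close>

section \<open>Complex inner product spaces\<close>

text \<open>For p \<noteq> q the difference of the two Jacobi matrices has diagonal q - p and
  off-diagonal entries tending to (q - p) / 2. It is not compact, so perturbation arguments of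
  trace-class or short-range type are out of reach and the limits must come from explicit formulas.
  What makes these match is the agreement of two computations. The geometric mean of two weights is
  a constant C times the weight with parameter (p + q) / 2, so the expected limit between two orbits
  is a single Laplace transform, with exponent \<beta> = (p + q) / 2 + 1. The coefficients of the
  power series in the evolving matrix element are products of two square roots and in general form
  no binomial series, but they are asymptotic to the same C times the coefficients of
  \<open>(1 - x) powr (- \<beta>)\<close>. Near x = 1 only large indices count, which is why an
  Abelian estimate takes the place of an identity. A second constraint is that \<open>exp_i\<close>,
  \<open>Phi\<close> and \<open>cadjoint\<close> are definite descriptions: each has to be
  identified, with uniqueness, before anything can be computed.\<close>

lemma scaleC_zero_left [simp]: "0 *\<^sub>C (x::'a::complex_inner) = 0"
  using scaleC_of_real[of 0 x] by simp

lemma scaleC_one [simp]: "1 *\<^sub>C (x::'a::complex_inner) = x"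
  using scaleC_of_real[of 1 x] by simp

lemma scaleC_minus_one: "(-1) *\<^sub>C (x::'a::complex_inner) = - x"
  using scaleC_of_real[of "-1" x] by simp

lemma scaleC_zero_right [simp]: "a *\<^sub>C (0::'a::complex_inner) = 0"
  by (metis scaleC_scaleC scaleC_zero_left mult_zero_right)

lemma scaleC_minus_right: "a *\<^sub>C (- x) = - (a *\<^sub>C (x::'a::complex_inner))"
  by (metis scaleC_minus_one scaleC_scaleC mult.commute)

lemma scaleC_diff_right: "a *\<^sub>C (x - y) = a *\<^sub>C x - a *\<^sub>C (y::'a::complex_inner)"
  by (metis scaleC_add_right scaleC_minus_right diff_conv_add_uminus)

lemma scaleC_sum_right: "a *\<^sub>C (\<Sum>i\<in>I. f i) = (\<Sum>i\<in>I. a *\<^sub>C (f i::'a::complex_inner))"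
  by (induction I rule: infinite_finite_induct) (auto simp: scaleC_add_right)

lemma cinner_add_right: "cinner (x::'a::complex_inner) (y + z) = cinner x y + cinner x z"
  by (metis cinner_add_left cinner_commute complex_cnj_add)

lemma cinner_scaleC_right: "cinner (x::'a::complex_inner) (a *\<^sub>C y) = cnj a * cinner x y"
  by (metis cinner_scaleC_left cinner_commute complex_cnj_mult)

lemma cinner_zero_left [simp]: "cinner 0 (x::'a::complex_inner) = 0"
  using cinner_scaleC_left[of 0 0 x] by simp

lemma cinner_zero_right [simp]: "cinner (x::'a::complex_inner) 0 = 0"
  using cinner_scaleC_right[of x 0 0] by simp

lemma cinner_minus_left: "cinner (- x) (y::'a::complex_inner) = - cinner x y"
  by (metis cinner_scaleC_left scaleC_minus_one mult_minus1)

lemma cinner_minus_right: "cinner x (- y::'a::complex_inner) = - cinner x y"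
  by (metis cinner_minus_left cinner_commute complex_cnj_minus)

lemma cinner_diff_left: "cinner (x - y) (z::'a::complex_inner) = cinner x z - cinner y z"
  by (metis cinner_add_left cinner_minus_left diff_conv_add_uminus)

lemma cinner_diff_right: "cinner x (y - z::'a::complex_inner) = cinner x y - cinner x z"
  by (metis cinner_add_right cinner_minus_right diff_conv_add_uminus)

lemma cinner_sum_left: "cinner (\<Sum>i\<in>I. f i) (y::'a::complex_inner) = (\<Sum>i\<in>I. cinner (f i) y)"
  by (induction I rule: infinite_finite_induct) (auto simp: cinner_add_left)

lemma cinner_sum_right: "cinner x (\<Sum>i\<in>I. f i::'a::complex_inner) = (\<Sum>i\<in>I. cinner x (f i))"
  by (induction I rule: infinite_finite_induct) (auto simp: cinner_add_right)

lemma cinner_self: "cinner x (x::'a::complex_inner) = complex_of_real ((norm x)\<^sup>2)"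
proof -
  have "Im (cinner x x) = 0"
    using cinner_commute[of x x] by (metis cnj.simps(2) neg_equal_zero)
  moreover have "Re (cinner x x) = (norm x)\<^sup>2"
    by (metis inner_eq_Re_cinner power2_norm_eq_inner)
  ultimately show ?thesis by (simp add: complex_eq_iff)
qed

lemma norm_scaleC: "norm (a *\<^sub>C (x::'a::complex_inner)) = cmod a * norm x"
proof -
  have "complex_of_real ((norm (a *\<^sub>C x))\<^sup>2) = complex_of_real ((cmod a * norm x)\<^sup>2)"
    unfolding cinner_self[symmetric] cinner_scaleC_left cinner_scaleC_right
    by (simp add: cinner_self power_mult_distrib complex_norm_square[of a, simplified] mult.assoc)
  then show ?thesis
    by (metis norm_ge_zero mult_nonneg_nonneg of_real_eq_iff power2_eq_imp_eq)
qed

text \<open>Rotating \<open>x\<close> by the conjugate phase of \<open>cinner x y\<close> makes the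
  inner product real and nonnegative, which reduces the claim to the real Cauchy-Schwarz
  inequality.\<close>

lemma norm_cinner_le: "cmod (cinner x (y::'a::complex_inner)) \<le> norm x * norm y"
proof (cases "cinner x y = 0")
  case False
  define a where "a = cnj (sgn (cinner x y))"
  have a: "cmod a = 1" using False by (simp add: a_def norm_sgn)
  have "a * cinner x y = complex_of_real (cmod (cinner x y))"
    using complex_norm_square[of "cinner x y"] False
    by (simp add: a_def sgn_eq field_simps power2_eq_square)
  then have "cmod (cinner x y) = inner (a *\<^sub>C x) y"
    by (simp add: inner_eq_Re_cinner cinner_scaleC_left)
  also have "\<dots> \<le> norm (a *\<^sub>C x) * norm y" by (rule norm_cauchy_schwarz)
  finally show ?thesis by (simp add: norm_scaleC a)
qed simp

text \<open>Boundedness and bilinearity over the reals suffice for continuity and for the product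
  rule, so conjugate-linearity in the second argument does no harm.\<close>

lemma bounded_bilinear_cinner: "bounded_bilinear (cinner :: 'a::complex_inner \<Rightarrow> 'a \<Rightarrow> complex)"
proof
  show "\<exists>K. \<forall>a b::'a. norm (cinner a b) \<le> norm a * norm b * K"
    by (rule exI[of _ 1]) (simp add: norm_cinner_le)
  show "cinner (r *\<^sub>R a) b = r *\<^sub>R cinner a b" for r and a b::'a
    by (simp only: scaleC_of_real[symmetric] cinner_scaleC_left scaleR_conv_of_real)
  show "cinner a (r *\<^sub>R b) = r *\<^sub>R cinner a b" for r and a b::'a
    by (simp only: scaleC_of_real[symmetric] cinner_scaleC_right scaleR_conv_of_real
        complex_cnj_complex_of_real)
qed (simp_all add: cinner_add_left cinner_add_right)

lemmas tendsto_cinner = bounded_bilinear.tendsto[OF bounded_bilinear_cinner]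

lemma bounded_bilinear_scaleC:
  "bounded_bilinear (scaleC :: complex \<Rightarrow> 'a::complex_inner \<Rightarrow> 'a)"
proof
  show "\<exists>K. \<forall>a (b::'a). norm (a *\<^sub>C b) \<le> norm a * norm b * K"
    by (rule exI[of _ 1]) (simp add: norm_scaleC)
  show "a *\<^sub>C r *\<^sub>R b = r *\<^sub>R a *\<^sub>C b" for a r and b::'a
    by (simp only: scaleC_of_real[symmetric] scaleC_scaleC mult.commute)
  show "(r *\<^sub>R a) *\<^sub>C b = r *\<^sub>R a *\<^sub>C b" for a r and b::'a
    by (simp only: scaleC_of_real[symmetric] scaleC_scaleC scaleR_conv_of_real)
qed (simp_all add: scaleC_add_left scaleC_add_right)

lemmas tendsto_scaleC = bounded_bilinear.tendsto[OF bounded_bilinear_scaleC]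

lemma norm_diff_sq_cinner:
  "(norm (x - y::'a::complex_inner))\<^sup>2 = (norm x)\<^sup>2 + (norm y)\<^sup>2 - 2 * Re (cinner x y)"
  by (simp add: power2_norm_eq_inner inner_diff_left inner_diff_right inner_commute[of y x]
      flip: inner_eq_Re_cinner)

lemma cinner_eqI: "(\<And>z. cinner x z = cinner y z) \<Longrightarrow> x = (y::'a::complex_inner)"
  using cinner_diff_left[of x y "x - y"] by (simp add: cinner_self)

lemma clinear_add: "clinear T \<Longrightarrow> T (x + y) = T x + T y"
  and clinear_scaleC: "clinear T \<Longrightarrow> T (a *\<^sub>C x) = a *\<^sub>C T x"
  by (auto simp: clinear_def)

lemma clinear_zero: "clinear T \<Longrightarrow> T 0 = 0"
  using clinear_scaleC[of T 0 0] by simp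

lemma clinear_diff: "clinear T \<Longrightarrow> T (x - y) = T x - T y"
  by (metis clinear_add diff_add_cancel add_diff_cancel_right')

lemma clinear_sum: "clinear T \<Longrightarrow> T (\<Sum>i\<in>I. f i) = (\<Sum>i\<in>I. T (f i))"
  by (induction I rule: infinite_finite_induct) (auto simp: clinear_zero clinear_add)

lemma unitaryD:
  assumes "unitary T"
  shows unitary_clinear: "clinear T" and unitary_surj: "surj T"
    and unitary_cinner: "cinner (T x) (T y) = cinner x y"
  using assms by (auto simp: unitary_def)

lemma norm_eq_of_cinner_eq:
  "cinner x x = cinner y y \<Longrightarrow> norm (x::'a::complex_inner) = norm (y::'b::complex_inner)"
  unfolding cinner_self of_real_eq_iff by (simp add: power2_eq_iff_nonneg)

lemma unitary_norm: "unitary T \<Longrightarrow> norm (T x) = norm x"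
  by (rule norm_eq_of_cinner_eq) (rule unitary_cinner)

lemma unitary_inj: assumes "unitary T" shows "inj T"
proof (rule injI)
  fix x y assume "T x = T y"
  then have "norm (T (x - y)) = 0" by (simp add: assms clinear_diff unitary_clinear)
  then show "x = y" by (simp add: assms unitary_norm)
qed

lemma unitary_bij: "unitary T \<Longrightarrow> bij T"
  by (simp add: bij_def unitary_inj unitary_surj)

lemma unitary_inv: assumes T: "unitary T" shows "unitary (inv T)"
proof -
  have s: "T (inv T x) = x" for x using unitary_surj[OF T] by (simp add: surj_f_inv_f)
  have "inv T (x + y) = inv T x + inv T y" for x y
    by (rule injD[OF unitary_inj[OF T]]) (simp add: s clinear_add[OF unitary_clinear[OF T]])
  moreover have "inv T (a *\<^sub>C x) = a *\<^sub>C inv T x" for a x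
    by (rule injD[OF unitary_inj[OF T]]) (simp add: s clinear_scaleC[OF unitary_clinear[OF T]])
  moreover have "cinner (inv T x) (inv T y) = cinner x y" for x y
    using unitary_cinner[OF T, of "inv T x" "inv T y"] by (simp add: s)
  moreover have "surj (inv T)" using T by (simp add: bij_imp_bij_inv bij_is_surj unitary_bij)
  ultimately show ?thesis by (auto simp: unitary_def clinear_def)
qed

lemma unitary_continuous: assumes "unitary T" shows "continuous_on A T"
proof -
  have "dist (T x) (T y) = dist x y" for x y
    by (simp add: assms dist_norm unitary_norm flip: clinear_diff[OF unitary_clinear[OF assms]])
  then show ?thesis by (auto simp: continuous_on_iff)
qed

lemma unitary_tendsto: "unitary T \<Longrightarrow> (f \<longlongrightarrow> l) F \<Longrightarrow> ((\<lambda>x. T (f x)) \<longlongrightarrow> T l) F"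
  by (rule continuous_on_tendsto_compose[OF unitary_continuous[of T UNIV]]) auto

text \<open>The inverse has the defining property because \<open>T\<close> preserves inner products;
  nondegeneracy of the inner product excludes any other candidate.\<close>

lemma cadjoint_unitary: assumes T: "unitary T" shows "cadjoint T = inv T"
  unfolding cadjoint_def
proof (rule the_equality)
  have "T (inv T y) = y" for y using unitary_surj[OF T] by (rule surj_f_inv_f)
  then show *: "\<forall>x y. cinner (T x) y = cinner x (inv T y)"
    using unitary_cinner[OF T] by metis
  fix S assume S: "\<forall>x y. cinner (T x) y = cinner x (S y)"
  show "S = inv T"
  proof
    fix y show "S y = inv T y"
    proof (rule cinner_eqI)
      fix z
      have "cinner z (S y) = cinner z (inv T y)" using S * by metis
      then show "cinner (S y) z = cinner (inv T y) z"
        using cinner_commute[of "S y" z] cinner_commute[of "inv T y" z] by simp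
    qed
  qed
qed

section \<open>Unitary groups and their generators\<close>

lemma unitary_groupD:
  assumes "unitary_group U"
  shows unitary_group_unitary: "unitary (U t)" and unitary_group_0: "U 0 = id"
    and unitary_group_add: "U (s + t) x = U s (U t x)"
    and unitary_group_continuous: "continuous_on UNIV (\<lambda>t. U t x)"
  using assms by (auto simp: unitary_group_def)

lemma unitary_group_minus: "unitary_group U \<Longrightarrow> U (- t) (U t x) = x"
  using unitary_group_add[of U "-t" t x] by (simp add: unitary_group_0)

lemma unitary_group_minus': "unitary_group U \<Longrightarrow> U t (U (- t) x) = x"
  using unitary_group_minus[of U "-t" x] by simp

lemma unitary_group_cinner:
  "unitary_group U \<Longrightarrow> cinner (U t x) y = cinner x (U (- t) y)"
  using unitary_cinner[OF unitary_group_unitary, of U t x "U (- t) y"]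
  by (simp add: unitary_group_minus')

lemma unitary_group_isCont: "unitary_group U \<Longrightarrow> ((\<lambda>t. U t x) \<longlongrightarrow> U s x) (at s)"
  using unitary_group_continuous[of U x] by (simp add: continuous_on_eq_continuous_at isCont_def)

lemma generator_iff:
  "(f, g) \<in> generator U \<longleftrightarrow>
    ((\<lambda>t. (1 / (\<i> * complex_of_real t)) *\<^sub>C (U t f - f)) \<longlongrightarrow> g) (at 0)"
  by (simp add: generator_def)

lemma generator_invariant:
  assumes U: "unitary_group U" and "(f, g) \<in> generator U"
  shows "(U s f, U s g) \<in> generator U"
proof -
  have "(\<lambda>t. U s ((1 / (\<i> * complex_of_real t)) *\<^sub>C (U t f - f))) =
      (\<lambda>t. (1 / (\<i> * complex_of_real t)) *\<^sub>C (U t (U s f) - U s f))"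
    by (simp add: clinear_diff[OF unitary_clinear[OF unitary_group_unitary[OF U]]]
        clinear_scaleC[OF unitary_clinear[OF unitary_group_unitary[OF U]]] add.commute
        flip: unitary_group_add[OF U])
  then show ?thesis
    using unitary_tendsto[OF unitary_group_unitary[OF U] assms(2)[unfolded generator_iff], of s]
    by (simp add: generator_iff)
qed

text \<open>The adjoint of the difference quotient at t is the difference quotient at -t, since
  \<open>U t\<close> moves across as \<open>U (- t)\<close> and \<open>1 / (\<i> t)\<close> is
  conjugated to \<open>1 / (\<i> (- t))\<close>. Both quotients have the same limit at 0.\<close>

lemma generator_symmetric:
  assumes U: "unitary_group U" and f: "(f, f') \<in> generator U" and g: "(g, g') \<in> generator U"
  shows "cinner f' g = cinner f g'"
proof (rule tendsto_unique[of "at (0::real)"])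
  let ?d = "\<lambda>f t. (1 / (\<i> * complex_of_real t)) *\<^sub>C (U t f - f)"
  show "((\<lambda>t. cinner (?d f t) g) \<longlongrightarrow> cinner f' g) (at 0)"
    by (intro tendsto_cinner tendsto_const f[unfolded generator_iff])
  have "((\<lambda>t. ?d g (- t)) \<longlongrightarrow> g') (at 0)"
    using g[unfolded generator_iff] filtermap_at_minus[of "0::real"]
      filterlim_filtermap[of "?d g" "nhds g'" uminus "at 0"] by simp
  then have "((\<lambda>t. cinner f (?d g (- t))) \<longlongrightarrow> cinner f g') (at 0)"
    by (intro tendsto_cinner tendsto_const)
  moreover have "cinner f (?d g (- t)) = cinner (?d f t) g" for t
    by (simp add: cinner_scaleC_left cinner_scaleC_right cinner_diff_left cinner_diff_right
        unitary_group_cinner[OF U])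
  ultimately show "((\<lambda>t. cinner (?d f t) g) \<longlongrightarrow> cinner f g') (at 0)" by simp
qed simp

section \<open>Differentiable orbits and uniqueness of the group with a given generator\<close>

lemma has_vector_derivative_iff_tendsto:
  fixes f :: "real \<Rightarrow> 'a::real_normed_vector"
  shows "(f has_vector_derivative D) (at x) \<longleftrightarrow> ((\<lambda>h. (f (x + h) - f x) /\<^sub>R h) \<longlongrightarrow> D) (at 0)"
proof -
  have "norm (f (x + h) - f x - h *\<^sub>R D) / norm h = norm ((f (x + h) - f x) /\<^sub>R h - D)"
    if "h \<noteq> 0" for h
  proof -
    have "(f (x + h) - f x) /\<^sub>R h - D = (f (x + h) - f x - h *\<^sub>R D) /\<^sub>R h"
      using that by (simp add: scaleR_diff_right)
    then show ?thesis by (simp add: divide_inverse mult.commute)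
  qed
  then have "((\<lambda>h. norm (f (x + h) - f x - h *\<^sub>R D) / norm h) \<longlongrightarrow> 0) (at 0) \<longleftrightarrow>
      ((\<lambda>h. norm ((f (x + h) - f x) /\<^sub>R h - D)) \<longlongrightarrow> 0) (at 0)"
    by (intro Lim_cong_within) auto
  also have "\<dots> \<longleftrightarrow> ((\<lambda>h. (f (x + h) - f x) /\<^sub>R h) \<longlongrightarrow> D) (at 0)"
    by (simp only: tendsto_norm_zero_iff LIM_zero_iff)
  finally show ?thesis
    by (simp add: has_vector_derivative_def has_derivative_at bounded_linear_scaleR_left)
qed

text \<open>The abstract Schroedinger equation: invariance of the generator under the group carries
  the derivative at time 0 to every time.\<close>

lemma generator_has_vector_derivative:
  assumes U: "unitary_group U" and f: "(f, g) \<in> generator U"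
  shows "((\<lambda>t. U t f) has_vector_derivative \<i> *\<^sub>C U t g) (at t)"
proof -
  have "((\<lambda>h. \<i> *\<^sub>C ((1 / (\<i> * complex_of_real h)) *\<^sub>C (U h (U t f) - U t f))) \<longlongrightarrow> \<i> *\<^sub>C U t g) (at 0)"
    using generator_invariant[OF U f, of t] unfolding generator_iff
    by (intro tendsto_scaleC tendsto_const)
  moreover have "\<i> *\<^sub>C ((1 / (\<i> * complex_of_real h)) *\<^sub>C (U h (U t f) - U t f)) =
      (U (t + h) f - U t f) /\<^sub>R h" for h
    by (simp add: scaleC_scaleC add.commute[of t h] unitary_group_add[OF U] inverse_eq_divide
        flip: scaleC_of_real)
  ultimately have "((\<lambda>h. (U (t + h) f - U t f) /\<^sub>R h) \<longlongrightarrow> \<i> *\<^sub>C U t g) (at 0)" by simp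
  then show ?thesis by (simp add: has_vector_derivative_iff_tendsto)
qed

lemma unitary_group_cinner_deriv:
  assumes U: "unitary_group U" "(f, f') \<in> generator U" and V: "unitary_group V" "(g, g') \<in> generator V"
  shows "((\<lambda>t. cinner (U t f) (V t g)) has_vector_derivative
    (\<i> * cinner (U t f') (V t g) - \<i> * cinner (U t f) (V t g'))) (at t)"
  using bounded_bilinear.has_vector_derivative[OF bounded_bilinear_cinner
      generator_has_vector_derivative[OF U, of t] generator_has_vector_derivative[OF V, of t]]
  by (simp add: cinner_scaleC_left cinner_scaleC_right algebra_simps)

lemma continuous_closure_eq:
  fixes f g :: "'a::topological_space \<Rightarrow> 'b::t2_space"
  assumes "continuous_on UNIV f" "continuous_on UNIV g" "\<And>x. x \<in> S \<Longrightarrow> f x = g x" "x \<in> closure S"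
  shows "f x = g x"
proof -
  have "closed {x. f x = g x}" using assms by (intro closed_Collect_eq)
  then have "closure S \<subseteq> {x. f x = g x}" using assms by (intro closure_minimal) auto
  then show ?thesis using assms by auto
qed

text \<open>The inner product of the two evolutions of a vector in the domain is constant in time, which
  forces them to coincide.\<close>

lemma unitary_group_unique:
  assumes U: "unitary_group U" and V: "unitary_group V" and eq: "generator U = generator V"
    and dense: "closure (fst ` generator U) = UNIV"
  shows "U = V"
proof -
  have on: "U t f = V t f" if f: "(f, g) \<in> generator U" for t f g
  proof -
    have "((\<lambda>t. cinner (U t f) (V t f)) has_vector_derivative 0) (at t)" for t
    proof -
      have "cinner (U t g) (V t f) = cinner (U t f) (V t g)" for t
        using generator_symmetric[OF U generator_invariant[OF U f], of "V t f" "V t g" t]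
          generator_invariant[OF V, of f g t] f eq by simp
      then show ?thesis
        using unitary_group_cinner_deriv[OF U f V f[unfolded eq], of t] by simp
    qed
    then have "cinner (U t f) (V t f) = cinner (U 0 f) (V 0 f)"
      using has_vector_derivative_zero_constant[of UNIV "\<lambda>t. cinner (U t f) (V t f)"]
      by (metis convex_UNIV UNIV_I)
    then have "cinner (U t f) (V t f) = complex_of_real ((norm f)\<^sup>2)"
      by (simp add: unitary_group_0 U V cinner_self)
    then have "(norm (U t f - V t f))\<^sup>2 = 0"
      by (simp add: norm_diff_sq_cinner unitary_norm[OF unitary_group_unitary] U V)
    then show ?thesis by simp
  qed
  have "U t f = V t f" for t f
  proof -
    have "f \<in> closure (fst ` generator U)" using dense by simp
    moreover have "continuous_on UNIV (U t)" "continuous_on UNIV (V t)"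
      by (simp_all add: unitary_continuous unitary_group_unitary U V)
    ultimately show ?thesis
      using on by (intro continuous_closure_eq[of "U t" "V t" "fst ` generator U" f]) auto
  qed
  then show ?thesis by blast
qed

text \<open>Mean value inequality for \<open>U s f - s *\<^sub>R (\<i> *\<^sub>C g)\<close>, whose
  derivative is \<open>\<i> *\<^sub>C (U s g - g)\<close>. The right-hand side involves only the
  continuity of the orbit of \<open>g\<close>, which lets the estimate survive limits of pairs
  \<open>(f, g)\<close>.\<close>

lemma generator_norm_bound:
  assumes U: "unitary_group U" and f: "(f, g) \<in> generator U"
    and e: "\<And>s. \<bar>s\<bar> \<le> \<bar>t\<bar> \<Longrightarrow> norm (U s g - g) \<le> e"
  shows "norm (U t f - f - (\<i> * complex_of_real t) *\<^sub>C g) \<le> \<bar>t\<bar> * e"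
proof -
  let ?h = "\<lambda>s. U s f - s *\<^sub>R (\<i> *\<^sub>C g)"
  have d: "(?h has_vector_derivative \<i> *\<^sub>C (U s g - g)) (at s within S)" for s S
  proof -
    have "((\<lambda>s. s *\<^sub>R (\<i> *\<^sub>C g)) has_vector_derivative s *\<^sub>R 0 + 1 *\<^sub>R (\<i> *\<^sub>C g)) (at s)"
      by (intro has_vector_derivative_scaleR DERIV_ident has_vector_derivative_const)
    then have "(?h has_vector_derivative \<i> *\<^sub>C U s g - (s *\<^sub>R 0 + 1 *\<^sub>R (\<i> *\<^sub>C g))) (at s)"
      by (intro has_vector_derivative_diff generator_has_vector_derivative[OF U f])
    then show ?thesis
      by (rule has_vector_derivative_at_within[OF has_vector_derivative_eq_rhs]) (simp add: scaleC_diff_right)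
  qed
  have "norm (?h t - ?h 0) \<le> e * norm (t - 0)"
  proof (rule differentiable_bound[of "cball 0 \<bar>t\<bar>" ?h "\<lambda>s r. r *\<^sub>R \<i> *\<^sub>C (U s g - g)"])
    show "(?h has_derivative (\<lambda>r. r *\<^sub>R \<i> *\<^sub>C (U s g - g))) (at s within cball 0 \<bar>t\<bar>)" for s
      using d[unfolded has_vector_derivative_def] .
    show "onorm (\<lambda>r. r *\<^sub>R \<i> *\<^sub>C (U s g - g)) \<le> e" if "s \<in> cball 0 \<bar>t\<bar>" for s
    proof (rule onorm_bound)
      show "0 \<le> e" using order_trans[OF norm_ge_zero e[of 0]] by simp
      show "norm (r *\<^sub>R \<i> *\<^sub>C (U s g - g)) \<le> e * norm r" for r
        using mult_left_mono[OF e[of s], of "\<bar>r\<bar>"] that by (simp add: norm_scaleC mult.commute)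
    qed
  qed auto
  then show ?thesis
    by (simp add: unitary_group_0[OF U] algebra_simps flip: scaleC_of_real)
      (simp add: scaleC_scaleC mult.commute)
qed

text \<open>By unitarity \<open>U s (gs n) - gs n\<close> differs from \<open>U s g - g\<close> by
  at most \<open>2 * norm (gs n - g)\<close> for every s. The remainder estimate for the pairs
  \<open>(fs n, gs n)\<close> therefore passes to \<open>(f, g)\<close>, where continuity of the
  orbit of \<open>g\<close> at 0 finishes the argument.\<close>

lemma closed_generator:
  assumes U: "unitary_group U"
  shows "closed (generator U)"
  unfolding closed_sequential_limits
proof (intro allI impI, elim conjE)
  fix x l assume x: "\<forall>n. x n \<in> generator U" and lim: "x \<longlonglongrightarrow> l"
  obtain f g where l: "l = (f, g)" by (cases l)
  define fs gs where "fs n = fst (x n)" and "gs n = snd (x n)" for n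
  have fg: "(fs n, gs n) \<in> generator U" for n using x by (simp add: fs_def gs_def)
  have fs: "fs \<longlonglongrightarrow> f" using tendsto_fst[OF lim] by (simp add: fs_def[abs_def] l)
  have gs: "gs \<longlonglongrightarrow> g" using tendsto_snd[OF lim] by (simp add: gs_def[abs_def] l)
  have bound: "norm (U t f - f - (\<i> * complex_of_real t) *\<^sub>C g) \<le> \<bar>t\<bar> * e"
    if e: "\<And>s. \<bar>s\<bar> \<le> \<bar>t\<bar> \<Longrightarrow> norm (U s g - g) \<le> e" for t e
  proof -
    have "norm (U t (fs n) - fs n - (\<i> * complex_of_real t) *\<^sub>C gs n) \<le> \<bar>t\<bar> * (e + 2 * norm (gs n - g))" for n
    proof (rule generator_norm_bound[OF U fg])
      fix s assume "\<bar>s\<bar> \<le> \<bar>t\<bar>"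
      have "U s (gs n) - gs n = U s (gs n - g) - (gs n - g) + (U s g - g)"
        by (simp add: clinear_diff unitary_clinear unitary_group_unitary U)
      also have "norm \<dots> \<le> norm (U s (gs n - g)) + norm (gs n - g) + norm (U s g - g)"
        by (meson add_right_mono norm_triangle_ineq norm_triangle_ineq4 order_trans)
      also have "\<dots> \<le> e + 2 * norm (gs n - g)"
        using e[OF \<open>\<bar>s\<bar> \<le> \<bar>t\<bar>\<close>] by (simp add: unitary_norm unitary_group_unitary U)
      finally show "norm (U s (gs n) - gs n) \<le> e + 2 * norm (gs n - g)" .
    qed
    moreover have "(\<lambda>n. norm (U t (fs n) - fs n - (\<i> * complex_of_real t) *\<^sub>C gs n)) \<longlonglongrightarrow>
        norm (U t f - f - (\<i> * complex_of_real t) *\<^sub>C g)"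
      by (intro tendsto_norm tendsto_diff tendsto_scaleC tendsto_const fs gs
          unitary_tendsto[OF unitary_group_unitary[OF U]])
    moreover have "(\<lambda>n. \<bar>t\<bar> * (e + 2 * norm (gs n - g))) \<longlonglongrightarrow> \<bar>t\<bar> * (e + 2 * norm (g - g))"
      by (intro tendsto_intros gs)
    ultimately show ?thesis using LIMSEQ_le by fastforce
  qed
  have "(f, g) \<in> generator U"
    unfolding generator_iff
  proof (rule tendstoI)
    fix e :: real assume "e > 0"
    have "((\<lambda>t. U t g) \<longlongrightarrow> g) (at 0)" using unitary_group_isCont[OF U, of g 0] by (simp add: unitary_group_0[OF U])
    then have "\<forall>\<^sub>F t in at 0. dist (U t g) g < e / 2" using \<open>e > 0\<close> by (intro tendstoD) auto
    then obtain d where "d > 0" and d: "\<And>s. s \<noteq> 0 \<Longrightarrow> \<bar>s\<bar> < d \<Longrightarrow> norm (U s g - g) < e / 2"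
      unfolding eventually_at by (auto simp: dist_norm)
    show "\<forall>\<^sub>F t in at 0. dist ((1 / (\<i> * complex_of_real t)) *\<^sub>C (U t f - f)) g < e"
      unfolding eventually_at
    proof (intro exI[of _ d] conjI \<open>d > 0\<close> ballI impI, elim conjE)
      fix t :: real assume "t \<noteq> 0" "dist t 0 < d"
      have s: "norm (U s g - g) \<le> e / 2" if "\<bar>s\<bar> \<le> \<bar>t\<bar>" for s
        using d[of s] that \<open>dist t 0 < d\<close> \<open>e > 0\<close> by (cases "s = 0") (auto simp: unitary_group_0[OF U])
      let ?c = "1 / (\<i> * complex_of_real t)"
      have "?c *\<^sub>C (U t f - f) - g = ?c *\<^sub>C (U t f - f - (\<i> * complex_of_real t) *\<^sub>C g)"
        using \<open>t \<noteq> 0\<close> by (simp add: scaleC_diff_right scaleC_scaleC)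
      then have "dist (?c *\<^sub>C (U t f - f)) g = norm (U t f - f - (\<i> * complex_of_real t) *\<^sub>C g) / \<bar>t\<bar>"
        by (simp add: dist_norm norm_scaleC norm_divide norm_mult)
      also have "\<dots> \<le> e / 2"
        using bound[OF s] \<open>t \<noteq> 0\<close> by (simp add: divide_le_eq mult.commute)
      finally show "dist (?c *\<^sub>C (U t f - f)) g < e" using \<open>e > 0\<close> by simp
    qed
  qed
  then show "l \<in> generator U" by (simp add: l)
qed

text \<open>If \<open>A\<close> is symmetric then \<open>\<parallel>A f + i f\<parallel>\<^sup>2 = \<parallel>A f\<parallel>\<^sup>2 + \<parallel>f\<parallel>\<^sup>2\<close>, so approximating \<open>A f + i f\<close>
  approximates \<open>f\<close> and \<open>A f\<close> separately.\<close>

lemma closure_eq_generator: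
  assumes U: "unitary_group U" and sub: "A \<subseteq> generator U"
    and dense: "closure ((\<lambda>(f, g). g + \<i> *\<^sub>C f) ` A) = UNIV"
  shows "closure A = generator U"
proof
  show "closure A \<subseteq> generator U" by (simp add: U closed_generator closure_minimal sub)
  show "generator U \<subseteq> closure A"
  proof
    fix x assume x: "x \<in> generator U"
    obtain f g where fg: "x = (f, g)" by (cases x)
    show "x \<in> closure A"
      unfolding closure_approachable
    proof (intro allI impI)
      fix e :: real assume "e > 0"
      have "g + \<i> *\<^sub>C f \<in> closure ((\<lambda>(f, g). g + \<i> *\<^sub>C f) ` A)" using dense by simp
      then obtain f' g' where A: "(f', g') \<in> A" and d: "dist (g' + \<i> *\<^sub>C f') (g + \<i> *\<^sub>C f) < e"
        unfolding closure_approachable using \<open>e > 0\<close> by fastforce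
      have gf: "(f' - f, g' - g) \<in> generator U"
      proof -
        have "(f', g') \<in> generator U" using A sub by blast
        then have "((\<lambda>t. (1 / (\<i> * complex_of_real t)) *\<^sub>C (U t f' - f') -
            (1 / (\<i> * complex_of_real t)) *\<^sub>C (U t f - f)) \<longlongrightarrow> g' - g) (at 0)"
          using x unfolding fg generator_iff by (intro tendsto_diff)
        moreover have "c *\<^sub>C (U t f' - f') - c *\<^sub>C (U t f - f) = c *\<^sub>C (U t (f' - f) - (f' - f))" for t c
          by (simp add: U clinear_diff unitary_clinear unitary_group_unitary scaleC_diff_right)
        ultimately show ?thesis by (simp only: generator_iff)
      qed
      let ?f = "f' - f" and ?g = "g' - g"
      have "complex_of_real ((norm (?g + \<i> *\<^sub>C ?f))\<^sup>2) = complex_of_real ((norm ?g)\<^sup>2 + (norm ?f)\<^sup>2)"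
        using generator_symmetric[OF U gf gf]
        unfolding cinner_self[symmetric] of_real_add
        by (simp add: cinner_add_left cinner_add_right cinner_scaleC_left cinner_scaleC_right
            distrib_left flip: mult.assoc)
      then have "(norm (?g + \<i> *\<^sub>C ?f))\<^sup>2 = (norm ?f)\<^sup>2 + (norm ?g)\<^sup>2" by (metis add.commute of_real_eq_iff)
      then have "dist (f', g') x = norm (?g + \<i> *\<^sub>C ?f)"
        unfolding fg dist_norm norm_Pair by (simp add: real_sqrt_unique norm_Pair)
      also have "?g + \<i> *\<^sub>C ?f = (g' + \<i> *\<^sub>C f') - (g + \<i> *\<^sub>C f)"
        by (simp add: scaleC_diff_right)
      finally show "\<exists>y\<in>A. dist y x < e" using A d by (auto simp: dist_norm intro!: bexI[of _ "(f', g')"])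
    qed
  qed
qed

section \<open>Density of subspaces with trivial orthogonal complement\<close>

text \<open>The projection theorem: a sequence in \<open>M\<close> minimising the distance to x
  converges to some l, and x - l is orthogonal to \<open>M\<close>, hence zero.\<close>

lemma dense_subspace_of_orthogonal_trivial:
  fixes M :: "'a::{real_inner, complete_space} set"
  assumes M: "subspace M" and orth: "\<And>x. (\<And>y. y \<in> M \<Longrightarrow> inner x y = 0) \<Longrightarrow> x = 0"
  shows "closure M = UNIV"
proof -
  have "x \<in> closure M" for x
  proof -
    define d where "d = infdist x M"
    have M0: "M \<noteq> {}" using subspace_0[OF M] by blast
    have dle: "d \<le> norm (x - y)" if "y \<in> M" for y
      using infdist_le[OF that, of x] by (simp add: d_def dist_norm)
    have d0: "d \<ge> 0" by (simp add: d_def infdist_nonneg)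
    have "\<exists>y\<in>M. norm (x - y) < d + 1 / real (Suc n)" for n
    proof (rule ccontr)
      assume "\<not> ?thesis"
      then have "d + 1 / real (Suc n) \<le> infdist x M"
        unfolding infdist_notempty[OF M0]
        by (intro cINF_greatest M0) (auto simp: dist_norm not_less)
      then show False by (simp add: d_def)
    qed
    then obtain y where y: "\<And>n. y n \<in> M" and yd: "\<And>n. norm (x - y n) < d + 1 / real (Suc n)"
      by metis
    \<comment> \<open>The midpoint of \<open>y m\<close> and \<open>y n\<close> lies in
      \<open>M\<close>, so its distance to x is at least d. The parallelogram law then bounds the
      gap by the excess of the two squared distances over d squared.\<close>
    have near: "(norm (y m - y n))\<^sup>2 \<le> (8 * d + 4) / real (Suc N)" if "m \<ge> N" "n \<ge> N" for m n N
    proof -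
      have "(1/2) *\<^sub>R (y m + y n) \<in> M" by (simp add: M subspace_add subspace_scale y)
      then have "d\<^sup>2 \<le> (norm (x - (1/2) *\<^sub>R (y m + y n)))\<^sup>2"
        using d0 dle by (intro power_mono) auto
      moreover have "(norm (y m - y n))\<^sup>2 = 2 * (norm (x - y m))\<^sup>2 + 2 * (norm (x - y n))\<^sup>2
          - 4 * (norm (x - (1/2) *\<^sub>R (y m + y n)))\<^sup>2"
        by (simp add: power2_norm_eq_inner inner_diff_left inner_diff_right inner_add_left
            inner_add_right inner_commute algebra_simps)
      moreover have "(norm (x - y k))\<^sup>2 \<le> d\<^sup>2 + (2 * d + 1) / real (Suc N)" if "k \<ge> N" for k
      proof -
        let ?e = "1 / real (Suc N)"
        have "1 / real (Suc k) \<le> ?e" using that by (simp add: frac_le)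
        then have "norm (x - y k) \<le> d + ?e" using yd[of k] by linarith
        then have "(norm (x - y k))\<^sup>2 \<le> (d + ?e)\<^sup>2" by (intro power_mono) auto
        also have "\<dots> = d\<^sup>2 + 2 * d * ?e + ?e * ?e" by (simp add: power2_eq_square algebra_simps)
        also have "?e * ?e \<le> 1 * ?e" by (intro mult_right_mono) auto
        finally show ?thesis by (simp add: add_divide_distrib)
      qed
      ultimately have "(norm (y m - y n))\<^sup>2 \<le> 4 * ((2 * d + 1) / real (Suc N))"
        using that by (smt (verit))
      then show ?thesis by (simp add: algebra_simps)
    qed
    have "Cauchy y"
    proof (rule metric_CauchyI)
      fix e :: real assume "e > 0"
      obtain N where N: "(8 * d + 4) / e\<^sup>2 < real N" using reals_Archimedean2 by blast
      then have "(8 * d + 4) / real (Suc N) < e\<^sup>2"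
      proof -
        have "8 * d + 4 < real N * e\<^sup>2" using N \<open>e > 0\<close> by (simp add: divide_less_eq)
        also have "\<dots> \<le> e\<^sup>2 * real (Suc N)" by (simp add: algebra_simps)
        finally show ?thesis by (simp add: divide_less_eq)
      qed
      then have "norm (y m - y n) < e" if "m \<ge> N" "n \<ge> N" for m n
        using near[OF that] \<open>e > 0\<close> by (intro power2_less_imp_less[of "norm (y m - y n)" e]) auto
      then show "\<exists>N. \<forall>m\<ge>N. \<forall>n\<ge>N. dist (y m) (y n) < e" by (auto simp: dist_norm)
    qed
    then obtain l where l: "y \<longlonglongrightarrow> l" by (metis Cauchy_convergent_iff convergent_def)
    have ld: "norm (x - l) \<le> d"
    proof (rule LIMSEQ_le)
      show "(\<lambda>n. norm (x - y n)) \<longlonglongrightarrow> norm (x - l)" by (intro tendsto_intros l)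
      have "(\<lambda>n. d + 1 / real (Suc n)) \<longlonglongrightarrow> d + 0" by (intro tendsto_intros LIMSEQ_Suc lim_1_over_n)
      then show "(\<lambda>n. d + 1 / real (Suc n)) \<longlonglongrightarrow> d" by simp
    qed (use yd less_imp_le in blast)
    have ge: "d \<le> norm (x - l - z)" if "z \<in> M" for z
    proof (rule LIMSEQ_le_const)
      show "(\<lambda>n. norm (x - y n - z)) \<longlonglongrightarrow> norm (x - l - z)" by (intro tendsto_intros l)
      show "\<exists>N. \<forall>n\<ge>N. d \<le> norm (x - y n - z)"
        using dle[OF subspace_add[OF M y that]] by (simp add: diff_diff_eq)
    qed
    have "inner (x - l) z = 0" if z: "z \<in> M" for z
    proof (rule ccontr)
      let ?a = "inner (x - l) z"
      assume a: "?a \<noteq> 0"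
      then have nz: "inner z z > 0" by auto
      \<comment> \<open>This t minimises the quadratic
        \<open>(norm (x - l - t *\<^sub>R z))\<^sup>2\<close>; a nonzero inner product would push
        the distance below d.\<close>
      define t where "t = ?a / inner z z"
      have "d\<^sup>2 \<le> (norm (x - l - t *\<^sub>R z))\<^sup>2"
        using ge[OF subspace_scale[OF M z]] d0 by (intro power_mono)
      also have "\<dots> = (norm (x - l))\<^sup>2 - 2 * t * ?a + t * t * inner z z"
        unfolding power2_norm_eq_inner
        by (simp add: inner_diff_left inner_diff_right inner_commute algebra_simps)
      also have "\<dots> = (norm (x - l))\<^sup>2 - ?a * ?a / inner z z"
        using nz by (simp add: t_def field_simps)
      also have "\<dots> < (norm (x - l))\<^sup>2" using a nz by (simp add: power2_eq_square[symmetric])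
      also have "\<dots> \<le> d\<^sup>2" using ld by (intro power_mono) auto
      finally show False by simp
    qed
    then have "x - l = 0" by (rule orth)
    then show ?thesis using l y closure_sequential[of x M] by auto
  qed
  then show ?thesis by blast
qed

section \<open>Orthonormal expansions\<close>

lift_definition unit_ell2 :: "nat \<Rightarrow> ell2" is "\<lambda>n k. if k = n then 1 else 0"
  by (rule summable_finite[of "{n}" for n]) auto

lemma ell2_nth_simps [simp]:
  "ell2_nth (f + g) n = ell2_nth f n + ell2_nth g n" "ell2_nth (- f) n = - ell2_nth f n"
  "ell2_nth (f - g) n = ell2_nth f n - ell2_nth g n"
  "ell2_nth (a *\<^sub>C f) n = a * ell2_nth f n" "ell2_nth 0 n = 0"
  "ell2_nth (unit_ell2 m) n = (if n = m then 1 else 0)"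
proof -
  show add: "ell2_nth (f + g) n = ell2_nth f n + ell2_nth g n" for f g by transfer simp
  show minus: "ell2_nth (- f) n = - ell2_nth f n" for f by transfer simp
  show "ell2_nth (f - g) n = ell2_nth f n - ell2_nth g n"
    by (simp only: diff_conv_add_uminus add minus)
qed (transfer, simp)+

lemma ell2_nth_sum: "ell2_nth (\<Sum>i\<in>I. f i) n = (\<Sum>i\<in>I. ell2_nth (f i) n)"
  by (induction I rule: infinite_finite_induct) auto

lemma ell2_eqI: "(\<And>n. ell2_nth f n = ell2_nth g n) \<Longrightarrow> f = g"
  by (metis ell2_nth_inject ext)

lemma cinner_ell2_sums: "(\<lambda>n. ell2_nth f n * cnj (ell2_nth g n)) sums cinner f g"
  unfolding cinner_ell2_def by (rule summable_sums[OF summable_cinner_ell2])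

lemma cinner_unit_ell2: "cinner f (unit_ell2 n) = ell2_nth f n"
proof -
  have "(\<lambda>k. ell2_nth f k * cnj (ell2_nth (unit_ell2 n) k)) =
      (\<lambda>k. if k = n then ell2_nth f k else 0)" by auto
  then show ?thesis
    using sums_unique2[OF cinner_ell2_sums[of f "unit_ell2 n"]] sums_single[of n "ell2_nth f"] by simp
qed

definition trunc_ell2 :: "nat \<Rightarrow> ell2 \<Rightarrow> ell2" where
  "trunc_ell2 N f = (\<Sum>n<N. ell2_nth f n *\<^sub>C unit_ell2 n)"

lemma finite_support_eq_sum:
  assumes "f \<in> finite_support"
  obtains N where "f = trunc_ell2 N f"
proof -
  obtain N where N: "{n. ell2_nth f n \<noteq> 0} \<subseteq> {..<N}"
    using assms finite_nat_iff_bounded[of "{n. ell2_nth f n \<noteq> 0}"] by (auto simp: finite_support_def)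
  have "f = trunc_ell2 N f"
    by (rule ell2_eqI) (use N in \<open>auto simp: trunc_ell2_def ell2_nth_sum if_distrib cong: if_cong\<close>)
  then show ?thesis by (rule that)
qed

lemma trunc_ell2_finite_support: "trunc_ell2 N f \<in> finite_support"
proof -
  have "{n. ell2_nth (trunc_ell2 N f) n \<noteq> 0} \<subseteq> {..<N}"
    by (auto simp: trunc_ell2_def ell2_nth_sum if_distrib cong: if_cong)
  then show ?thesis unfolding finite_support_def using finite_subset by blast
qed

text \<open>The inner product of f with its truncation and the squared norm of the truncation are
  the same partial sum, so the squared error is the tail of the series for
  \<open>cinner f f\<close>.\<close>

lemma trunc_ell2_tendsto: "(\<lambda>N. trunc_ell2 N f) \<longlonglongrightarrow> f"
proof -
  have c: "cinner f (trunc_ell2 N f) = (\<Sum>n<N. ell2_nth f n * cnj (ell2_nth f n))"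
    "cinner (trunc_ell2 N f) (trunc_ell2 N f) = (\<Sum>n<N. ell2_nth f n * cnj (ell2_nth f n))" for N
    by (simp_all add: trunc_ell2_def cinner_sum_right cinner_sum_left cinner_scaleC_right
        cinner_scaleC_left cinner_unit_ell2 mult.commute ell2_nth_sum if_distrib cong: if_cong)
  have "(\<lambda>N. cinner (f - trunc_ell2 N f) (f - trunc_ell2 N f)) = 
      (\<lambda>N. cinner f f - cnj (\<Sum>n<N. ell2_nth f n * cnj (ell2_nth f n)))"
    using cinner_commute[of "trunc_ell2 _ f" f]
    by (simp add: cinner_diff_left cinner_diff_right c)
  moreover have "\<dots> \<longlonglongrightarrow> cinner f f - cnj (cinner f f)"
    by (intro tendsto_intros cinner_ell2_sums[unfolded sums_def])
  ultimately have "(\<lambda>N. complex_of_real ((norm (f - trunc_ell2 N f))\<^sup>2)) \<longlonglongrightarrow> 0"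
    by (simp add: cinner_self)
  then have "(\<lambda>N. (norm (f - trunc_ell2 N f))\<^sup>2) \<longlonglongrightarrow> 0"
    using tendsto_of_real_iff[of "\<lambda>N. (norm (f - trunc_ell2 N f))\<^sup>2" "0::real", where 'a = complex]
    by (simp del: of_real_power)
  then have "(\<lambda>N. sqrt ((norm (f - trunc_ell2 N f))\<^sup>2)) \<longlonglongrightarrow> sqrt 0" by (rule tendsto_real_sqrt)
  then have "(\<lambda>N. norm (trunc_ell2 N f - f)) \<longlonglongrightarrow> 0" by (simp add: norm_minus_commute)
  then show ?thesis by (simp only: tendsto_norm_zero_iff LIM_zero_iff)
qed

lemma closure_finite_support: "closure finite_support = UNIV"
proof -
  have "f \<in> closure finite_support" for f
    unfolding closure_sequential
    by (intro exI[of _ "\<lambda>N. trunc_ell2 N f"] conjI allI trunc_ell2_finite_support trunc_ell2_tendsto)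
  then show ?thesis by blast
qed

text \<open>The synthesis operator of the system \<open>b\<close>. For the Laguerre functions it
  turns out to be \<open>Phi p\<close>.\<close>

definition expansion :: "(nat \<Rightarrow> 'a::{complex_inner, banach}) \<Rightarrow> ell2 \<Rightarrow> 'a" where
  "expansion b f = (\<Sum>n. ell2_nth f n *\<^sub>C b n)"

context
  fixes b :: "nat \<Rightarrow> 'a::{complex_inner, banach}"
  assumes orthonormal: "\<And>m n. cinner (b m) (b n) = (if m = n then 1 else 0)"
begin

lemma expansion_partial_cinner:
  assumes "finite I"
  shows "cinner (\<Sum>n\<in>I. c n *\<^sub>C b n) (\<Sum>n\<in>I. d n *\<^sub>C b n) = (\<Sum>n\<in>I. c n * cnj (d n))"
  using assms by (simp add: cinner_sum_left cinner_sum_right cinner_scaleC_left cinner_scaleC_right orthonormal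
      if_distrib mult.commute cong: if_cong)

lemma expansion_partial_norm:
  assumes "finite I"
  shows "(norm (\<Sum>n\<in>I. c n *\<^sub>C b n))\<^sup>2 = (\<Sum>n\<in>I. (norm (c n))\<^sup>2)"
proof -
  have "complex_of_real ((norm (\<Sum>n\<in>I. c n *\<^sub>C b n))\<^sup>2) = complex_of_real (\<Sum>n\<in>I. (norm (c n))\<^sup>2)"
    unfolding cinner_self[symmetric] expansion_partial_cinner[OF assms] of_real_sum complex_norm_square ..
  then show ?thesis by (simp only: of_real_eq_iff)
qed

text \<open>By Pythagoras the Cauchy criterion for the vector series is the Cauchy criterion for the
  squared coefficients.\<close>

lemma expansion_summable: "summable (\<lambda>n. ell2_nth f n *\<^sub>C b n)"
  unfolding summable_Cauchy
proof (intro allI impI)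
  fix e :: real assume "e > 0"
  then obtain N where N: "\<And>m n. m \<ge> N \<Longrightarrow> norm (\<Sum>k=m..<n. (norm (ell2_nth f k))\<^sup>2) < e\<^sup>2"
    using summable_ell2[of f] unfolding summable_Cauchy by (meson zero_less_power)
  have "norm (\<Sum>k=m..<n. ell2_nth f k *\<^sub>C b k) < e" if "m \<ge> N" for m n
  proof (rule power2_less_imp_less)
    show "(norm (\<Sum>k=m..<n. ell2_nth f k *\<^sub>C b k))\<^sup>2 < e\<^sup>2"
      using N[OF that, of n] by (simp add: expansion_partial_norm)
  qed (use \<open>e > 0\<close> in simp)
  then show "\<exists>N. \<forall>m\<ge>N. \<forall>n. norm (\<Sum>k=m..<n. ell2_nth f k *\<^sub>C b k) < e" by blast
qed

lemma expansion_LIMSEQ: "(\<lambda>N. \<Sum>n<N. ell2_nth f n *\<^sub>C b n) \<longlonglongrightarrow> expansion b f"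
  unfolding expansion_def by (rule summable_LIMSEQ[OF expansion_summable])

lemma expansion_cinner: "cinner (expansion b f) (expansion b g) = cinner f g"
proof (rule LIMSEQ_unique)
  show "(\<lambda>N. cinner (\<Sum>n<N. ell2_nth f n *\<^sub>C b n) (\<Sum>n<N. ell2_nth g n *\<^sub>C b n))
      \<longlonglongrightarrow> cinner (expansion b f) (expansion b g)"
    by (intro tendsto_cinner expansion_LIMSEQ)
  show "(\<lambda>N. cinner (\<Sum>n<N. ell2_nth f n *\<^sub>C b n) (\<Sum>n<N. ell2_nth g n *\<^sub>C b n)) \<longlonglongrightarrow> cinner f g"
    using cinner_ell2_sums[of f g] by (simp add: expansion_partial_cinner sums_def)
qed

lemma expansion_clinear: "clinear (expansion b)"
  unfolding clinear_def
proof (intro conjI allI)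
  show "expansion b (f + g) = expansion b f + expansion b g" for f g
    unfolding expansion_def
    by (simp add: scaleC_add_left suminf_add expansion_summable)
  show "expansion b (a *\<^sub>C f) = a *\<^sub>C expansion b f" for a f
  proof (rule LIMSEQ_unique[OF expansion_LIMSEQ])
    show "(\<lambda>N. \<Sum>n<N. ell2_nth (a *\<^sub>C f) n *\<^sub>C b n) \<longlonglongrightarrow> a *\<^sub>C expansion b f"
      using tendsto_scaleC[OF tendsto_const expansion_LIMSEQ, of a f]
      by (simp add: scaleC_sum_right scaleC_scaleC)
  qed
qed

lemma expansion_unit: "expansion b (unit_ell2 n) = b n"
  unfolding expansion_def using suminf_finite[of "{n}" "\<lambda>k. ell2_nth (unit_ell2 n) k *\<^sub>C b k"]
  by simp

lemma expansion_trunc: "expansion b (trunc_ell2 N f) = (\<Sum>n<N. ell2_nth f n *\<^sub>C b n)"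
  by (simp add: trunc_ell2_def clinear_sum clinear_scaleC expansion_clinear expansion_unit)

text \<open>Orthonormality already gives an isometry. For surjectivity, Bessel's inequality puts the
  coefficients of x into \<open>ell2\<close>, and completeness annihilates the difference between x
  and their expansion.\<close>

lemma unitary_expansion:
  assumes complete: "\<And>x. (\<And>n. cinner x (b n) = 0) \<Longrightarrow> x = 0"
  shows "unitary (expansion b)"
  unfolding unitary_def
proof (intro conjI allI expansion_clinear expansion_cinner)
  show "surj (expansion b)"
    unfolding surj_def
  proof
    fix x
    define c where "c n = cinner x (b n)" for n
    have "(\<Sum>n<N. (norm (c n))\<^sup>2) \<le> (norm x)\<^sup>2" for N
    proof -
      let ?s = "\<Sum>n<N. c n *\<^sub>C b n"
      have "cinner x ?s = complex_of_real (\<Sum>n<N. (norm (c n))\<^sup>2)"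
        by (simp add: cinner_sum_right cinner_scaleC_right c_def[symmetric] complex_norm_square
            mult.commute flip: of_real_power)
      then have "(norm (x - ?s))\<^sup>2 = (norm x)\<^sup>2 - (\<Sum>n<N. (norm (c n))\<^sup>2)"
        by (simp add: norm_diff_sq_cinner expansion_partial_norm)
      then show ?thesis using zero_le_power2[of "norm (x - ?s)"] by linarith
    qed
    then have "summable (\<lambda>n. (norm (c n))\<^sup>2)"
      by (intro bounded_imp_summable[of _ "(norm x)\<^sup>2"]) (auto simp: lessThan_Suc_atMost[symmetric] simp del: sum.lessThan_Suc)
    then have nth: "ell2_nth (Abs_ell2 c) n = c n" for n
      by (simp add: Abs_ell2_inverse)
    have "x - expansion b (Abs_ell2 c) = 0"
    proof (rule complete)
      fix n
      have "cinner (expansion b (Abs_ell2 c)) (b n) = c n"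
        using expansion_cinner[of "Abs_ell2 c" "unit_ell2 n"]
        by (simp add: expansion_unit cinner_unit_ell2 nth)
      then show "cinner (x - expansion b (Abs_ell2 c)) (b n) = 0"
        by (simp add: cinner_diff_left c_def)
    qed
    then show "\<exists>f. x = expansion b f" by auto
  qed
qed

end

section \<open>Completeness of the space of square-integrable functions\<close>

lemma L2_class_simps:
  assumes "sq_integrable f"
  shows L2_class_scaleC: "a *\<^sub>C L2_class f = L2_class (\<lambda>x. a * f x)"
    and L2_class_add: "sq_integrable g \<Longrightarrow> L2_class f + L2_class g = L2_class (\<lambda>x. f x + g x)"
    and L2_class_uminus: "- L2_class f = L2_class (\<lambda>x. - f x)"
    and cinner_L2_class: "sq_integrable g \<Longrightarrow>
      cinner (L2_class f) (L2_class g) = (\<integral>x. f x * cnj (g x) \<partial>half_line)"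
  using assms
  by (simp_all add: scaleC_L2_half_line.abs_eq plus_L2_half_line.abs_eq uminus_L2_half_line.abs_eq
      cinner_L2_half_line.abs_eq L2_rel_def)

lemma sq_integrable_uminus: "sq_integrable f \<Longrightarrow> sq_integrable (\<lambda>x. - f x)"
  using sq_integrable_cmult[of f "-1"] by simp

lemma sq_integrable_diff: "sq_integrable f \<Longrightarrow> sq_integrable g \<Longrightarrow> sq_integrable (\<lambda>x. f x - g x)"
  using sq_integrable_add[of f "\<lambda>x. - g x"] sq_integrable_uminus by simp

lemma L2_class_diff:
  "sq_integrable f \<Longrightarrow> sq_integrable g \<Longrightarrow> L2_class f - L2_class g = L2_class (\<lambda>x. f x - g x)"
  using L2_class_add[of f "\<lambda>x. - g x"] L2_class_uminus[of g] sq_integrable_uminus[of g]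
  by (simp add: minus_L2_half_line_def)

lemma L2_class_sum:
  "(\<And>i. i \<in> I \<Longrightarrow> sq_integrable (f i)) \<Longrightarrow>
    sq_integrable (\<lambda>x. \<Sum>i\<in>I. f i x) \<and> (\<Sum>i\<in>I. L2_class (f i)) = L2_class (\<lambda>x. \<Sum>i\<in>I. f i x)"
proof (induction I rule: infinite_finite_induct)
  case (insert i I)
  then show ?case by (simp add: L2_class_add sq_integrable_add)
qed (simp_all add: sq_integrable_def zero_L2_half_line_def)

lemma L2_class_surj:
  obtains f where "sq_integrable f" "x = L2_class f"
proof (rule that)
  show "sq_integrable (L2_fun x)"
    using Quotient3_rep_reflp[OF Quotient3_L2_half_line, of x] by (simp add: L2_rel_def)
  show "x = L2_class (L2_fun x)"
    by (simp add: Quotient3_abs_rep[OF Quotient3_L2_half_line])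
qed

lemma norm_L2_class:
  assumes "sq_integrable f"
  shows "(norm (L2_class f))\<^sup>2 = (\<integral>x. (norm (f x))\<^sup>2 \<partial>half_line)"
proof -
  have "complex_of_real ((norm (L2_class f))\<^sup>2) = (\<integral>x. complex_of_real ((norm (f x))\<^sup>2) \<partial>half_line)"
    unfolding cinner_self[symmetric] cinner_L2_class[OF assms assms] complex_norm_square ..
  then show ?thesis by (simp only: integral_complex_of_real of_real_eq_iff)
qed

lemma L2_class_eq_iff:
  assumes "sq_integrable f" "sq_integrable g"
  shows "L2_class f = L2_class g \<longleftrightarrow> (AE x in half_line. f x = g x)"
  using assms Quotient3_rel[OF Quotient3_L2_half_line, of f g] by (auto simp: L2_rel_def)

lemma L2_class_eq_zero:
  assumes f: "sq_integrable f" and "AE x in half_line. f x = 0"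
  shows "L2_class f = 0"
proof -
  have "sq_integrable (\<lambda>_. 0)" by (simp add: sq_integrable_def)
  then show ?thesis using assms by (simp add: zero_L2_half_line_def L2_class_eq_iff)
qed

lemma nn_integral_norm_L2_class:
  assumes "sq_integrable f"
  shows "(\<integral>\<^sup>+x. ennreal ((norm (f x))\<^sup>2) \<partial>half_line) = ennreal ((norm (L2_class f))\<^sup>2)"
  using assms by (subst nn_integral_eq_integral) (auto simp: sq_integrable_def norm_L2_class)


lemma borel_measurable_half_line: "f \<in> borel_measurable borel \<Longrightarrow> f \<in> borel_measurable half_line"
  by (rule measurable_restrict_space1) simp

lemma nn_integral_half_line:
  "f \<in> borel_measurable lborel \<Longrightarrow>
    (\<integral>\<^sup>+x. f x \<partial>half_line) = (\<integral>\<^sup>+x. f x * indicator {0<..} x \<partial>lborel)"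
  by (rule nn_integral_restrict_space) auto

lemma nn_integral_exp_half_line: "(\<integral>\<^sup>+x. ennreal (exp (- x)) \<partial>half_line) \<le> 1"
proof -
  have "(\<integral>\<^sup>+x. ennreal (exp (- x)) \<partial>half_line) =
      (\<integral>\<^sup>+x. ennreal (exp (- x)) * indicator {0<..} x \<partial>lborel)"
    by (rule nn_integral_half_line) auto
  also have "\<dots> \<le> (\<integral>\<^sup>+x. ennreal (x ^ 0 * exp (- x)) * indicator {0..} x \<partial>lborel)"
    by (intro nn_integral_mono) (auto simp: indicator_def)
  also have "\<dots> = 1" by (subst nn_intergal_power_times_exp_Ici) simp
  finally show ?thesis .
qed

text \<open>The AM-GM bound \<open>|D| e\<^sup>-\<^sup>x\<^sup>/\<^sup>2 \<le> 2\<^sup>k |D|\<^sup>2 + 2\<^sup>-\<^sup>k e\<^sup>-\<^sup>x\<close> makes the increments of a fast Cauchy sequence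
  summable in a weighted \<open>L\<^sup>1\<close> space, hence almost everywhere.\<close>

lemma AE_convergent_of_fast_Cauchy:
  fixes G :: "nat \<Rightarrow> real \<Rightarrow> complex"
  assumes [measurable]: "\<And>k. G k \<in> borel_measurable half_line"
    and bound: "\<And>k. (\<integral>\<^sup>+x. ennreal ((norm (G (Suc k) x - G k x))\<^sup>2) \<partial>half_line) \<le> ennreal ((1/4) ^ k)"
  shows "AE x in half_line. convergent (\<lambda>k. G k x)"
proof -
  define D where "D k x = norm (G (Suc k) x - G k x) * exp (- x / 2)" for k x
  have [measurable]: "(\<lambda>x::real. exp (- x)) \<in> borel_measurable half_line"
    by (rule borel_measurable_half_line) measurable
  have [measurable]: "(\<lambda>x. exp (- x / 2)) \<in> borel_measurable half_line"
    by (rule borel_measurable_half_line) measurable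
  have [measurable]: "D k \<in> borel_measurable half_line" for k
    unfolding D_def by measurable
  have Dle: "D k x \<le> 2 ^ k * (norm (G (Suc k) x - G k x))\<^sup>2 + (1/2) ^ k * exp (- x)" for k x
  proof -
    let ?a = "norm (G (Suc k) x - G k x)" and ?b = "exp (- x / 2)"
    have c: "(1/2) ^ k * (2 ^ k :: real) = 1" by (simp flip: power_mult_distrib)
    have "0 \<le> (1/2) ^ k * (2 ^ k * ?a - ?b)\<^sup>2" by simp
    also have "\<dots> = ((1/2) ^ k * 2 ^ k) * 2 ^ k * ?a\<^sup>2 - 2 * ((1/2) ^ k * 2 ^ k) * (?a * ?b) + (1/2) ^ k * ?b\<^sup>2"
      by (simp only: power2_eq_square algebra_simps)
    finally have le: "2 * (?a * ?b) \<le> 2 ^ k * ?a\<^sup>2 + (1/2) ^ k * ?b\<^sup>2"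
      unfolding c by simp
    have e: "exp (- x) = ?b\<^sup>2" by (simp add: power2_eq_square flip: exp_add)
    have "0 \<le> ?a * ?b" by simp
    then show ?thesis unfolding D_def e using le by linarith
  qed
  have "(\<integral>\<^sup>+x. ennreal (D k x) \<partial>half_line) \<le> ennreal (2 * (1/2) ^ k)" for k
  proof -
    have "(\<integral>\<^sup>+x. ennreal (D k x) \<partial>half_line) \<le> (\<integral>\<^sup>+x. ennreal (2 ^ k) *
        ennreal ((norm (G (Suc k) x - G k x))\<^sup>2) + ennreal ((1/2) ^ k) * ennreal (exp (- x)) \<partial>half_line)"
      using Dle by (intro nn_integral_mono) (simp flip: ennreal_mult ennreal_plus)
    also have "\<dots> = ennreal (2 ^ k) * (\<integral>\<^sup>+x. ennreal ((norm (G (Suc k) x - G k x))\<^sup>2) \<partial>half_line) +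
        ennreal ((1/2) ^ k) * (\<integral>\<^sup>+x. ennreal (exp (- x)) \<partial>half_line)"
      by (subst nn_integral_add) (auto simp: nn_integral_cmult)
    also have "\<dots> \<le> ennreal (2 ^ k) * ennreal ((1/4) ^ k) + ennreal ((1/2) ^ k) * 1"
      by (intro add_mono mult_left_mono bound nn_integral_exp_half_line) auto
    also have "\<dots> = ennreal (2 ^ k * (1/4) ^ k + (1/2) ^ k)"
      by (simp add: ennreal_mult ennreal_plus)
    also have "2 ^ k * (1/4) ^ k = (1/2 :: real) ^ k" by (simp flip: power_mult_distrib)
    finally show ?thesis by simp
  qed
  then have "(\<Sum>k. \<integral>\<^sup>+x. ennreal (D k x) \<partial>half_line) \<le> (\<Sum>k. ennreal (2 * (1/2) ^ k))"
    by (intro suminf_le) auto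
  also have "\<dots> < \<infinity>"
    by (subst suminf_ennreal2) (auto intro!: summable_mult summable_geometric)
  finally have "(\<integral>\<^sup>+x. (\<Sum>k. ennreal (D k x)) \<partial>half_line) \<noteq> \<infinity>"
    by (subst nn_integral_suminf) auto
  then have "AE x in half_line. (\<Sum>k. ennreal (D k x)) \<noteq> \<infinity>"
    by (intro nn_integral_PInf_AE) auto
  then show ?thesis
  proof (rule AE_mp, intro AE_I2 impI)
    fix x assume "(\<Sum>k. ennreal (D k x)) \<noteq> \<infinity>"
    then have "summable (\<lambda>k. D k x)"
      by (intro summable_suminf_not_top) (auto simp: D_def)
    then have "summable (\<lambda>k. D k x * exp (x / 2))" by (rule summable_mult2)
    then have "summable (\<lambda>k. norm (G (Suc k) x - G k x))"
      by (simp add: D_def mult.assoc flip: exp_add)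
    then have "summable (\<lambda>k. G (Suc k) x - G k x)" by (rule summable_norm_cancel)
    then have "convergent (\<lambda>n. \<Sum>k<n. G (Suc k) x - G k x)" by (simp add: summable_iff_convergent)
    then have "convergent (\<lambda>n. G n x - G 0 x)"
      unfolding sum_lessThan_telescope[of "\<lambda>k. G k x"] .
    then show "convergent (\<lambda>n. G n x)" by (simp only: convergent_diff_const_right_iff)
  qed
qed

text \<open>Riesz-Fischer: a rapidly converging subsequence has an almost everywhere limit, Fatou's
  lemma turns this into a norm limit, and a Cauchy sequence follows its subsequence.\<close>

instance L2_half_line :: banach
proof
  fix X :: "nat \<Rightarrow> L2_half_line" assume X: "Cauchy X"
  have "\<forall>k. \<exists>N. \<forall>m\<ge>N. \<forall>n\<ge>N. dist (X m) (X n) < (1/2) ^ k"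
    using X unfolding Cauchy_def by simp
  then obtain N where N: "\<And>k m n. m \<ge> N k \<Longrightarrow> n \<ge> N k \<Longrightarrow> dist (X m) (X n) < (1/2) ^ k"
    by metis
  \<comment> \<open>Summing makes \<open>r\<close> monotone with \<open>N k \<le> r k\<close>, so
    all later members of the subsequence stay within \<open>(1/2) ^ k\<close> of
    \<open>X (r k)\<close>.\<close>
  define r where "r k = (\<Sum>i\<le>k. N i)" for k
  have rN: "N k \<le> r k" for k unfolding r_def by (rule member_le_sum) auto
  have rmono: "r k \<le> r j" if "k \<le> j" for k j unfolding r_def using that by (intro sum_mono2) auto
  have "\<forall>k. \<exists>f. sq_integrable f \<and> X (r k) = L2_class f" by (metis L2_class_surj)
  then obtain G where G: "\<And>k. sq_integrable (G k)" and XG: "\<And>k. X (r k) = L2_class (G k)"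
    by metis
  have [measurable]: "G k \<in> borel_measurable half_line" for k
    using G[of k] by (simp add: sq_integrable_def)
  have G_diff: "(\<integral>\<^sup>+x. ennreal ((norm (G j x - G k x))\<^sup>2) \<partial>half_line) \<le> ennreal ((1/4) ^ k)"
    if "k \<le> j" for j k
  proof -
    have "norm (L2_class (\<lambda>x. G j x - G k x)) \<le> (1/2) ^ k"
      using N[of k "r j" "r k"] rN[of k] rmono[OF that]
      by (simp add: XG dist_norm L2_class_diff G)
    then have "(norm (L2_class (\<lambda>x. G j x - G k x)))\<^sup>2 \<le> ((1/2) ^ k)\<^sup>2"
      by (intro power_mono) auto
    also have "((1/2::real) ^ k)\<^sup>2 = (1/4) ^ k"
      by (simp add: power2_eq_square flip: power_mult_distrib)
    finally show ?thesis
      by (subst nn_integral_norm_L2_class) (auto intro: sq_integrable_diff G ennreal_leI)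
  qed
  define F where "F x = lim (\<lambda>k. G k x)" for x
  have [measurable]: "F \<in> borel_measurable half_line"
    unfolding F_def by measurable
  have conv: "AE x in half_line. (\<lambda>k. G k x) \<longlonglongrightarrow> F x"
    using AE_convergent_of_fast_Cauchy[of G] G_diff by (auto simp: F_def convergent_LIMSEQ_iff)
  \<comment> \<open>Fatou's lemma in j: for almost every x the integrand is the liminf of the
    squared differences \<open>G j x - G k x\<close>, whose integrals are bounded once j \<ge>
    k.\<close>
  have FG: "(\<integral>\<^sup>+x. ennreal ((norm (F x - G k x))\<^sup>2) \<partial>half_line) \<le> ennreal ((1/4) ^ k)" for k
  proof -
    have "(\<integral>\<^sup>+x. ennreal ((norm (F x - G k x))\<^sup>2) \<partial>half_line) =
        (\<integral>\<^sup>+x. liminf (\<lambda>j. ennreal ((norm (G j x - G k x))\<^sup>2)) \<partial>half_line)"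
    proof (rule nn_integral_cong_AE, rule AE_mp[OF conv], intro AE_I2 impI)
      fix x assume "(\<lambda>j. G j x) \<longlonglongrightarrow> F x"
      then have "(\<lambda>j. ennreal ((norm (G j x - G k x))\<^sup>2)) \<longlonglongrightarrow> ennreal ((norm (F x - G k x))\<^sup>2)"
        by (intro tendsto_ennrealI tendsto_intros)
      then show "ennreal ((norm (F x - G k x))\<^sup>2) = liminf (\<lambda>j. ennreal ((norm (G j x - G k x))\<^sup>2))"
        by (intro lim_imp_Liminf[symmetric]) auto
    qed
    also have "\<dots> \<le> liminf (\<lambda>j. \<integral>\<^sup>+x. ennreal ((norm (G j x - G k x))\<^sup>2) \<partial>half_line)"
      by (rule nn_integral_liminf) measurable
    also have "\<dots> \<le> ennreal ((1/4) ^ k)"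
      by (rule Liminf_le) (use G_diff in \<open>auto simp: eventually_sequentially\<close>)
    finally show ?thesis .
  qed
  have sqFG: "sq_integrable (\<lambda>x. F x - G k x)" for k
    unfolding sq_integrable_def
    using FG[of k] by (auto intro!: integrableI_bounded simp: le_less_trans[OF _ ennreal_less_top])
  have sqF: "sq_integrable F"
    using sq_integrable_add[OF sqFG[of 0] G[of 0]] by simp
  have lim: "norm (X (r k) - L2_class F) \<le> (1/2) ^ k" for k
  proof -
    have "(norm (L2_class (\<lambda>x. F x - G k x)))\<^sup>2 \<le> (1/4) ^ k"
      using FG[of k] by (simp add: nn_integral_norm_L2_class[OF sqFG])
    also have "(1/4) ^ k = ((1/2::real) ^ k)\<^sup>2"
      by (simp add: power2_eq_square flip: power_mult_distrib)
    finally have "norm (L2_class (\<lambda>x. F x - G k x)) \<le> (1/2) ^ k"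
      by (rule power2_le_imp_le) simp
    then have "norm (L2_class F - X (r k)) \<le> (1/2) ^ k" by (simp add: XG L2_class_diff sqF G)
    then show ?thesis by (simp only: norm_minus_commute)
  qed
  have "X \<longlonglongrightarrow> L2_class F"
  proof (rule LIMSEQ_I)
    fix e :: real assume "e > 0"
    then obtain k where k: "(1/2) ^ k < e / 2" using real_arch_pow_inv[of "e / 2" "1/2"] by auto
    have "norm (X n - L2_class F) < e" if "n \<ge> r k" for n
    proof -
      have "dist (X n) (X (r k)) < (1/2) ^ k" using N[of k n "r k"] rN[of k] that by linarith
      then show ?thesis
        using lim[of k] k norm_triangle_ineq[of "X n - X (r k)" "X (r k) - L2_class F"]
        by (simp add: dist_norm)
    qed
    then show "\<exists>no. \<forall>n\<ge>no. norm (X n - L2_class F) < e" by blast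
  qed
  then show "convergent X" by (rule convergentI)
qed

section \<open>Integrals on the half-line\<close>

lemma integrable_half_line:
  fixes f :: "real \<Rightarrow> 'a::{banach, second_countable_topology}"
  shows "integrable half_line f \<longleftrightarrow> set_integrable lborel {0<..} f"
  unfolding set_integrable_def by (rule integrable_restrict_space) simp

text \<open>Taking norms in the absolutely convergent complex Gamma integral. That integral refers
  to Lebesgue measurable functions, hence the return from \<open>completion lborel\<close> to
  \<open>lborel\<close>.\<close>

lemma integrable_powr_exp:
  assumes "s > -1" "c > 0"
  shows "integrable half_line (\<lambda>x. x powr s * exp (- c * x))"
proof -
  have "(\<lambda>t. complex_of_real t powr (of_real (s + 1) - 1) / of_real (exp (c * t)))
      absolutely_integrable_on {0<..}"
    using assms by (intro absolutely_integrable_Gamma_integral) auto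
  then have "(\<lambda>t. norm (complex_of_real t powr (of_real (s + 1) - 1) / of_real (exp (c * t))))
      absolutely_integrable_on {0<..}"
    by (rule absolutely_integrable_norm[unfolded o_def])
  then have "(\<lambda>t. t powr s * exp (- c * t)) absolutely_integrable_on {0<..}"
    by (rule set_integrable_cong[THEN iffD1, rotated -1])
      (auto simp: norm_divide norm_powr_real_powr exp_minus field_simps)
  then have "integrable (completion lborel) (\<lambda>t. indicator {0<..} t *\<^sub>R (t powr s * exp (- c * t)))"
    by (simp add: set_integrable_def)
  then show ?thesis
    unfolding integrable_half_line set_integrable_def
    by (subst (asm) integrable_completion) (auto intro!: borel_measurable_indicator)
qed

lemma integral_powr_exp:
  assumes "s > -1"
  shows "(\<integral>x. x powr s * exp (- x) \<partial>half_line) = Gamma (s + 1)"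
proof -
  have "(\<integral>\<^sup>+x. ennreal (x powr s * exp (- x)) \<partial>half_line) =
      (\<integral>\<^sup>+x. ennreal (x powr s * exp (- x)) * indicator {0<..} x \<partial>lborel)"
    by (rule nn_integral_half_line) simp
  also have "\<dots> = (\<integral>\<^sup>+t. ennreal (indicator {0..} t * t powr (s + 1 - 1) / exp t) \<partial>lborel)"
    by (intro nn_integral_cong) (auto simp: indicator_def exp_minus field_simps)
  also have "\<dots> = ennreal (Gamma (s + 1))"
    using assms by (subst Gamma_conv_nn_integral_real) auto
  finally have "(\<integral>\<^sup>+x. ennreal (x powr s * exp (- x)) \<partial>half_line) = ennreal (Gamma (s + 1))" .
  moreover have "(\<lambda>x. x powr s * exp (- x)) \<in> borel_measurable half_line"
    by (rule borel_measurable_half_line) measurable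
  ultimately show ?thesis
    using assms Gamma_real_pos[of "s + 1"] by (simp add: integral_eq_nn_integral)
qed

text \<open>Demanding the bound for every rate e, and not for one fixed rate, makes the class closed
  under products. It contains all polynomials, and an arbitrarily small part of an exponential decay
  absorbs any of its members.\<close>

definition subexponential :: "(real \<Rightarrow> real) \<Rightarrow> bool" where
  "subexponential f \<longleftrightarrow> f \<in> borel_measurable borel \<and>
    (\<forall>e>0. \<exists>K. \<forall>x\<ge>0. \<bar>f x\<bar> \<le> K * exp (e * x))"

lemma subexponential_measurable: "subexponential f \<Longrightarrow> f \<in> borel_measurable borel"
  by (simp add: subexponential_def)

lemma subexponentialE:
  assumes "subexponential f" "e > 0"
  obtains K where "K \<ge> 0" "\<And>x. x \<ge> 0 \<Longrightarrow> \<bar>f x\<bar> \<le> K * exp (e * x)"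
proof -
  obtain K where K: "\<And>x. x \<ge> 0 \<Longrightarrow> \<bar>f x\<bar> \<le> K * exp (e * x)"
    using assms unfolding subexponential_def by blast
  show ?thesis
  proof (rule that)
    show "K \<ge> 0" using K[of 0] by simp
  qed (rule K)
qed

lemma subexponential_const: "subexponential (\<lambda>_. a)"
proof -
  have "\<bar>a\<bar> \<le> \<bar>a\<bar> * exp (e * x)" if "e > 0" "x \<ge> 0" for e x :: real
    using that by (simp add: mult_le_cancel_left1)
  then show ?thesis unfolding subexponential_def by auto
qed

lemma subexponential_ident: "subexponential (\<lambda>x. x)"
proof -
  have "\<bar>x\<bar> \<le> 1 / e * exp (e * x)" if "e > 0" "x \<ge> 0" for e x :: real
  proof -
    have "e * x \<le> exp (e * x)" using exp_ge_add_one_self[of "e * x"] by linarith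
    then show ?thesis using that by (simp add: field_simps)
  qed
  then show ?thesis unfolding subexponential_def
    by (intro conjI allI impI exI[of _ "1 / e" for e]) auto
qed

lemma subexponential_add:
  assumes f: "subexponential f" and g: "subexponential g"
  shows "subexponential (\<lambda>x. f x + g x)"
  unfolding subexponential_def
proof (intro conjI allI impI)
  show "(\<lambda>x. f x + g x) \<in> borel_measurable borel"
    using f g by (auto simp: subexponential_def)
  fix e :: real assume e: "e > 0"
  obtain K where K: "\<And>x. x \<ge> 0 \<Longrightarrow> \<bar>f x\<bar> \<le> K * exp (e * x)" using subexponentialE[OF f e] by metis
  obtain L where L: "\<And>x. x \<ge> 0 \<Longrightarrow> \<bar>g x\<bar> \<le> L * exp (e * x)" using subexponentialE[OF g e] by metis
  have "\<bar>f x + g x\<bar> \<le> (K + L) * exp (e * x)" if "x \<ge> 0" for x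
    using K[OF that] L[OF that] abs_triangle_ineq[of "f x" "g x"] by (simp add: distrib_right)
  then show "\<exists>K. \<forall>x\<ge>0. \<bar>f x + g x\<bar> \<le> K * exp (e * x)" by blast
qed

lemma subexponential_mult:
  assumes f: "subexponential f" and g: "subexponential g"
  shows "subexponential (\<lambda>x. f x * g x)"
  unfolding subexponential_def
proof (intro conjI allI impI)
  show "(\<lambda>x. f x * g x) \<in> borel_measurable borel"
    using f g by (auto simp: subexponential_def)
  fix e :: real assume "e > 0"
  then have e: "e / 2 > 0" by simp
  obtain K where K: "K \<ge> 0" "\<And>x. x \<ge> 0 \<Longrightarrow> \<bar>f x\<bar> \<le> K * exp (e / 2 * x)" using subexponentialE[OF f e] by metis
  obtain L where L: "\<And>x. x \<ge> 0 \<Longrightarrow> \<bar>g x\<bar> \<le> L * exp (e / 2 * x)" using subexponentialE[OF g e] by metis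
  have "\<bar>f x * g x\<bar> \<le> (K * L) * exp (e * x)" if "x \<ge> 0" for x
  proof -
    have "\<bar>f x * g x\<bar> \<le> (K * exp (e / 2 * x)) * (L * exp (e / 2 * x))"
      unfolding abs_mult using K L that by (intro mult_mono) auto
    also have "\<dots> = (K * L) * (exp (e / 2 * x) * exp (e / 2 * x))" by (simp add: mult_ac)
    also have "exp (e / 2 * x) * exp (e / 2 * x) = exp (e * x)" by (simp flip: exp_add)
    finally show ?thesis .
  qed
  then show "\<exists>K. \<forall>x\<ge>0. \<bar>f x * g x\<bar> \<le> K * exp (e * x)" by blast
qed

lemma subexponential_power: "subexponential f \<Longrightarrow> subexponential (\<lambda>x. f x ^ n)"
  by (induction n) (auto intro: subexponential_const subexponential_mult)

lemma subexponential_cmult: "subexponential f \<Longrightarrow> subexponential (\<lambda>x. a * f x)"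
  by (rule subexponential_mult[OF subexponential_const])

lemma subexponential_diff: "subexponential f \<Longrightarrow> subexponential g \<Longrightarrow> subexponential (\<lambda>x. f x - g x)"
  using subexponential_add[OF _ subexponential_cmult, of f g "-1"] by simp

text \<open>Half of the decay rate \<open>c\<close> is spent on \<open>f\<close>; the other half
  keeps the Gamma integral convergent.\<close>

lemma integrable_subexponential:
  assumes f: "subexponential f" and s: "s > -1" and c: "c > 0"
  shows "integrable half_line (\<lambda>x. f x * (x powr s * exp (- c * x)))"
proof -
  obtain K where K: "K \<ge> 0" "\<And>x. x \<ge> 0 \<Longrightarrow> \<bar>f x\<bar> \<le> K * exp (c / 2 * x)"
    using subexponentialE[OF f, of "c / 2"] c by auto
  have [measurable]: "f \<in> borel_measurable borel" using f by (simp add: subexponential_def)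
  show ?thesis
  proof (rule Bochner_Integration.integrable_bound)
    show "integrable half_line (\<lambda>x. K * (x powr s * exp (- (c / 2) * x)))"
      using s c by (intro integrable_mult_right integrable_powr_exp) auto
    show "(\<lambda>x. f x * (x powr s * exp (- c * x))) \<in> borel_measurable half_line"
      by (rule borel_measurable_half_line) measurable
    show "AE x in half_line. norm (f x * (x powr s * exp (- c * x))) \<le> norm (K * (x powr s * exp (- (c / 2) * x)))"
    proof (intro AE_I2)
      fix x assume "x \<in> space half_line"
      then have x: "x > 0" by (simp add: space_restrict_space)
      have "\<bar>f x\<bar> * (x powr s * exp (- c * x)) \<le> (K * exp (c / 2 * x)) * (x powr s * exp (- c * x))"
        using K(2)[of x] x by (intro mult_right_mono) auto
      also have "\<dots> = K * (x powr s * (exp (c / 2 * x) * exp (- c * x)))" by (simp add: mult_ac)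
      also have "exp (c / 2 * x) * exp (- c * x) = exp (- (c / 2) * x)" by (simp flip: exp_add)
      finally show "norm (f x * (x powr s * exp (- c * x))) \<le> norm (K * (x powr s * exp (- (c / 2) * x)))"
        using K(1) by (simp add: abs_mult)
    qed
  qed
qed


section \<open>Functions determined by their moments\<close>

lemma integrable_mult_iexp:
  assumes "integrable half_line f"
  shows "integrable half_line (\<lambda>x. f x * iexp (r * x))"
proof (rule Bochner_Integration.integrable_bound[OF assms])
  have "(\<lambda>x. iexp (r * x)) \<in> borel_measurable half_line"
    by (rule borel_measurable_half_line) measurable
  then show "(\<lambda>x. f x * iexp (r * x)) \<in> borel_measurable half_line"
    by (intro borel_measurable_times borel_measurable_integrable[OF assms])
  show "AE x in half_line. norm (f x * iexp (r * x)) \<le> norm (f x)"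
    by (intro AE_I2) (simp add: norm_mult del: of_real_mult)
qed

text \<open>The positive and negative parts of \<open>A\<close> have equal Fourier transforms, in
  particular equal total mass at frequency 0. Unless that mass vanishes, both become probability
  densities after division by it, and Levy's uniqueness theorem identifies them.\<close>

lemma AE_zero_of_fourier_real:
  fixes A :: "real \<Rightarrow> real"
  assumes A: "integrable half_line A"
    and zero: "\<And>r. (\<integral>x. complex_of_real (A x) * iexp (r * x) \<partial>half_line) = 0"
  shows "AE x in half_line. A x = 0"
proof -
  define P where "P x = max 0 (A x)" for x
  define N where "N x = max 0 (- A x)" for x
  have AE: "A x = P x - N x" for x by (simp add: P_def N_def)
  have int: "integrable half_line P" "integrable half_line N"
    unfolding P_def N_def using A by auto
  have [measurable]: "P \<in> borel_measurable half_line" "N \<in> borel_measurable half_line"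
    using int by auto
  have nonneg: "0 \<le> P x" "0 \<le> N x" for x by (simp_all add: P_def N_def)
  have int_exp: "integrable half_line (\<lambda>x. complex_of_real (f x) * iexp (r * x))"
    if "integrable half_line f" for f :: "real \<Rightarrow> real" and r
    using integrable_mult_iexp[of "\<lambda>x. complex_of_real (f x)" r] that by simp
  have eq: "(\<integral>x. complex_of_real (P x) * iexp (r * x) \<partial>half_line) =
      (\<integral>x. complex_of_real (N x) * iexp (r * x) \<partial>half_line)" for r
  proof -
    have "0 = (\<integral>x. complex_of_real (P x) * iexp (r * x) - complex_of_real (N x) * iexp (r * x) \<partial>half_line)"
      using zero[of r] by (simp only: AE left_diff_distrib of_real_diff)
    also have "\<dots> = (\<integral>x. complex_of_real (P x) * iexp (r * x) \<partial>half_line) -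
        (\<integral>x. complex_of_real (N x) * iexp (r * x) \<partial>half_line)"
      by (intro Bochner_Integration.integral_diff int_exp int)
    finally show ?thesis by simp
  qed
  define I where "I = (\<integral>x. P x \<partial>half_line)"
  have "complex_of_real (\<integral>x. P x \<partial>half_line) = complex_of_real (\<integral>x. N x \<partial>half_line)"
    using eq[of 0] by (simp only: integral_complex_of_real mult_zero_left of_real_0 mult_zero_right exp_zero mult_1_right)
  then have IN: "(\<integral>x. N x \<partial>half_line) = I" by (simp only: I_def of_real_eq_iff)
  show ?thesis
  proof (cases "I = 0")
    case True
    then have "AE x in half_line. P x = 0" "AE x in half_line. N x = 0"
      using integral_nonneg_eq_0_iff_AE[OF int(1)] integral_nonneg_eq_0_iff_AE[OF int(2)] nonneg IN
      by (auto simp: I_def)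
    then show ?thesis by eventually_elim (simp add: AE)
  next
    case False
    have "I \<ge> 0" unfolding I_def by (intro integral_nonneg_AE AE_I2 nonneg)
    with False have I: "I > 0" by simp
    define M where "M f = density half_line (\<lambda>x. ennreal (f x / I))" for f :: "real \<Rightarrow> real"
    define D where "D f = distr (M f) borel (\<lambda>x. x)" for f :: "real \<Rightarrow> real"
    have id[measurable]: "(\<lambda>x. x) \<in> borel_measurable half_line" by (rule borel_measurable_half_line) simp
    have idM: "(\<lambda>x. x) \<in> borel_measurable (M f)" for f using id by (simp add: M_def)
    have dist: "real_distribution (D f)"
      if f: "integrable half_line f" "\<And>x. 0 \<le> f x" "(\<integral>x. f x \<partial>half_line) = I" for f
    proof -
      have [measurable]: "f \<in> borel_measurable half_line" using f by auto
      have "emeasure (M f) (space (M f)) =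
          (\<integral>\<^sup>+x. ennreal (f x / I) * indicator (space half_line) x \<partial>half_line)"
        unfolding M_def space_density by (rule emeasure_density[OF _ sets.top]) measurable
      also have "\<dots> = (\<integral>\<^sup>+x. ennreal (f x / I) \<partial>half_line)" by (intro nn_integral_cong) simp
      also have "\<dots> = ennreal (\<integral>x. f x / I \<partial>half_line)"
        using f I by (intro nn_integral_eq_integral) auto
      also have "\<dots> = 1" using f(3) I by simp
      finally interpret prob_space "M f" by (intro prob_spaceI)
      show ?thesis unfolding D_def by (rule real_distribution_distr[OF idM])
    qed
    have char: "char (D f) r = (\<integral>x. complex_of_real (f x) * iexp (r * x) \<partial>half_line) / I"
      if f: "integrable half_line f" "\<And>x. 0 \<le> f x" for f r
    proof -
      have [measurable]: "f \<in> borel_measurable half_line" using f by auto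
      have "char (D f) r = (\<integral>x. iexp (r * x) \<partial>M f)"
        unfolding char_def D_def by (rule integral_distr[OF idM]) measurable
      also have "\<dots> = (\<integral>x. (f x / I) *\<^sub>R iexp (r * x) \<partial>half_line)"
        unfolding M_def using f I by (intro integral_density) auto
      also have "\<dots> = (\<integral>x. complex_of_real (f x) * iexp (r * x) / I \<partial>half_line)"
        by (simp add: scaleR_conv_of_real)
      finally show ?thesis by simp
    qed
    have "D P = D N"
    proof (rule Levy_uniqueness)
      show "char (D P) = char (D N)" using eq by (auto simp: char int nonneg)
    qed (use dist int nonneg IN I_def in auto)
    \<comment> \<open>\<open>D f\<close> is \<open>M f\<close> carried to the Borel line by the
      identity. A measurable subset of the half-line is its own preimage, so equality of the images
      gives equality of the measures on \<open>half_line\<close>.\<close>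
    have "M P = M N"
    proof (rule measure_eqI)
      fix S assume "S \<in> sets (M P)"
      then have S: "S \<in> sets half_line" by (simp add: M_def)
      then have "S \<subseteq> {0<..}" "S \<in> sets borel" by (auto simp: sets_restrict_space)
      then have "(\<lambda>x. x) -` S \<inter> space (M f) = S" for f by (auto simp: M_def space_restrict_space)
      then have "emeasure (M f) S = emeasure (D f) S" for f
        unfolding D_def using \<open>S \<in> sets borel\<close> by (subst emeasure_distr[OF idM]) auto
      then show "emeasure (M P) S = emeasure (M N) S" using \<open>D P = D N\<close> by simp
    qed (simp add: M_def)
    moreover have "(\<integral>\<^sup>+x. ennreal (P x / I) \<partial>half_line) \<noteq> \<infinity>"
      using int nonneg I by (subst nn_integral_eq_integral) auto
    ultimately have "AE x in half_line. ennreal (P x / I) = ennreal (N x / I)"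
      unfolding M_def by (subst (asm) finite_density_unique) auto
    then show ?thesis
      by eventually_elim (use I nonneg in \<open>simp add: AE\<close>)
  qed
qed

text \<open>The transform of \<open>cnj (G x)\<close> at r is the conjugate of the transform of
  \<open>G\<close> at -r, so it vanishes as well, and with it the transforms of the real and
  imaginary parts.\<close>

lemma AE_zero_of_fourier:
  fixes G :: "real \<Rightarrow> complex"
  assumes G: "integrable half_line G"
    and zero: "\<And>r. (\<integral>x. G x * iexp (r * x) \<partial>half_line) = 0"
  shows "AE x in half_line. G x = 0"
proof -
  note int = integrable_mult_iexp
  have cnj: "(\<integral>x. cnj (G x) * iexp (r * x) \<partial>half_line) = 0" for r
  proof -
    have "(\<integral>x. cnj (G x) * iexp (r * x) \<partial>half_line) = (\<integral>x. cnj (G x * iexp (- r * x)) \<partial>half_line)"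
      by (simp add: exp_cnj)
    also have "\<dots> = cnj (\<integral>x. G x * iexp (- r * x) \<partial>half_line)" by (rule Bochner_Integration.integral_cnj)
    finally show ?thesis using zero[of "- r"] by simp
  qed
  have cG: "integrable half_line (\<lambda>x. cnj (G x))" using G by simp
  have "AE x in half_line. Re (G x) = 0"
  proof (rule AE_zero_of_fourier_real)
    fix r
    have "complex_of_real (Re (G x)) * iexp (r * x) =
        (1/2) * (G x * iexp (r * x) + cnj (G x) * iexp (r * x))" for x
      by (simp add: complex_eq_iff)
    then show "(\<integral>x. complex_of_real (Re (G x)) * iexp (r * x) \<partial>half_line) = 0"
      by (simp only: integral_mult_right_zero Bochner_Integration.integral_add[OF int[OF G] int[OF cG]]
          zero cnj) simp
  qed (use G in simp)
  moreover have "AE x in half_line. Im (G x) = 0"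
  proof (rule AE_zero_of_fourier_real)
    fix r
    have "complex_of_real (Im (G x)) * iexp (r * x) =
        (-\<i>/2) * (G x * iexp (r * x) - cnj (G x) * iexp (r * x))" for x
      by (simp add: complex_eq_iff)
    then show "(\<integral>x. complex_of_real (Im (G x)) * iexp (r * x) \<partial>half_line) = 0"
      by (simp only: integral_mult_right_zero Bochner_Integration.integral_diff[OF int[OF G] int[OF cG]]
          zero cnj) simp
  qed (use G in simp)
  ultimately show ?thesis by eventually_elim (simp add: complex_eq_iff)
qed

lemma norm_exp_partial_sum_le: "norm (\<Sum>k<m. z ^ k / fact k :: complex) \<le> exp (norm z)"
proof -
  have "norm (\<Sum>k<m. z ^ k / fact k) \<le> (\<Sum>k<m. norm z ^ k / fact k)"
    by (rule order_trans[OF norm_sum]) (simp add: norm_divide norm_power)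
  also have "\<dots> \<le> (\<Sum>k. norm z ^ k / fact k)"
    using summable_exp[of "norm z"] by (intro sum_le_suminf) (auto simp: field_simps)
  also have "\<dots> = exp (norm z)" by (simp add: exp_def divide_inverse_commute scaleR_conv_of_real)
  finally show ?thesis .
qed

text \<open>The Fourier transform of \<open>G\<close> is analytic near the real axis with a radius of convergence that does
  not depend on the point, so vanishing of all derivatives propagates from \<open>0\<close> to all of \<open>\<real>\<close> in
  steps of constant length.\<close>

lemma AE_zero_of_moments:
  fixes G :: "real \<Rightarrow> complex"
  assumes G[measurable]: "G \<in> borel_measurable half_line" and c: "c > 0"
    and int: "integrable half_line (\<lambda>x. norm (G x) * exp (c * x))"
    and zero: "\<And>n. (\<integral>x. G x * complex_of_real (x ^ n) \<partial>half_line) = 0"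
  shows "AE x in half_line. G x = 0"
proof -
  have ms: "f \<in> borel_measurable half_line"
    if "f \<in> borel_measurable borel" for f :: "real \<Rightarrow> complex"
    by (rule borel_measurable_half_line[OF that])
  \<comment> \<open>The weight \<open>exp (c * x)\<close> is split in two: one half pays for the
    power \<open>x ^ n\<close>, the other for the exponential partial sums in a step of length at
    most \<open>c / 2\<close>.\<close>
  define K where "K n = (SOME K. \<forall>x\<ge>0. \<bar>x ^ n\<bar> \<le> K * exp (c / 2 * x))" for n :: nat
  have K: "x ^ n \<le> K n * exp (c / 2 * x)" if "x > 0" for n x
  proof -
    have "\<exists>K. \<forall>x\<ge>0. \<bar>x ^ n\<bar> \<le> K * exp (c / 2 * x)"
      using subexponentialE[OF subexponential_power[OF subexponential_ident], of "c / 2" n] c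
      by (metis half_gt_zero)
    from someI_ex[OF this] show ?thesis using that unfolding K_def by (simp add: abs_le_iff)
  qed
  have Kb: "norm (G x) * (x ^ n * exp (c / 2 * x)) \<le> K n * (norm (G x) * exp (c * x))" if "x > 0" for n x
  proof -
    have "x ^ n * exp (c / 2 * x) \<le> K n * exp (c / 2 * x) * exp (c / 2 * x)"
      using K[OF that] by (intro mult_right_mono) auto
    also have "\<dots> = K n * exp (c * x)" by (simp add: mult.assoc flip: exp_add)
    finally have "norm (G x) * (x ^ n * exp (c / 2 * x)) \<le> norm (G x) * (K n * exp (c * x))"
      by (intro mult_left_mono) auto
    then show ?thesis by (simp add: mult_ac)
  qed
  have Ki: "integrable half_line (\<lambda>x. K n * (norm (G x) * exp (c * x)))" for n
    by (intro integrable_mult_right int)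
  have integrable: "integrable half_line (\<lambda>x. G x * complex_of_real (x ^ n) * iexp (r * x) * h x)"
    if h: "h \<in> borel_measurable borel" "\<And>x. x > 0 \<Longrightarrow> norm (h x) \<le> exp (c / 2 * x)" for n r h
  proof (rule Bochner_Integration.integrable_bound[OF Ki[of n]])
    show "(\<lambda>x. G x * complex_of_real (x ^ n) * iexp (r * x) * h x) \<in> borel_measurable half_line"
      using h(1) by (intro borel_measurable_times G ms) measurable
    show "AE x in half_line. norm (G x * complex_of_real (x ^ n) * iexp (r * x) * h x)
        \<le> norm (K n * (norm (G x) * exp (c * x)))"
    proof (rule AE_I2)
      fix x assume "x \<in> space half_line"
      then have x: "x > 0" by (simp add: space_restrict_space)
      have "norm (G x) * (x ^ n * norm (h x)) \<le> norm (G x) * (x ^ n * exp (c / 2 * x))"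
        using x h(2)[OF x] by (intro mult_left_mono) auto
      also have "\<dots> \<le> K n * (norm (G x) * exp (c * x))" by (rule Kb[OF x])
      finally show "norm (G x * complex_of_real (x ^ n) * iexp (r * x) * h x)
          \<le> norm (K n * (norm (G x) * exp (c * x)))"
        using x by (simp add: norm_mult norm_power mult.assoc)
    qed
  qed
  have one: "norm (1::complex) \<le> exp (c / 2 * x)" if "x > 0" for x using c that by simp
  \<comment> \<open>Up to powers of \<i>, \<open>Z r\<close> says that all derivatives of the
    Fourier transform of \<open>G\<close> vanish at r.\<close>
  define Z where "Z r \<longleftrightarrow> (\<forall>n. (\<integral>x. G x * complex_of_real (x ^ n) * iexp (r * x) \<partial>half_line) = 0)" for r
  have step: "Z (r + d)" if Z: "Z r" and d: "\<bar>d\<bar> \<le> c / 2" for r d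
    unfolding Z_def
  proof
    fix n
    define S where "S m x = (\<Sum>k<m. (\<i> * complex_of_real (d * x)) ^ k / fact k)" for m x
    have Sm: "S m \<in> borel_measurable borel" for m unfolding S_def by measurable
    have Sb: "norm (S m x) \<le> exp (c / 2 * x)" if "x > 0" for m x
    proof -
      have "norm (S m x) \<le> exp (norm (\<i> * complex_of_real (d * x)))"
        unfolding S_def by (rule norm_exp_partial_sum_le)
      also have "\<dots> \<le> exp (c / 2 * x)"
        using d that by (simp add: norm_mult abs_mult)
      finally show ?thesis .
    qed
    have Slim: "(\<lambda>m. S m x) \<longlonglongrightarrow> iexp (d * x)" for x
      using exp_converges[of "\<i> * complex_of_real (d * x)"]
      by (simp add: sums_def S_def scaleR_conv_of_real divide_inverse mult.commute)
    let ?F = "\<lambda>x. G x * complex_of_real (x ^ n) * iexp (r * x)"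
    have F_meas: "?F \<in> borel_measurable half_line"
      by (intro borel_measurable_times G ms) measurable
    have "(\<lambda>m. \<integral>x. ?F x * S m x \<partial>half_line) \<longlonglongrightarrow> (\<integral>x. ?F x * iexp (d * x) \<partial>half_line)"
    proof (rule integral_dominated_convergence[OF _ _ Ki[of n]])
      show "(\<lambda>x. ?F x * iexp (d * x)) \<in> borel_measurable half_line"
        by (intro borel_measurable_times[OF F_meas] ms) measurable
      show "(\<lambda>x. ?F x * S m x) \<in> borel_measurable half_line" for m
        by (intro borel_measurable_times[OF F_meas] ms Sm)
      show "AE x in half_line. (\<lambda>m. ?F x * S m x) \<longlonglongrightarrow> ?F x * iexp (d * x)"
        by (intro AE_I2 tendsto_mult tendsto_const Slim)
      show "AE x in half_line. norm (?F x * S m x) \<le> K n * (norm (G x) * exp (c * x))" for m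
      proof (rule AE_I2)
        fix x assume "x \<in> space half_line"
        then have x: "x > 0" by (simp add: space_restrict_space)
        have "norm (G x) * (x ^ n * norm (S m x)) \<le> norm (G x) * (x ^ n * exp (c / 2 * x))"
          using x Sb[OF x] by (intro mult_left_mono) auto
        also have "\<dots> \<le> K n * (norm (G x) * exp (c * x))" by (rule Kb[OF x])
        finally show "norm (?F x * S m x) \<le> K n * (norm (G x) * exp (c * x))"
          using x by (simp add: norm_mult norm_power mult.assoc)
      qed
    qed
    moreover have "(\<integral>x. ?F x * S m x \<partial>half_line) = 0" for m
    proof -
      \<comment> \<open>The k-th Taylor term raises the moment from n to n + k; carrying all moments
        along in \<open>Z\<close> therefore makes every term vanish.\<close>
      have eq: "?F x * S m x = (\<Sum>k<m. ((\<i> * complex_of_real d) ^ k / fact k) *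
          (G x * complex_of_real (x ^ (n + k)) * iexp (r * x) * 1))" for x
        unfolding S_def sum_distrib_left
        by (intro sum.cong) (simp_all add: power_mult_distrib power_add)
      have "(\<integral>x. ?F x * S m x \<partial>half_line) = (\<Sum>k<m. ((\<i> * complex_of_real d) ^ k / fact k) *
          (\<integral>x. G x * complex_of_real (x ^ (n + k)) * iexp (r * x) * 1 \<partial>half_line))"
        unfolding eq
      proof (subst Bochner_Integration.integral_sum)
        show "integrable half_line (\<lambda>x. ((\<i> * complex_of_real d) ^ k / fact k) *
            (G x * complex_of_real (x ^ (n + k)) * iexp (r * x) * 1))" for k
          by (intro integrable_mult_right integrable one borel_measurable_const)
      qed (simp only: integral_mult_right_zero)
      then show ?thesis using Z by (simp add: Z_def)
    qed
    ultimately have "(\<integral>x. ?F x * iexp (d * x) \<partial>half_line) = 0"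
      by (simp only: LIMSEQ_const_iff)
    then show "(\<integral>x. G x * complex_of_real (x ^ n) * iexp ((r + d) * x) \<partial>half_line) = 0"
      by (simp add: mult.assoc distrib_right distrib_left flip: exp_add)
  qed
  have Z: "Z r" for r
  proof -
    \<comment> \<open>The point r is reached from 0 in m equal steps, each of length at most
      \<open>c / 2\<close>.\<close>
    obtain m :: nat where m: "\<bar>r\<bar> / (c / 2) < m" using reals_Archimedean2 by blast
    then have m0: "real m > 0" using c by (meson abs_ge_zero divide_nonneg_nonneg half_gt_zero less_imp_le order_le_less_trans)
    have d: "\<bar>r / real m\<bar> \<le> c / 2" using m m0 c by (simp add: field_simps)
    have "Z (real j * (r / real m))" for j
    proof (induction j)
      case 0
      show ?case using zero by (simp add: Z_def)
    next
      case (Suc j)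
      then show ?case using step[OF Suc d] by (simp add: distrib_right add.commute add_divide_distrib)
    qed
    from this[of m] show ?thesis using m0 by simp
  qed
  show ?thesis
  proof (rule AE_zero_of_fourier)
    show "integrable half_line G" using integrable[of "\<lambda>_. 1" 0 0, OF _ one] by simp
    show "(\<integral>x. G x * iexp (r * x) \<partial>half_line) = 0" for r
      using Z[of r, unfolded Z_def, rule_format, of 0] by simp
  qed
qed

section \<open>Laguerre polynomials\<close>

lemma norm_iexp_quotient_le:
  assumes "h \<noteq> 0"
  shows "norm ((iexp (h * x) - 1) / complex_of_real h) \<le> \<bar>x\<bar>"
proof -
  have "norm (iexp (h * x) - 1) \<le> \<bar>h * x\<bar>" using iexp_approx1[of "h * x" 0] by simp
  then show ?thesis using assms by (simp add: norm_divide divide_le_eq abs_mult mult.commute)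
qed

lemma iexp_quotient_LIMSEQ:
  assumes X0: "\<And>k. X k \<noteq> 0" and X: "X \<longlonglongrightarrow> 0"
  shows "(\<lambda>k. (iexp (X k * x) - 1) / complex_of_real (X k)) \<longlonglongrightarrow> \<i> * complex_of_real x"
proof -
  have "((\<lambda>h. exp ((\<i> * complex_of_real x) * h)) has_field_derivative
      exp ((\<i> * complex_of_real x) * 0) * (\<i> * complex_of_real x)) (at 0)"
    by (auto intro!: derivative_eq_intros)
  then have "((\<lambda>h. (exp ((\<i> * complex_of_real x) * h) - 1) / h) \<longlongrightarrow> \<i> * complex_of_real x) (at 0)"
    by (simp add: DERIV_def)
  moreover have "filterlim (\<lambda>k. complex_of_real (X k)) (at 0) sequentially"
    using tendsto_of_real[OF X, where 'a = complex] X0 by (intro filterlim_atI) auto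
  ultimately have "(\<lambda>k. (exp ((\<i> * complex_of_real x) * complex_of_real (X k)) - 1) / complex_of_real (X k))
      \<longlonglongrightarrow> \<i> * complex_of_real x"
    by (rule filterlim_compose)
  then show ?thesis by (simp add: mult_ac)
qed

text \<open>The difference quotient of the exponential is bounded by \<bar>x\<bar>, so \<bar>x G
  x\<bar> dominates. The limit is tested along sequences because dominated convergence is
  sequential.\<close>

lemma integral_iexp_has_vector_derivative:
  fixes G :: "real \<Rightarrow> real"
  assumes G: "integrable half_line G" and xG: "integrable half_line (\<lambda>x. x * G x)"
  shows "((\<lambda>t. \<integral>x. complex_of_real (G x) * iexp (- t * x) \<partial>half_line) has_vector_derivative
    - \<i> * (\<integral>x. complex_of_real (x * G x) * iexp (- t * x) \<partial>half_line)) (at t)"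
proof -
  let ?e = "\<lambda>h x. (iexp (h * - x) - 1) / complex_of_real h"
  have int: "integrable half_line (\<lambda>x. complex_of_real (G x) * iexp (s * x))" for s
    by (intro integrable_mult_iexp integrable_of_real G)
  show ?thesis
    unfolding has_vector_derivative_iff_tendsto tendsto_at_iff_sequentially
  proof (intro allI impI)
    fix X :: "nat \<Rightarrow> real" assume X0: "\<forall>i. X i \<in> UNIV - {0}" and X: "X \<longlonglongrightarrow> 0"
    have diff: "((\<integral>x. complex_of_real (G x) * iexp (- (t + h) * x) \<partial>half_line) -
        (\<integral>x. complex_of_real (G x) * iexp (- t * x) \<partial>half_line)) /\<^sub>R h =
        (\<integral>x. complex_of_real (G x) * iexp (- t * x) * ?e h x \<partial>half_line)" if "h \<noteq> 0" for h
    proof -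
      have "iexp (- (t + h) * x) = iexp (- t * x) * iexp (h * - x)" for x
        by (simp add: algebra_simps flip: exp_add)
      then have eq: "complex_of_real (G x) * iexp (- t * x) * ?e h x =
          (1 / complex_of_real h) * (complex_of_real (G x) * iexp (- (t + h) * x) - complex_of_real (G x) * iexp (- t * x))" for x
        by (simp only:) (simp add: algebra_simps diff_divide_distrib)
      show ?thesis
        unfolding eq integral_mult_right_zero
        by (subst Bochner_Integration.integral_diff[OF int int]) (simp add: scaleR_conv_of_real divide_inverse)
    qed
    have "(\<lambda>i. \<integral>x. complex_of_real (G x) * iexp (- t * x) * ?e (X i) x \<partial>half_line) \<longlonglongrightarrow>
        (\<integral>x. complex_of_real (G x) * iexp (- t * x) * (- \<i> * x) \<partial>half_line)"
    proof (rule integral_dominated_convergence)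
      show "integrable half_line (\<lambda>x. \<bar>x * G x\<bar>)" using xG by (rule integrable_abs)
      have m: "(\<lambda>x. complex_of_real (G x) * iexp (- t * x)) \<in> borel_measurable half_line"
        by (rule borel_measurable_integrable[OF int])
      show "(\<lambda>x. complex_of_real (G x) * iexp (- t * x) * (- \<i> * complex_of_real x)) \<in> borel_measurable half_line"
        by (intro borel_measurable_times[OF m] borel_measurable_half_line) measurable
      show "(\<lambda>x. complex_of_real (G x) * iexp (- t * x) * ?e (X i) x) \<in> borel_measurable half_line" for i
        by (rule borel_measurable_times[OF m], rule borel_measurable_half_line) measurable
      show "AE x in half_line. (\<lambda>i. complex_of_real (G x) * iexp (- t * x) * ?e (X i) x)
          \<longlonglongrightarrow> complex_of_real (G x) * iexp (- t * x) * (- \<i> * x)"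
      proof (intro AE_I2 tendsto_mult tendsto_const)
        fix x
        show "(\<lambda>i. ?e (X i) x) \<longlonglongrightarrow> - \<i> * x"
          using iexp_quotient_LIMSEQ[of X "- x"] X0 X by simp
      qed
      show "AE x in half_line. norm (complex_of_real (G x) * iexp (- t * x) * ?e (X i) x) \<le> \<bar>x * G x\<bar>" for i
      proof (rule AE_I2)
        fix x
        have "norm (complex_of_real (G x) * iexp (- t * x) * ?e (X i) x) = \<bar>G x\<bar> * norm (?e (X i) x)"
          by (simp only: norm_mult norm_exp_i_times norm_of_real mult_1_right)
        also have "\<dots> \<le> \<bar>G x\<bar> * \<bar>x\<bar>" using X0 norm_iexp_quotient_le[of "X i" "- x"] by (intro mult_left_mono) auto
        finally show "norm (complex_of_real (G x) * iexp (- t * x) * ?e (X i) x) \<le> \<bar>x * G x\<bar>"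
          by (simp only: abs_mult mult.commute)
      qed
    qed
    moreover have "(\<integral>x. complex_of_real (G x) * iexp (- t * x) * (- \<i> * x) \<partial>half_line) =
        - \<i> * (\<integral>x. complex_of_real (x * G x) * iexp (- t * x) \<partial>half_line)"
      unfolding integral_mult_right_zero[symmetric] by (simp add: mult_ac)
    ultimately show "((\<lambda>h. ((\<integral>x. complex_of_real (G x) * iexp (- (t + h) * x) \<partial>half_line) -
        (\<integral>x. complex_of_real (G x) * iexp (- t * x) \<partial>half_line)) /\<^sub>R h) \<circ> X) \<longlonglongrightarrow>
        - \<i> * (\<integral>x. complex_of_real (x * G x) * iexp (- t * x) \<partial>half_line)"
      unfolding o_def using X0 by (subst diff) auto
  qed
qed

section \<open>Growth, Laplace transforms and orthonormality of the Laguerre polynomials\<close>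

context
  fixes p :: real
  assumes p: "p > -1"
begin

lemma Gamma_pos: "Gamma (p + 1) > 0"
  using p by (intro Gamma_real_pos) simp

lemma Gamma_nonzero [simp]: "Gamma (p + 1) \<noteq> 0"
  using Gamma_pos by (rule less_imp_neq[symmetric])

lemma lag_a_pos: "lag_a p n > 0"
  using p unfolding lag_a_def by (intro real_sqrt_gt_zero mult_pos_pos) auto

lemma laguerre_recurrence:
  "x * laguerre p n x = (if n = 0 then 0 else lag_a p (n - 1) * laguerre p (n - 1) x)
    + lag_b p n * laguerre p n x + lag_a p n * laguerre p (Suc n) x"
  using lag_a_pos[of n] by (cases n) (auto simp: field_simps)

lemma subexponential_laguerre: "subexponential (laguerre p n)"
proof (induction n rule: less_induct)
  case (less n)
  consider "n = 0" | "n = Suc 0" | m where "n = Suc (Suc m)" by (metis not0_implies_Suc)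
  then show ?case
  proof cases
    case 1
    then show ?thesis by (simp add: subexponential_const)
  next
    case 2
    have "subexponential (\<lambda>z. (1 / lag_a p 0) * (z - lag_b p 0))"
      by (intro subexponential_cmult subexponential_diff subexponential_ident subexponential_const)
    then show ?thesis using 2 by simp
  next
    case (3 m)
    have "subexponential (\<lambda>z. (1 / lag_a p (Suc m)) *
        ((z - lag_b p (Suc m)) * laguerre p (Suc m) z - lag_a p m * laguerre p m z))"
      using less 3
      by (intro subexponential_cmult subexponential_diff subexponential_ident subexponential_const
          subexponential_mult) auto
    then show ?thesis using 3 by simp
  qed
qed

lemma laguerre_weight_pos: "x > 0 \<Longrightarrow> laguerre_weight p x > 0"
  using p by (simp add: laguerre_weight_def Gamma_pos)

lemma borel_measurable_laguerre_weight: "laguerre_weight p \<in> borel_measurable borel"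
  unfolding laguerre_weight_def[abs_def] by measurable

text \<open>The weight decays like \<open>exp (- x)\<close> up to a power, so any a < 1 leaves
  positive decay. This surplus later supplies the exponential moments behind uniqueness of the
  moment problem.\<close>

lemma integrable_laguerre_weight_exp:
  assumes "subexponential f" "a < 1"
  shows "integrable half_line (\<lambda>x. f x * (laguerre_weight p x * exp (a * x)))"
proof -
  have "integrable half_line (\<lambda>x. (1 / Gamma (p + 1)) * (f x * (x powr p * exp (- (1 - a) * x))))"
    using assms p by (intro integrable_mult_right integrable_subexponential) auto
  moreover have "(1 / Gamma (p + 1)) * (f x * (x powr p * exp (- (1 - a) * x))) =
      f x * (laguerre_weight p x * exp (a * x))" for x
    by (simp add: laguerre_weight_def algebra_simps flip: exp_add)
  ultimately show ?thesis by simp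
qed

lemma integrable_laguerre_weight:
  "subexponential f \<Longrightarrow> integrable half_line (\<lambda>x. f x * laguerre_weight p x)"
  using integrable_laguerre_weight_exp[of f 0] by simp

text \<open>Because the weight contains \<open>exp (- x)\<close>, this is the Laplace transform of
  \<open>f x * x powr p / Gamma (p + 1)\<close> at the point 1 + \<i> t.\<close>

definition laguerre_transform :: "(real \<Rightarrow> real) \<Rightarrow> real \<Rightarrow> complex" where
  "laguerre_transform f t = (\<integral>x. complex_of_real (f x * laguerre_weight p x) * iexp (- t * x) \<partial>half_line)"

lemma integrable_laguerre_transform:
  "subexponential f \<Longrightarrow>
    integrable half_line (\<lambda>x. complex_of_real (f x * laguerre_weight p x) * iexp (t * x))"
  by (intro integrable_mult_iexp integrable_of_real integrable_laguerre_weight)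

lemma laguerre_transform_add:
  assumes "subexponential f" "subexponential g"
  shows "laguerre_transform (\<lambda>x. f x + g x) t = laguerre_transform f t + laguerre_transform g t"
  unfolding laguerre_transform_def
  by (subst Bochner_Integration.integral_add[symmetric])
    (auto intro!: integrable_laguerre_transform assms simp only: distrib_right of_real_add)

lemma laguerre_transform_cmult:
  "laguerre_transform (\<lambda>x. a * f x) t = a * laguerre_transform f t"
  unfolding laguerre_transform_def integral_mult_right_zero[symmetric]
  by (simp only: of_real_mult mult.assoc)

lemma laguerre_transform_deriv:
  assumes f: "subexponential f"
  shows "(laguerre_transform f has_vector_derivative - \<i> * laguerre_transform (\<lambda>x. x * f x) t) (at t)"
proof -
  have "integrable half_line (\<lambda>x. x * (f x * laguerre_weight p x))"
    using integrable_laguerre_weight[OF subexponential_mult[OF subexponential_ident f]]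
    by (simp only: mult.assoc)
  from integral_iexp_has_vector_derivative[OF integrable_laguerre_weight[OF f] this]
  show ?thesis unfolding laguerre_transform_def[abs_def] by (simp only: mult.assoc)
qed

text \<open>Integration by parts: \<open>x\<^sup>p\<^sup>+\<^sup>1 e\<^sup>-\<^sup>z\<^sup>x\<close> vanishes at both ends of the half-line.\<close>

lemma laguerre_transform_ident:
  "(1 + \<i> * t) * laguerre_transform (\<lambda>x. x) t = (p + 1) * laguerre_transform (\<lambda>_. 1) t"
proof -
  define z where "z = 1 + \<i> * complex_of_real t"
  define F where "F x = complex_of_real (x powr (p + 1) / Gamma (p + 1)) * exp (- z * x)" for x :: real
  define f where "f x = (p + 1) * (complex_of_real (1 * laguerre_weight p x) * iexp (- t * x)) -
      z * (complex_of_real (x * laguerre_weight p x) * iexp (- t * x))" for x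
  have int: "integrable half_line f"
    unfolding f_def
    by (intro Bochner_Integration.integrable_diff integrable_mult_right integrable_laguerre_transform
        subexponential_const subexponential_ident)
  have normF: "norm (F x) = x powr (p + 1) * exp (- x) / Gamma (p + 1)" for x
    using p Gamma_pos by (simp add: F_def norm_mult norm_divide z_def)
  have e: "exp (- z * x) = complex_of_real (exp (- x)) * iexp (- t * x)" for x :: real
  proof -
    have "- z * x = complex_of_real (- x) + \<i> * complex_of_real (- t * x)"
      by (simp add: z_def algebra_simps)
    then show ?thesis by (simp only: exp_add exp_of_real)
  qed
  have "(LBINT x=0..\<infinity>. f x) = 0 - 0"
  proof (rule interval_integral_FTC_integrable)
    fix x assume "0 < ereal x"
    then have x: "x > 0" by simp
    have d1: "((\<lambda>x. complex_of_real (x powr (p + 1) / Gamma (p + 1))) has_vector_derivative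
        complex_of_real ((p + 1) * x powr p / Gamma (p + 1))) (at x)"
      using x
      by (intro has_vector_derivative_of_real) (auto intro!: derivative_eq_intros simp: Gamma_nonzero)
    have d2: "((\<lambda>x. exp (- z * complex_of_real x)) has_vector_derivative - z * exp (- z * x)) (at x)"
    proof -
      have "((\<lambda>w. exp (- z * w)) has_field_derivative - z * exp (- z * x)) (at (complex_of_real x))"
        by (auto intro!: derivative_eq_intros)
      moreover have "(complex_of_real has_vector_derivative 1) (at x)"
        using has_vector_derivative_of_real[OF DERIV_ident] by simp
      ultimately show ?thesis
        using field_vector_diff_chain_at[of complex_of_real 1 x "\<lambda>w. exp (- z * w)"] by (simp add: o_def)
    qed
    have "(F has_vector_derivative complex_of_real (x powr (p + 1) / Gamma (p + 1)) * (- z * exp (- z * x)) +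
        complex_of_real ((p + 1) * x powr p / Gamma (p + 1)) * exp (- z * x)) (at x)"
      unfolding F_def[abs_def] by (rule has_vector_derivative_mult[OF d1 d2])
    also have "complex_of_real (x powr (p + 1) / Gamma (p + 1)) * (- z * exp (- z * x)) +
        complex_of_real ((p + 1) * x powr p / Gamma (p + 1)) * exp (- z * x) = f x"
      unfolding f_def e laguerre_weight_def using x by (simp add: powr_add algebra_simps)
    finally show "(F has_vector_derivative f x) (at x)" .
    have "continuous_on {0<..} f"
      unfolding f_def[abs_def] laguerre_weight_def by (intro continuous_intros) (auto simp: Gamma_nonzero)
    then show "isCont f x" using x by (simp add: continuous_on_eq_continuous_at)
  next
    show "set_integrable lborel (einterval 0 \<infinity>) f"
      using int by (simp add: integrable_half_line zero_ereal_def)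
    have "((\<lambda>x. norm (F x)) \<longlongrightarrow> 0) (at_right 0)"
      unfolding normF
    proof (rule tendsto_eq_rhs)
      show "((\<lambda>x. x powr (p + 1) * exp (- x) / Gamma (p + 1)) \<longlongrightarrow> 0 * exp (- 0) / Gamma (p + 1)) (at_right 0)"
        using p Gamma_pos
        by (intro tendsto_intros tendsto_zero_powrI[where b = "p + 1"])
          (auto simp: eventually_at_filter)
    qed simp
    then have "(F \<longlongrightarrow> 0) (at_right 0)" by (simp only: tendsto_norm_zero_iff)
    then show "((F \<circ> real_of_ereal) \<longlongrightarrow> 0) (at_right 0)"
      by (simp add: zero_ereal_def ereal_tendsto_simps)
    obtain m :: nat where m: "p + 1 \<le> m" using real_arch_simple by blast
    have "((\<lambda>x. norm (F x)) \<longlongrightarrow> 0) at_top"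
    proof (rule tendsto_sandwich[OF _ _ tendsto_const])
      show "((\<lambda>x. x ^ m / exp x / Gamma (p + 1)) \<longlongrightarrow> 0) at_top"
        using tendsto_divide[OF tendsto_power_div_exp_0[of m] tendsto_const[of "Gamma (p + 1)"]]
          p Gamma_pos by simp
      show "\<forall>\<^sub>F x in at_top. norm (F x) \<le> x ^ m / exp x / Gamma (p + 1)"
      proof (rule eventually_mono[OF eventually_ge_at_top[of 1]])
        fix x :: real assume x: "1 \<le> x"
        then have "x powr (p + 1) \<le> x ^ m" using m by (simp add: powr_mono flip: powr_realpow)
        then show "norm (F x) \<le> x ^ m / exp x / Gamma (p + 1)"
          unfolding normF using p Gamma_pos
          by (simp add: exp_minus divide_inverse mult_right_mono)
      qed
    qed auto
    then have "(F \<longlongrightarrow> 0) at_top" by (simp only: tendsto_norm_zero_iff)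
    then show "((F \<circ> real_of_ereal) \<longlongrightarrow> 0) (at_left \<infinity>)"
      by (simp add: ereal_tendsto_simps)
  qed simp
  then have "(\<integral>x. f x \<partial>half_line) = 0"
    by (simp add: zero_ereal_def interval_integral_to_infinity_eq set_lebesgue_integral_def
        integral_restrict_space)
  moreover have "(\<integral>x. f x \<partial>half_line) = (p + 1) * laguerre_transform (\<lambda>_. 1) t - z * laguerre_transform (\<lambda>x. x) t"
    unfolding f_def laguerre_transform_def
    by (subst Bochner_Integration.integral_diff)
      (auto intro!: integrable_mult_right integrable_laguerre_transform subexponential_const subexponential_ident
        simp only: integral_mult_right_zero)
  ultimately show ?thesis by (simp add: z_def)
qed

text \<open>Integration by parts gives a first-order linear differential equation in t, for which
  multiplication by \<open>z t powr of_real (p + 1)\<close> is an integrating factor. The principal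
  branch is smooth along the line because its real part is 1, and the Gamma integral fixes the value
  at t = 0.\<close>

lemma laguerre_transform_one: "laguerre_transform (\<lambda>_. 1) t = (1 + \<i> * t) powr (- of_real (p + 1))"
proof -
  define z where "z t = 1 + \<i> * complex_of_real t" for t
  have z: "z t \<notin> \<real>\<^sub>\<le>\<^sub>0" "z t \<noteq> 0" for t
    by (auto simp: z_def complex_nonpos_Reals_iff complex_eq_iff)
  let ?u = "laguerre_transform (\<lambda>_. 1)"
  let ?g = "\<lambda>t. ?u t * z t powr of_real (p + 1)"
  have "(?g has_vector_derivative 0) (at t)" for t
  proof -
    have "(z has_vector_derivative \<i>) (at t)"
      unfolding z_def[abs_def] by (auto intro!: derivative_eq_intros)
    from field_vector_diff_chain_at[OF this has_field_derivative_powr[OF z(1)], of "of_real (p + 1)"]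
    have d: "((\<lambda>t. z t powr of_real (p + 1)) has_vector_derivative
        \<i> * (of_real (p + 1) * z t powr (of_real (p + 1) - 1))) (at t)"
      by (simp add: o_def)
    have "(?g has_vector_derivative ?u t * (\<i> * (of_real (p + 1) * z t powr (of_real (p + 1) - 1))) +
        (- \<i> * laguerre_transform (\<lambda>x. x * 1) t) * z t powr of_real (p + 1)) (at t)"
      by (intro has_vector_derivative_mult laguerre_transform_deriv subexponential_const d)
    moreover have "z t powr (of_real (p + 1) - 1) = z t powr of_real (p + 1) / z t"
      using z(2)[of t] by (subst powr_diff) simp
    moreover have "laguerre_transform (\<lambda>x. x * 1) t = (p + 1) * ?u t / z t"
      using laguerre_transform_ident[of t] z(2)[of t] by (simp add: z_def field_simps)
    ultimately show ?thesis by simp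
  qed
  then have "?g t = ?g 0"
    using has_vector_derivative_zero_constant[of UNIV ?g] by (metis convex_UNIV UNIV_I)
  also have "?g 0 = 1"
  proof -
    have "?u 0 = complex_of_real (\<integral>x. laguerre_weight p x \<partial>half_line)"
      by (simp add: laguerre_transform_def)
    also have "(\<integral>x. laguerre_weight p x \<partial>half_line) = 1"
      using integral_powr_exp[OF p] by (simp add: laguerre_weight_def Gamma_nonzero)
    finally show ?thesis by (simp add: z_def)
  qed
  finally have "?u t * z t powr of_real (p + 1) = 1" .
  then have "?u t = inverse (z t powr of_real (p + 1))" by (metis inverse_unique mult.commute)
  then show ?thesis by (simp only: powr_minus z_def)
qed

definition laguerre_coeff :: "nat \<Rightarrow> real" where
  "laguerre_coeff n = sqrt (pochhammer (p + 1) n / fact n)"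

lemma laguerre_coeff_0: "laguerre_coeff 0 = 1" by (simp add: laguerre_coeff_def)

text \<open>The squared ratio of consecutive coefficients is (n + 1 + p) / (n + 1); multiplied by
  the square of \<open>lag_a p n\<close> it becomes a perfect square, so no root survives.\<close>

lemma lag_a_mult_coeff_Suc: "lag_a p n * laguerre_coeff (Suc n) = (real n + 1 + p) * laguerre_coeff n"
proof -
  have "pochhammer (p + 1) (Suc n) / fact (Suc n) =
      (pochhammer (p + 1) n / fact n) * ((real n + 1 + p) / (real n + 1))"
    by (simp add: pochhammer_Suc add_ac)
  then have "(real n + 1) * (real n + 1 + p) * (pochhammer (p + 1) (Suc n) / fact (Suc n)) =
      (real n + 1 + p)\<^sup>2 * (pochhammer (p + 1) n / fact n)"
    by (simp add: power2_eq_square)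
  then show ?thesis
    using p unfolding lag_a_def laguerre_coeff_def real_sqrt_mult[symmetric]
    by (simp only: real_sqrt_mult real_sqrt_abs)
qed

lemma lag_a_mult_coeff: "lag_a p n * laguerre_coeff n = (real n + 1) * laguerre_coeff (Suc n)"
proof -
  have "lag_a p n * (lag_a p n * laguerre_coeff n) = (real n + 1) * ((real n + 1 + p) * laguerre_coeff n)"
    using p by (simp add: lag_a_def mult.assoc[symmetric])
  also have "\<dots> = lag_a p n * ((real n + 1) * laguerre_coeff (Suc n))"
    by (simp flip: lag_a_mult_coeff_Suc)
  finally show ?thesis using lag_a_pos[of n] by simp
qed

text \<open>Multiplication by \<open>x\<close> becomes \<open>-d/dz\<close> under the Laplace transform at \<open>z = 1 + i t\<close>, so the three-term
  recurrence determines the transforms of all Laguerre polynomials from that of \<open>1\<close>.\<close>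

lemma laguerre_transform_laguerre:
  "laguerre_transform (laguerre p n) t =
    laguerre_coeff n * (1 + \<i> * t) powr (- of_real (p + 1)) * (1 / (1 + \<i> * t) - 1) ^ n"
proof (induction n arbitrary: t rule: less_induct)
  case (less n)
  define z where "z t = 1 + \<i> * complex_of_real t" for t
  have z: "z t \<notin> \<real>\<^sub>\<le>\<^sub>0" "z t \<noteq> 0" for t
    by (auto simp: z_def complex_nonpos_Reals_iff complex_eq_iff)
  define w where "w t = 1 / z t - 1" for t
  define s where "s = - complex_of_real (p + 1)"
  define e where "e t = z t powr s" for t
  show ?case
  proof (cases n)
    case 0
    then show ?thesis using laguerre_transform_one by (simp add: laguerre_coeff_0 fun_eq_iff)
  next
    case (Suc m)
    let ?L = "\<lambda>n t. laguerre_transform (laguerre p n) t"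
    have IH: "?L k t = laguerre_coeff k * e t * w t ^ k" if "k \<le> m" for k t
      using less[of k t] that Suc by (simp add: e_def w_def z_def s_def)
    \<comment> \<open>The point \<open>z t\<close> moves with velocity \<i>, whence the outer
      factor. At m = 0 the truncated exponent m - 1 is harmless because of the factor
      \<open>of_nat m\<close>.\<close>
    have "((\<lambda>t. laguerre_coeff m * e t * w t ^ m) has_vector_derivative
        \<i> * (laguerre_coeff m * (s * e t / z t * w t ^ m - e t * (of_nat m * w t ^ (m - 1)) / (z t)\<^sup>2))) (at t)"
    proof -
      have "(z has_vector_derivative \<i>) (at t)"
        unfolding z_def[abs_def] by (auto intro!: derivative_eq_intros)
      moreover have "((\<lambda>z. laguerre_coeff m * z powr s * (1 / z - 1) ^ m) has_field_derivative
          (laguerre_coeff m * (s * e t / z t * w t ^ m - e t * (of_nat m * w t ^ (m - 1)) / (z t)\<^sup>2))) (at (z t))"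
        using z[of t] unfolding e_def w_def
        by (auto intro!: derivative_eq_intros has_field_derivative_powr
            simp: powr_diff power2_eq_square algebra_simps)
      ultimately show ?thesis
        using field_vector_diff_chain_at by (fastforce simp: o_def e_def w_def)
    qed
    moreover have "(?L m has_vector_derivative - \<i> * laguerre_transform (\<lambda>x. x * laguerre p m x) t) (at t)"
      by (intro laguerre_transform_deriv subexponential_laguerre)
    moreover have "?L m = (\<lambda>t. laguerre_coeff m * e t * w t ^ m)" using IH by auto
    ultimately have "- \<i> * laguerre_transform (\<lambda>x. x * laguerre p m x) t =
        \<i> * (laguerre_coeff m * (s * e t / z t * w t ^ m - e t * (of_nat m * w t ^ (m - 1)) / (z t)\<^sup>2))"
      using vector_derivative_unique_at by metis
    moreover have "X = - Y" if "- \<i> * X = \<i> * Y" for X Y :: complex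
    proof -
      have "\<i> * (X + Y) = 0" using that by (simp add: distrib_left flip: that)
      then show ?thesis by (simp add: eq_neg_iff_add_eq_0)
    qed
    ultimately have "laguerre_transform (\<lambda>x. x * laguerre p m x) t =
        - (laguerre_coeff m * (s * e t / z t * w t ^ m - e t * (of_nat m * w t ^ (m - 1)) / (z t)\<^sup>2))"
      by blast
    also have "\<dots> = laguerre_coeff m * e t * (of_real (p + 1) / z t * w t ^ m + of_nat m * w t ^ (m - 1) / (z t)\<^sup>2)"
      by (simp add: s_def algebra_simps add_divide_distrib diff_divide_distrib)
    finally have D: "laguerre_transform (\<lambda>x. x * laguerre p m x) t =
        laguerre_coeff m * e t * (of_real (p + 1) / z t * w t ^ m + of_nat m * w t ^ (m - 1) / (z t)\<^sup>2)" .
    define r where "r = (if m = 0 then 0 else lag_a p (m - 1))"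
    have "laguerre_transform (\<lambda>x. x * laguerre p m x) t =
        r * ?L (m - 1) t + lag_b p m * ?L m t + lag_a p m * ?L (Suc m) t"
    proof -
      have "(\<lambda>x. x * laguerre p m x) = (\<lambda>x. (r * laguerre p (m - 1) x +
          lag_b p m * laguerre p m x) + lag_a p m * laguerre p (Suc m) x)"
        unfolding r_def by (subst laguerre_recurrence) auto
      then show ?thesis
        by (simp only: laguerre_transform_add laguerre_transform_cmult subexponential_add
            subexponential_cmult subexponential_laguerre)
    qed
    moreover have "r * ?L (m - 1) t = e t * laguerre_coeff m * (of_nat m * w t ^ (m - 1))"
    proof (cases m)
      case (Suc l)
      then have "complex_of_real r * laguerre_coeff l = of_nat m * laguerre_coeff m"
        using lag_a_mult_coeff[of l] unfolding r_def
        by (simp flip: of_real_mult)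
      then show ?thesis using IH[of l t] Suc by (simp add: mult_ac)
    qed (simp add: r_def)
    moreover have "of_nat m * w t ^ m = of_nat m * (w t * w t ^ (m - 1))"
      by (cases m) auto
    ultimately have "lag_a p m * ?L (Suc m) t = e t * laguerre_coeff m * ((of_nat m + 1 + of_real p) * w t ^ Suc m)"
    proof -
      assume 1: "laguerre_transform (\<lambda>x. x * laguerre p m x) t =
        r * ?L (m - 1) t + lag_b p m * ?L m t + lag_a p m * ?L (Suc m) t"
      assume 2: "r * ?L (m - 1) t = e t * laguerre_coeff m * (of_nat m * w t ^ (m - 1))"
      assume 3: "of_nat m * w t ^ m = of_nat m * (w t * w t ^ (m - 1))"
      \<comment> \<open>Writing \<open>1 / z t\<close> as \<open>w t + 1\<close> reduces the
        recurrence to a polynomial identity in \<open>w t\<close>, in which the powers m - 1 and m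
        cancel and only m + 1 remains.\<close>
      have iz: "1 / z t = w t + 1" by (simp add: w_def)
      have "lag_a p m * ?L (Suc m) t = laguerre_coeff m * e t * (of_real (p + 1) / z t * w t ^ m + of_nat m * w t ^ (m - 1) / (z t)\<^sup>2)
          - e t * laguerre_coeff m * (of_nat m * w t ^ (m - 1)) - lag_b p m * (laguerre_coeff m * e t * w t ^ m)"
        using 1 unfolding D 2 IH[OF order_refl] by (simp add: algebra_simps)
      also have "\<dots> = laguerre_coeff m * e t * (of_real (p + 1) * w t ^ m * (w t + 1) + of_nat m * w t ^ (m - 1) * (w t + 1)\<^sup>2
          - of_nat m * w t ^ (m - 1) - (2 * of_nat m + of_real p + 1) * w t ^ m)"
        unfolding iz[symmetric] by (simp add: lag_b_def algebra_simps power2_eq_square add_divide_distrib)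
      also have "of_nat m * w t ^ (m - 1) * (w t + 1)\<^sup>2 = w t * (of_nat m * w t ^ m)
          + 2 * (of_nat m * w t ^ m) + of_nat m * w t ^ (m - 1)"
        unfolding 3 by (simp add: power2_eq_square algebra_simps)
      finally show ?thesis by (simp add: algebra_simps)
    qed
    also have "\<dots> = lag_a p m * (laguerre_coeff (Suc m) * e t * w t ^ Suc m)"
    proof -
      have "complex_of_real (lag_a p m) * laguerre_coeff (Suc m) = (of_nat m + 1 + of_real p) * laguerre_coeff m"
        using arg_cong[OF lag_a_mult_coeff_Suc[of m], of complex_of_real] by simp
      then show ?thesis by (simp add: mult.assoc[symmetric])
    qed
    finally have "?L (Suc m) t = laguerre_coeff (Suc m) * e t * w t ^ Suc m"
      using lag_a_pos[of m] by simp
    then show ?thesis by (simp only: Suc e_def w_def z_def s_def)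
  qed
qed

text \<open>At t = 0 the base \<open>1 / (1 + \<i> * t) - 1\<close> is zero, so its n-th power is 1
  for n = 0 and vanishes otherwise.\<close>

lemma integral_laguerre:
  "(\<integral>x. laguerre p n x * laguerre_weight p x \<partial>half_line) = (if n = 0 then 1 else 0)"
proof -
  have "complex_of_real (\<integral>x. laguerre p n x * laguerre_weight p x \<partial>half_line) =
      laguerre_transform (laguerre p n) 0"
    unfolding laguerre_transform_def by (simp flip: of_real_mult)
  also have "\<dots> = complex_of_real (if n = 0 then 1 else 0)"
    by (simp add: laguerre_transform_laguerre laguerre_coeff_0 power_0_left)
  finally show ?thesis by (simp only: of_real_eq_iff)
qed

text \<open>Multiplication by \<open>x\<close> is symmetric, so the Gram matrix satisfies the three-term recurrence in both
  indices; its first row determines it.\<close>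

lemma laguerre_orthonormal:
  "(\<integral>x. laguerre p m x * laguerre p n x * laguerre_weight p x \<partial>half_line) = (if m = n then 1 else 0)"
proof (induction m arbitrary: n rule: less_induct)
  case (less m)
  define B where "B m n = (\<integral>x. laguerre p m x * laguerre p n x * laguerre_weight p x \<partial>half_line)" for m n
  have int: "integrable half_line (\<lambda>x. a * (laguerre p m x * laguerre p n x * laguerre_weight p x))" for a m n
    by (intro integrable_mult_right integrable_laguerre_weight subexponential_mult subexponential_laguerre)
  have lin: "(\<integral>x. x * laguerre p m x * laguerre p n x * laguerre_weight p x \<partial>half_line) =
      (if m = 0 then 0 else lag_a p (m - 1)) * B (m - 1) n + lag_b p m * B m n + lag_a p m * B (Suc m) n" for m n
  proof -
    have "(\<integral>x. x * laguerre p m x * laguerre p n x * laguerre_weight p x \<partial>half_line) =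
        (\<integral>x. ((if m = 0 then 0 else lag_a p (m - 1)) * (laguerre p (m - 1) x * laguerre p n x * laguerre_weight p x)
        + lag_b p m * (laguerre p m x * laguerre p n x * laguerre_weight p x))
        + lag_a p m * (laguerre p (Suc m) x * laguerre p n x * laguerre_weight p x) \<partial>half_line)"
      by (subst laguerre_recurrence) (simp add: algebra_simps)
    also have "\<dots> = (if m = 0 then 0 else lag_a p (m - 1)) * B (m - 1) n + lag_b p m * B m n + lag_a p m * B (Suc m) n"
      unfolding B_def integral_mult_right_zero[symmetric]
      by (subst Bochner_Integration.integral_add, (intro Bochner_Integration.integrable_add int)+)+ simp
    finally show ?thesis .
  qed
  have sym: "B m n = B n m" for m n by (simp add: B_def mult.commute)
  show ?case
  proof (cases m)
    case 0
    then show ?thesis using integral_laguerre[of n] by simp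
  next
    case (Suc k)
    have IH: "B j l = (if j = l then 1 else 0)" if "j \<le> k" for j l
      using less[of j l] that Suc by (simp add: B_def)
    have "(\<integral>x. x * laguerre p k x * laguerre p n x * laguerre_weight p x \<partial>half_line) =
        (\<integral>x. x * laguerre p n x * laguerre p k x * laguerre_weight p x \<partial>half_line)"
      by (simp add: mult_ac)
    from this[unfolded lin] have "lag_a p k * B (Suc k) n =
      (if n = 0 then 0 else lag_a p (n - 1)) * B k (n - 1) + lag_b p n * B k n + lag_a p n * B k (Suc n)
      - (if k = 0 then 0 else lag_a p (k - 1)) * B (k - 1) n - lag_b p k * B k n"
      by (simp only: sym[of _ k])
    also have "\<dots> = lag_a p k * (if Suc k = n then 1 else 0)"
      by (auto simp: IH split: if_splits)
    finally show ?thesis using lag_a_pos[of k] Suc by (simp add: B_def split: if_splits)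
  qed
qed

end

section \<open>The multiplication group and the operators \<open>\<Phi>\<close>\<close>

lemma ell2_nth_trunc: "ell2_nth (trunc_ell2 N f) n = (if n < N then ell2_nth f n else 0)"
  by (auto simp: trunc_ell2_def ell2_nth_sum if_distrib cong: if_cong)

lemma sq_integrable_mult_exp:
  assumes "sq_integrable f"
  shows "sq_integrable (\<lambda>x. iexp (t * x) * f x)"
proof -
  have "(\<lambda>x. iexp (t * x)) \<in> borel_measurable half_line"
    by (rule borel_measurable_half_line) measurable
  then have "(\<lambda>x. iexp (t * x) * f x) \<in> borel_measurable half_line"
    using assms by (intro borel_measurable_times) (auto simp: sq_integrable_def)
  then show ?thesis
    using assms unfolding sq_integrable_def norm_mult norm_exp_i_times by simp
qed

lift_definition mult_exp :: "real \<Rightarrow> L2_half_line \<Rightarrow> L2_half_line" is "\<lambda>t f x. iexp (t * x) * f x"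
  unfolding L2_rel_def by (auto simp del: of_real_mult intro!: sq_integrable_mult_exp)

lemma mult_exp_L2_class: "sq_integrable f \<Longrightarrow> mult_exp t (L2_class f) = L2_class (\<lambda>x. iexp (t * x) * f x)"
  by (simp add: mult_exp.abs_eq L2_rel_def)

text \<open>Dominated convergence in square mean; the domination is imposed on the error, since that
  is what the applications estimate.\<close>

lemma L2_class_LIMSEQ:
  assumes F: "\<And>k. sq_integrable (F k)" and G: "sq_integrable G" and H: "sq_integrable H"
    and bound: "\<And>k x. x > 0 \<Longrightarrow> norm (F k x - G x) \<le> norm (H x)"
    and lim: "\<And>x. x > 0 \<Longrightarrow> (\<lambda>k. F k x) \<longlonglongrightarrow> G x"
  shows "(\<lambda>k. L2_class (F k)) \<longlonglongrightarrow> L2_class G"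
proof -
  have "(\<lambda>k. \<integral>x. (norm (F k x - G x))\<^sup>2 \<partial>half_line) \<longlonglongrightarrow> (\<integral>x. 0 \<partial>half_line)"
  proof (rule integral_dominated_convergence)
    show "integrable half_line (\<lambda>x. (norm (H x))\<^sup>2)" using H by (simp add: sq_integrable_def)
    show "(\<lambda>x. (norm (F k x - G x))\<^sup>2) \<in> borel_measurable half_line" for k
      using sq_integrable_diff[OF F[of k] G] by (auto simp: sq_integrable_def)
    show "AE x in half_line. (\<lambda>k. (norm (F k x - G x))\<^sup>2) \<longlonglongrightarrow> 0"
    proof (rule AE_I2)
      fix x assume "x \<in> space half_line"
      then have "(\<lambda>k. F k x) \<longlonglongrightarrow> G x" using lim by (simp add: space_restrict_space)
      then have "(\<lambda>k. (norm (F k x - G x))\<^sup>2) \<longlonglongrightarrow> (norm (G x - G x))\<^sup>2" by (intro tendsto_intros)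
      then show "(\<lambda>k. (norm (F k x - G x))\<^sup>2) \<longlonglongrightarrow> 0" by simp
    qed
    show "AE x in half_line. norm ((norm (F k x - G x))\<^sup>2) \<le> (norm (H x))\<^sup>2" for k
      using bound by (intro AE_I2) (auto simp: space_restrict_space intro!: power_mono)
  qed simp
  then have "(\<lambda>k. sqrt ((norm (L2_class (F k) - L2_class G))\<^sup>2)) \<longlonglongrightarrow> sqrt 0"
    by (intro tendsto_real_sqrt) (simp add: L2_class_diff norm_L2_class sq_integrable_diff F G)
  then have "(\<lambda>k. norm (L2_class (F k) - L2_class G)) \<longlonglongrightarrow> 0" by simp
  then show ?thesis by (simp only: tendsto_norm_zero_iff LIM_zero_iff)
qed

lemma unitary_group_mult_exp: "unitary_group mult_exp"
proof -
  have zero: "mult_exp 0 = id"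
  proof
    fix x show "mult_exp 0 x = id x"
      by (rule L2_class_surj[of x]) (simp add: mult_exp_L2_class)
  qed
  have add: "mult_exp (s + t) = mult_exp s \<circ> mult_exp t" for s t
  proof
    fix x show "mult_exp (s + t) x = (mult_exp s \<circ> mult_exp t) x"
    proof (rule L2_class_surj[of x])
      fix f assume f: "sq_integrable f" "x = L2_class f"
      have "iexp ((s + t) * x) = iexp (s * x) * iexp (t * x)" for x
        by (simp add: algebra_simps flip: exp_add)
      then show ?thesis
        unfolding f(2) by (simp only: comp_apply mult_exp_L2_class sq_integrable_mult_exp f(1) mult.assoc)
    qed
  qed
  have "unitary (mult_exp t)" for t
    unfolding unitary_def clinear_def
  proof (intro conjI allI)
    show "mult_exp t (x + y) = mult_exp t x + mult_exp t y" for x y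
      by (rule L2_class_surj[of x], rule L2_class_surj[of y])
        (simp add: mult_exp_L2_class L2_class_add sq_integrable_mult_exp[simplified] sq_integrable_add distrib_left)
    show "mult_exp t (a *\<^sub>C x) = a *\<^sub>C mult_exp t x" for a x
      by (rule L2_class_surj[of x])
        (simp only: mult_exp_L2_class L2_class_scaleC sq_integrable_mult_exp sq_integrable_cmult mult.left_commute)
    show "surj (mult_exp t)"
      by (rule surjI[of _ "mult_exp (- t)"]) (metis add zero comp_apply id_apply add.right_inverse)
    show "cinner (mult_exp t x) (mult_exp t y) = cinner x y" for x y
    proof (rule L2_class_surj[of x], rule L2_class_surj[of y])
      fix f g assume fg: "sq_integrable f" "sq_integrable g" "x = L2_class f" "y = L2_class g"
      have "iexp (t * x) * f x * cnj (iexp (t * x) * g x) = f x * cnj (g x)" for x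
      proof -
        have "iexp (t * x) * cnj (iexp (t * x)) = 1" by (simp add: exp_cnj flip: exp_add)
        then show ?thesis by (simp only: complex_cnj_mult mult_ac) (simp add: mult_ac)
      qed
      then show ?thesis
        using fg by (simp only: mult_exp_L2_class cinner_L2_class sq_integrable_mult_exp)
    qed
  qed
  moreover have "continuous_on UNIV (\<lambda>t. mult_exp t x)" for x
    unfolding continuous_on_sequentially o_def
  proof (rule L2_class_surj[of x], intro allI ballI impI, elim conjE)
    fix f and X :: "nat \<Rightarrow> real" and t assume f: "sq_integrable f" "x = L2_class f" and X: "X \<longlonglongrightarrow> t"
    show "(\<lambda>k. mult_exp (X k) x) \<longlonglongrightarrow> mult_exp t x"
      unfolding f(2) mult_exp_L2_class[OF f(1)]
    proof (rule L2_class_LIMSEQ[OF sq_integrable_mult_exp sq_integrable_mult_exp sq_integrable_cmult])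
      show "(\<lambda>k. iexp (X k * x) * f x) \<longlonglongrightarrow> iexp (t * x) * f x" for x
        by (intro tendsto_intros X)
      show "norm (iexp (X k * x) * f x - iexp (t * x) * f x) \<le> norm (2 * f x)" for k x
        using norm_triangle_ineq4[of "iexp (X k * x) * f x" "iexp (t * x) * f x"]
        by (simp add: norm_mult)
    qed (rule f)+
  qed
  ultimately show ?thesis using zero add by (simp add: unitary_group_def)
qed

text \<open>The difference quotient is at most \<bar>x f x\<bar> in modulus, so twice this function
  dominates its distance to the limit, and it is square-integrable by assumption.\<close>

lemma generator_mult_exp:
  assumes f: "sq_integrable f" and xf: "sq_integrable (\<lambda>x. complex_of_real x * f x)"
  shows "(L2_class f, L2_class (\<lambda>x. complex_of_real x * f x)) \<in> generator mult_exp"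
  unfolding generator_iff tendsto_at_iff_sequentially o_def
proof (intro allI impI)
  fix X :: "nat \<Rightarrow> real" assume X0: "\<forall>i. X i \<in> UNIV - {0}" and X: "X \<longlonglongrightarrow> 0"
  let ?c = "\<lambda>k. 1 / (\<i> * complex_of_real (X k))"
  have "(\<lambda>k. L2_class (\<lambda>x. ?c k * (iexp (X k * x) * f x - f x))) \<longlonglongrightarrow> L2_class (\<lambda>x. complex_of_real x * f x)"
  proof (rule L2_class_LIMSEQ)
    show "sq_integrable (\<lambda>x. ?c k * (iexp (X k * x) * f x - f x))" for k
      by (intro sq_integrable_cmult sq_integrable_diff sq_integrable_mult_exp f)
    show "sq_integrable (\<lambda>x. 2 * (complex_of_real x * f x))"
      by (rule sq_integrable_cmult[OF xf])
    show "sq_integrable (\<lambda>x. complex_of_real x * f x)" by (rule xf)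
    show "norm (?c k * (iexp (X k * x) * f x - f x) - complex_of_real x * f x) \<le>
        norm (2 * (complex_of_real x * f x))" for k x
    proof -
      have "norm (?c k * (iexp (X k * x) - 1)) \<le> \<bar>x\<bar>"
        using norm_iexp_quotient_le[of "X k" x] X0 by (simp add: norm_mult norm_divide)
      then have "norm (?c k * (iexp (X k * x) - 1) - complex_of_real x) \<le> 2 * \<bar>x\<bar>"
        using norm_triangle_ineq4[of "?c k * (iexp (X k * x) - 1)" "complex_of_real x"]
        by (simp only: norm_of_real)
      then have "norm (?c k * (iexp (X k * x) - 1) - complex_of_real x) * norm (f x) \<le> 2 * \<bar>x\<bar> * norm (f x)"
        by (rule mult_right_mono) simp
      moreover have "?c k * (iexp (X k * x) * f x - f x) - complex_of_real x * f x =
          (?c k * (iexp (X k * x) - 1) - complex_of_real x) * f x"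
        by (simp only: left_diff_distrib right_diff_distrib mult.assoc mult_1_left)
      ultimately show ?thesis by (simp only: norm_mult norm_of_real) simp
    qed
    show "(\<lambda>k. ?c k * (iexp (X k * x) * f x - f x)) \<longlonglongrightarrow> complex_of_real x * f x" for x
    proof -
      have "(\<lambda>k. (iexp (X k * x) - 1) / complex_of_real (X k) * (f x / \<i>)) \<longlonglongrightarrow>
          (\<i> * complex_of_real x) * (f x / \<i>)"
        using X0 X by (intro tendsto_mult tendsto_const iexp_quotient_LIMSEQ) auto
      moreover have "(iexp (X k * x) - 1) / complex_of_real (X k) * (f x / \<i>) =
          ?c k * (iexp (X k * x) * f x - f x)" for k
        by (simp add: divide_simps) (simp add: algebra_simps)
      moreover have "(j * a) * (b / j) = a * b" if "j \<noteq> 0" for j a b :: complex using that by simp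
      ultimately show ?thesis by (simp only: complex_i_not_zero not_False_eq_True)
    qed
  qed
  moreover have "?c k *\<^sub>C (mult_exp (X k) (L2_class f) - L2_class f) =
      L2_class (\<lambda>x. ?c k * (iexp (X k * x) * f x - f x))" for k
    by (simp only: mult_exp_L2_class L2_class_diff L2_class_scaleC sq_integrable_diff sq_integrable_mult_exp f)
  ultimately show "(\<lambda>k. ?c k *\<^sub>C (mult_exp (X k) (L2_class f) - L2_class f)) \<longlonglongrightarrow>
      L2_class (\<lambda>x. complex_of_real x * f x)" by simp
qed

section \<open>Transport by unitary maps and linearity of generators\<close>

lemma unitary_group_conj:
  assumes T: "unitary T" and U: "unitary_group U"
  shows "unitary_group (\<lambda>t f. inv T (U t (T f)))"
proof -
  have [simp]: "T (inv T x) = x" for x using unitary_surj[OF T] by (rule surj_f_inv_f)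
  have "unitary (\<lambda>f. inv T (U t (T f)))" for t
    using unitary_inv[OF T] unitary_group_unitary[OF U, of t] T bij_is_surj[OF unitary_bij]
    unfolding unitary_def clinear_def
    by (auto intro!: surjI[of "\<lambda>f. inv T (U t (T f))" "\<lambda>f. inv T (U (- t) (T f))"]
        simp: unitary_group_minus'[OF U] inv_f_f[OF unitary_inj[OF T]])
  moreover have "continuous_on UNIV (\<lambda>t. inv T (U t (T f)))" for f
    using continuous_on_compose2[OF unitary_continuous[OF unitary_inv[OF T]] unitary_group_continuous[OF U]]
    by blast
  ultimately show ?thesis
    unfolding unitary_group_def using unitary_inj[OF T]
    by (auto simp: unitary_group_0[OF U] unitary_group_add[OF U] fun_eq_iff)
qed

text \<open>\<open>T\<close> carries the difference quotients of one group to those of the other,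
  and both \<open>T\<close> and its inverse preserve limits.\<close>

lemma generator_conj:
  assumes T: "unitary T"
  shows "(f, g) \<in> generator (\<lambda>t f. inv T (U t (T f))) \<longleftrightarrow> (T f, T g) \<in> generator U"
proof -
  let ?d = "\<lambda>t. (1 / (\<i> * complex_of_real t)) *\<^sub>C (inv T (U t (T f)) - f)"
  have Ti: "T (inv T x) = x" for x using unitary_surj[OF T] by (rule surj_f_inv_f)
  have iT: "inv T (T x) = x" for x using unitary_inj[OF T] by (rule inv_f_f)
  have eq: "T (?d t) = (1 / (\<i> * complex_of_real t)) *\<^sub>C (U t (T f) - T f)" for t
    by (simp add: clinear_scaleC[OF unitary_clinear[OF T]] clinear_diff[OF unitary_clinear[OF T]] Ti)
  show ?thesis
    unfolding generator_iff eq[symmetric]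
    using unitary_tendsto[OF T, of ?d g "at 0"]
      unitary_tendsto[OF unitary_inv[OF T], of "\<lambda>t. T (?d t)" "T g" "at 0"]
    by (auto simp: iT)
qed

lemma generator_add:
  assumes U: "unitary_group U" and f: "(f, f') \<in> generator U" and g: "(g, g') \<in> generator U"
  shows "(f + g, f' + g') \<in> generator U"
proof -
  have "c *\<^sub>C (U t f - f) + c *\<^sub>C (U t g - g) = c *\<^sub>C (U t (f + g) - (f + g))" for t c
    by (simp add: U clinear_add unitary_clinear unitary_group_unitary scaleC_diff_right scaleC_add_right)
  then show ?thesis
    using tendsto_add[OF f[unfolded generator_iff] g[unfolded generator_iff]]
    by (simp only: generator_iff)
qed

lemma generator_scaleC:
  assumes U: "unitary_group U" and f: "(f, f') \<in> generator U"
  shows "(a *\<^sub>C f, a *\<^sub>C f') \<in> generator U"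
proof -
  have "a *\<^sub>C c *\<^sub>C (U t f - f) = c *\<^sub>C (U t (a *\<^sub>C f) - a *\<^sub>C f)" for t c
    by (simp add: clinear_scaleC[OF unitary_clinear[OF unitary_group_unitary[OF U]]] scaleC_diff_right scaleC_scaleC mult.commute)
  then show ?thesis
    using tendsto_scaleC[OF tendsto_const f[unfolded generator_iff], of a]
    by (simp only: generator_iff)
qed


section \<open>Completeness of the Laguerre functions and unitarity of \<open>Phi\<close>\<close>

context
  fixes p :: real
  assumes p: "p > -1"
begin

lemma laguerre_weight_nonneg: "laguerre_weight p x \<ge> 0"
  using less_imp_le[OF Gamma_pos[OF p]] by (simp add: laguerre_weight_def)

text \<open>Squaring doubles the rate a, and 2 a < 1 leaves exponential decay.\<close>

lemma sq_integrable_laguerre_weight_exp: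
  fixes g :: "real \<Rightarrow> complex"
  assumes g: "g \<in> borel_measurable borel" "subexponential (\<lambda>x. norm (g x))" and a: "a < 1 / 2"
  shows "sq_integrable (\<lambda>x. complex_of_real (sqrt (laguerre_weight p x) * exp (a * x)) * g x)"
  unfolding sq_integrable_def
proof
  show "(\<lambda>x. complex_of_real (sqrt (laguerre_weight p x) * exp (a * x)) * g x) \<in> borel_measurable half_line"
  proof (intro borel_measurable_half_line borel_measurable_times g)
    have [measurable]: "laguerre_weight p \<in> borel_measurable borel"
      by (rule borel_measurable_laguerre_weight[OF p])
    show "(\<lambda>x. complex_of_real (sqrt (laguerre_weight p x) * exp (a * x))) \<in> borel_measurable borel"
      by measurable
  qed
  have "integrable half_line (\<lambda>x. (norm (g x))\<^sup>2 * (laguerre_weight p x * exp ((2 * a) * x)))"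
    using a by (intro integrable_laguerre_weight_exp[OF p] subexponential_power g) auto
  moreover have "(norm (complex_of_real (sqrt (laguerre_weight p x) * exp (a * x)) * g x))\<^sup>2 =
      (norm (g x))\<^sup>2 * (laguerre_weight p x * exp ((2 * a) * x))" for x
  proof -
    have "exp (2 * a * x) = (exp (a * x))\<^sup>2" by (simp add: power2_eq_square flip: exp_add)
    then show ?thesis
      using laguerre_weight_nonneg[of x] by (simp add: norm_mult power_mult_distrib abs_mult)
  qed
  ultimately show "integrable half_line (\<lambda>x. (norm (complex_of_real (sqrt (laguerre_weight p x) * exp (a * x)) * g x))\<^sup>2)"
    by simp
qed

lemma sq_integrable_laguerre_weight:
  fixes g :: "real \<Rightarrow> complex"
  assumes "g \<in> borel_measurable borel" "subexponential (\<lambda>x. norm (g x))"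
  shows "sq_integrable (\<lambda>x. complex_of_real (sqrt (laguerre_weight p x)) * g x)"
  using sq_integrable_laguerre_weight_exp[OF assms, of 0] by simp

lemma subexponential_abs: "subexponential f \<Longrightarrow> subexponential (\<lambda>x. \<bar>f x\<bar>)"
  by (auto simp: subexponential_def)

lemma sq_integrable_laguerre_fun: "sq_integrable (\<lambda>x. complex_of_real (f x) * complex_of_real (laguerre_fun p n x))"
  if f: "subexponential f" for f n
proof -
  have s: "subexponential (\<lambda>x. f x * laguerre p n x)"
    by (intro subexponential_mult f subexponential_laguerre p)
  then have "(\<lambda>x. complex_of_real (f x * laguerre p n x)) \<in> borel_measurable borel"
    using subexponential_measurable by measurable
  moreover have "subexponential (\<lambda>x. norm (complex_of_real (f x * laguerre p n x)))"
    unfolding norm_of_real by (rule subexponential_abs[OF s])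
  ultimately have "sq_integrable (\<lambda>x. complex_of_real (sqrt (laguerre_weight p x)) * complex_of_real (f x * laguerre p n x))"
    by (rule sq_integrable_laguerre_weight)
  then show ?thesis by (simp add: laguerre_fun_def mult_ac)
qed

text \<open>The recurrence upgrades orthogonality to all Laguerre functions to the vanishing of all
  moments of h g times the root of the weight. The multiplier \<open>g\<close> serves two purposes:
  g = 1 yields completeness, and g = x - \<i> yields density of the range of J + \<i>.\<close>

lemma AE_zero_of_orthogonal_laguerre:
  assumes h: "sq_integrable h" and g: "g \<in> borel_measurable borel" "subexponential (\<lambda>x. norm (g x))"
    and zero: "\<And>n. (\<integral>x. h x * g x * complex_of_real (laguerre_fun p n x) \<partial>half_line) = 0"
  shows "AE x in half_line. h x * g x = 0"
proof -
  define w where "w x = complex_of_real (sqrt (laguerre_weight p x))" for x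
  define G where "G x = h x * g x * w x" for x
  have w_meas: "w \<in> borel_measurable borel"
    unfolding w_def using borel_measurable_laguerre_weight[OF p] by measurable
  have h_meas: "h \<in> borel_measurable half_line" using h by (simp add: sq_integrable_def)
  have G_meas: "G \<in> borel_measurable half_line"
    unfolding G_def by (intro borel_measurable_times h_meas borel_measurable_half_line g w_meas)
  \<comment> \<open>The rate 1/4 stands for any number strictly between 0 and 1/2: positive for the
    moment theorem, below 1/2 for square-integrability.\<close>
  have sub: "integrable half_line (\<lambda>x. G x * complex_of_real (f x) * complex_of_real (exp (1/4 * x)))" if f: "subexponential f" for f
  proof -
    have m: "(\<lambda>x. complex_of_real (f x) * cnj (g x)) \<in> borel_measurable borel"
      using subexponential_measurable[OF f] g(1)
      by (intro borel_measurable_mult_cnj) measurable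
    have s: "subexponential (\<lambda>x. norm (complex_of_real (f x) * cnj (g x)))"
      using subexponential_mult[OF subexponential_abs[OF f] g(2)] by (simp add: norm_mult)
    have "integrable half_line (\<lambda>x. h x * cnj (complex_of_real (sqrt (laguerre_weight p x) * exp (1/4 * x)) *
        (complex_of_real (f x) * cnj (g x))))"
      by (rule integrable_cinner_L2[OF h sq_integrable_laguerre_weight_exp[OF m s]]) simp
    then show ?thesis by (simp add: G_def w_def mult_ac)
  qed
  have int: "integrable half_line (\<lambda>x. G x * complex_of_real (f x))" if f: "subexponential f" for f
  proof (rule Bochner_Integration.integrable_bound[OF sub[OF f]])
    show "(\<lambda>x. G x * complex_of_real (f x)) \<in> borel_measurable half_line"
      using subexponential_measurable[OF f]
      by (intro borel_measurable_times[OF G_meas] borel_measurable_half_line) measurable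
    show "AE x in half_line. norm (G x * complex_of_real (f x)) \<le> norm (G x * complex_of_real (f x) * complex_of_real (exp (1/4 * x)))"
    proof (rule AE_I2)
      fix x assume "x \<in> space half_line"
      then have "1 \<le> exp (1/4 * x)" by (simp add: space_restrict_space)
      then have "norm (G x * complex_of_real (f x)) * 1 \<le> norm (G x * complex_of_real (f x)) * exp (1/4 * x)"
        by (intro mult_left_mono) auto
      then show "norm (G x * complex_of_real (f x)) \<le> norm (G x * complex_of_real (f x) * complex_of_real (exp (1/4 * x)))"
        by (simp add: norm_mult)
    qed
  qed
  \<comment> \<open>Raising the power k by one mixes the neighbouring indices n - 1, n and n + 1, so
    the induction on k keeps n arbitrary.\<close>
  have mom: "(\<integral>x. G x * complex_of_real (x ^ k * laguerre p n x) \<partial>half_line) = 0" for k n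
  proof (induction k arbitrary: n)
    case 0
    show ?case using zero[of n] by (simp add: G_def w_def laguerre_fun_def mult_ac)
  next
    case (Suc k)
    let ?I = "\<lambda>m x. G x * complex_of_real (x ^ k * laguerre p m x)"
    have i: "integrable half_line (?I m)" for m
      by (intro int subexponential_mult subexponential_power subexponential_ident subexponential_laguerre p)
    define r where "r = (if n = 0 then 0 else lag_a p (n - 1))"
    have "G x * complex_of_real (x ^ Suc k * laguerre p n x) =
        (complex_of_real r * ?I (n - 1) x + complex_of_real (lag_b p n) * ?I n x) + complex_of_real (lag_a p n) * ?I (Suc n) x" for x
    proof -
      have "x ^ Suc k * laguerre p n x = x ^ k * (x * laguerre p n x)" by simp
      also have "x * laguerre p n x = r * laguerre p (n - 1) x + lag_b p n * laguerre p n x + lag_a p n * laguerre p (Suc n) x"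
        unfolding r_def by (subst laguerre_recurrence[OF p]) simp
      finally show ?thesis by (simp only: of_real_mult of_real_add) (simp add: algebra_simps)
    qed
    then have "(\<integral>x. G x * complex_of_real (x ^ Suc k * laguerre p n x) \<partial>half_line) =
        (\<integral>x. (complex_of_real r * ?I (n - 1) x + complex_of_real (lag_b p n) * ?I n x) + complex_of_real (lag_a p n) * ?I (Suc n) x \<partial>half_line)"
      by (simp only:)
    also have "\<dots> = (complex_of_real r * integral\<^sup>L half_line (?I (n - 1)) + complex_of_real (lag_b p n) * integral\<^sup>L half_line (?I n))
        + complex_of_real (lag_a p n) * integral\<^sup>L half_line (?I (Suc n))"
      by (simp only: Bochner_Integration.integral_add Bochner_Integration.integrable_add integrable_mult_right i integral_mult_right_zero)
    also have "\<dots> = 0" by (simp only: Suc.IH mult_zero_right add_0_right)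
    finally show ?case .
  qed
  have "AE x in half_line. G x = 0"
  proof (rule AE_zero_of_moments[OF G_meas])
    show "integrable half_line (\<lambda>x. norm (G x) * exp (1/4 * x))"
      using integrable_norm[OF sub[OF subexponential_const[of 1]]] by (simp add: norm_mult)
    show "(\<integral>x. G x * complex_of_real (x ^ n) \<partial>half_line) = 0" for n using mom[of n 0] by simp
  qed simp
  moreover have "AE x in half_line. w x \<noteq> 0"
    by (rule AE_I2) (use laguerre_weight_pos[OF p] in \<open>auto simp: w_def space_restrict_space less_imp_neq[symmetric]\<close>)
  ultimately show ?thesis by eventually_elim (simp add: G_def)
qed

definition laguerre_vec :: "nat \<Rightarrow> L2_half_line" where
  "laguerre_vec n = L2_class (\<lambda>x. complex_of_real (laguerre_fun p n x))"

lemma sq_integrable_laguerre: "sq_integrable (\<lambda>x. complex_of_real (laguerre_fun p n x))"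
  using sq_integrable_laguerre_fun[OF subexponential_const[of 1]] by simp

lemma laguerre_vec_orthonormal: "cinner (laguerre_vec m) (laguerre_vec n) = (if m = n then 1 else 0)"
proof -
  have "cinner (laguerre_vec m) (laguerre_vec n) =
      (\<integral>x. complex_of_real (laguerre p m x * laguerre p n x * laguerre_weight p x) \<partial>half_line)"
    unfolding laguerre_vec_def cinner_L2_class[OF sq_integrable_laguerre sq_integrable_laguerre]
    by (intro Bochner_Integration.integral_cong)
      (simp_all add: laguerre_fun_def laguerre_weight_nonneg algebra_simps flip: of_real_mult power2_eq_square)
  also have "\<dots> = (if m = n then 1 else 0)"
    by (simp only: integral_complex_of_real laguerre_orthonormal[OF p]) simp
  finally show ?thesis .
qed

lemma laguerre_vec_complete:
  assumes "\<And>n. cinner x (laguerre_vec n) = 0"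
  shows "x = 0"
proof (rule L2_class_surj[of x])
  fix h assume h: "sq_integrable h" "x = L2_class h"
  have "AE x in half_line. h x * 1 = 0"
  proof (rule AE_zero_of_orthogonal_laguerre[OF h(1)])
    show "(\<integral>x. h x * 1 * complex_of_real (laguerre_fun p n x) \<partial>half_line) = 0" for n
      using assms[of n] by (simp add: h laguerre_vec_def cinner_L2_class sq_integrable_laguerre)
  qed (use subexponential_const[of 1] in simp_all)
  then show ?thesis by (simp add: h L2_class_eq_zero)
qed

text \<open>On finitely supported sequences the pointwise sum is finite and agrees with the
  expansion; density of these sequences leaves no other continuous extension.\<close>

lemma Phi_eq_expansion: "Phi p = expansion laguerre_vec"
  unfolding Phi_def
proof (rule the_equality)
  have u: "unitary (expansion laguerre_vec)"
    by (rule unitary_expansion[OF laguerre_vec_orthonormal laguerre_vec_complete])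
  have e: "expansion laguerre_vec f = L2_class (\<lambda>x. \<Sum>n. complex_of_real (laguerre_fun p n x) * ell2_nth f n)"
    if f: "f \<in> finite_support" for f
  proof -
    obtain N where N: "f = trunc_ell2 N f" using finite_support_eq_sum[OF f] .
    have z: "ell2_nth f n = 0" if "n \<notin> {..<N}" for n
      using that by (subst N) (simp add: ell2_nth_trunc)
    have "expansion laguerre_vec f = (\<Sum>n<N. ell2_nth f n *\<^sub>C laguerre_vec n)"
      by (subst N) (rule expansion_trunc[OF laguerre_vec_orthonormal])
    also have "\<dots> = (\<Sum>n<N. L2_class (\<lambda>x. ell2_nth f n * complex_of_real (laguerre_fun p n x)))"
      by (simp add: laguerre_vec_def L2_class_scaleC sq_integrable_laguerre)
    also have "\<dots> = L2_class (\<lambda>x. \<Sum>n<N. ell2_nth f n * complex_of_real (laguerre_fun p n x))"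
      using L2_class_sum[of "{..<N}" "\<lambda>n x. ell2_nth f n * complex_of_real (laguerre_fun p n x)"]
      by (simp add: sq_integrable_cmult sq_integrable_laguerre)
    also have "(\<lambda>x. \<Sum>n<N. ell2_nth f n * complex_of_real (laguerre_fun p n x)) =
        (\<lambda>x. \<Sum>n. complex_of_real (laguerre_fun p n x) * ell2_nth f n)"
      by (rule ext, subst suminf_finite[of "{..<N}"]) (auto simp: z mult.commute)
    finally show ?thesis .
  qed
  show "continuous_on UNIV (expansion laguerre_vec) \<and> (\<forall>f\<in>finite_support. expansion laguerre_vec f =
      L2_class (\<lambda>x. \<Sum>n. complex_of_real (laguerre_fun p n x) * ell2_nth f n))"
    using e unitary_continuous[OF u] by blast
  fix T assume T: "continuous_on UNIV T \<and> (\<forall>f\<in>finite_support. T f =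
      L2_class (\<lambda>x. \<Sum>n. complex_of_real (laguerre_fun p n x) * ell2_nth f n))"
  show "T = expansion laguerre_vec"
  proof
    fix f show "T f = expansion laguerre_vec f"
      using T e unitary_continuous[OF u] closure_finite_support
      by (intro continuous_closure_eq[of T "expansion laguerre_vec" finite_support f]) auto
  qed
qed

lemma unitary_Phi: "unitary (Phi p)"
  unfolding Phi_eq_expansion by (rule unitary_expansion[OF laguerre_vec_orthonormal laguerre_vec_complete])

lemma Phi_unit: "Phi p (unit_ell2 n) = laguerre_vec n"
  unfolding Phi_eq_expansion by (rule expansion_unit[OF laguerre_vec_orthonormal])

section \<open>The group generated by the Laguerre operator\<close>

definition laguerre_group :: "real \<Rightarrow> ell2 \<Rightarrow> ell2" where
  "laguerre_group t f = inv (Phi p) (mult_exp t (Phi p f))"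

lemma Phi_laguerre_group: "Phi p (laguerre_group t f) = mult_exp t (Phi p f)"
  unfolding laguerre_group_def by (rule surj_f_inv_f[OF unitary_surj[OF unitary_Phi]])

lemma unitary_group_laguerre: "unitary_group laguerre_group"
  using unitary_group_conj[OF unitary_Phi unitary_group_mult_exp] by (simp add: laguerre_group_def[abs_def])

text \<open>Column n of the Jacobi matrix, that is, the image of \<open>unit_ell2 n\<close>.\<close>

definition jacobi_unit :: "nat \<Rightarrow> ell2" where
  "jacobi_unit n = (if n = 0 then 0 else complex_of_real (lag_a p (n - 1)) *\<^sub>C unit_ell2 (n - 1))
    + complex_of_real (lag_b p n) *\<^sub>C unit_ell2 n + complex_of_real (lag_a p n) *\<^sub>C unit_ell2 (Suc n)"

lemma Phi_jacobi_unit: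
  "Phi p (jacobi_unit n) = L2_class (\<lambda>x. complex_of_real x * complex_of_real (laguerre_fun p n x))"
proof -
  define r where "r = complex_of_real (if n = 0 then 0 else lag_a p (n - 1))"
  have j: "jacobi_unit n = r *\<^sub>C unit_ell2 (n - 1) + complex_of_real (lag_b p n) *\<^sub>C unit_ell2 n
      + complex_of_real (lag_a p n) *\<^sub>C unit_ell2 (Suc n)"
    by (simp add: jacobi_unit_def r_def)
  have "Phi p (jacobi_unit n) = r *\<^sub>C laguerre_vec (n - 1) + complex_of_real (lag_b p n) *\<^sub>C laguerre_vec n
      + complex_of_real (lag_a p n) *\<^sub>C laguerre_vec (Suc n)"
    unfolding j by (simp add: clinear_add clinear_scaleC unitary_clinear[OF unitary_Phi] Phi_unit)
  also have "\<dots> = L2_class (\<lambda>x. r * complex_of_real (laguerre_fun p (n - 1) x)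
      + complex_of_real (lag_b p n) * complex_of_real (laguerre_fun p n x)
      + complex_of_real (lag_a p n) * complex_of_real (laguerre_fun p (Suc n) x))"
    unfolding laguerre_vec_def
    by (simp add: L2_class_scaleC L2_class_add sq_integrable_laguerre sq_integrable_cmult sq_integrable_add)
  also have "(\<lambda>x. r * complex_of_real (laguerre_fun p (n - 1) x)
      + complex_of_real (lag_b p n) * complex_of_real (laguerre_fun p n x)
      + complex_of_real (lag_a p n) * complex_of_real (laguerre_fun p (Suc n) x)) =
      (\<lambda>x. complex_of_real x * complex_of_real (laguerre_fun p n x))"
  proof
    fix x
    have "x * laguerre_fun p n x = sqrt (laguerre_weight p x) * (x * laguerre p n x)"
      by (simp add: laguerre_fun_def)
    also have "\<dots> = (if n = 0 then 0 else lag_a p (n - 1)) * laguerre_fun p (n - 1) x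
        + lag_b p n * laguerre_fun p n x + lag_a p n * laguerre_fun p (Suc n) x"
      by (subst laguerre_recurrence[OF p]) (simp add: laguerre_fun_def algebra_simps)
    finally show "r * complex_of_real (laguerre_fun p (n - 1) x)
      + complex_of_real (lag_b p n) * complex_of_real (laguerre_fun p n x)
      + complex_of_real (lag_a p n) * complex_of_real (laguerre_fun p (Suc n) x) =
      complex_of_real x * complex_of_real (laguerre_fun p n x)"
      unfolding r_def by (simp only: of_real_mult[symmetric] of_real_add[symmetric])
  qed
  finally show ?thesis .
qed

lemma jacobi_unit_generator: "(unit_ell2 n, jacobi_unit n) \<in> generator laguerre_group"
  unfolding laguerre_group_def[abs_def] generator_conj[OF unitary_Phi] Phi_unit Phi_jacobi_unit laguerre_vec_def
  by (intro generator_mult_exp sq_integrable_laguerre sq_integrable_laguerre_fun subexponential_ident)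

text \<open>Combining columns reproduces the row formula because the matrix is symmetric. The
  vanishing of \<open>c\<close> from N onwards covers the boundary rows, where the row formula
  reaches indices beyond the summation range.\<close>

lemma ell2_nth_jacobi_sum:
  assumes "\<And>n. n \<ge> N \<Longrightarrow> c n = 0"
  shows "ell2_nth (\<Sum>n<N. c n *\<^sub>C jacobi_unit n) k =
    (if k = 0 then 0 else complex_of_real (lag_a p (k - 1)) * c (k - 1))
        + complex_of_real (lag_b p k) * c k + complex_of_real (lag_a p k) * c (k + 1)"
proof -
  have "ell2_nth (jacobi_unit n) k = (if n = Suc k then complex_of_real (lag_a p k) else 0) +
      (if n = k then complex_of_real (lag_b p k) else 0) +
      (if n = k - 1 then (if k = 0 then 0 else complex_of_real (lag_a p (k - 1))) else 0)" for n
    unfolding jacobi_unit_def by (cases k) auto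
  then have "ell2_nth (\<Sum>n<N. c n *\<^sub>C jacobi_unit n) k =
      (\<Sum>n<N. if n = Suc k then c n * complex_of_real (lag_a p k) else 0) +
      (\<Sum>n<N. if n = k then c n * complex_of_real (lag_b p k) else 0) +
      (\<Sum>n<N. if n = k - 1 then c n * (if k = 0 then 0 else complex_of_real (lag_a p (k - 1))) else 0)"
    unfolding ell2_nth_sum sum.distrib[symmetric] by (intro sum.cong) (auto simp: algebra_simps)
  also have "\<dots> = (if k = 0 then 0 else complex_of_real (lag_a p (k - 1)) * c (k - 1))
        + complex_of_real (lag_b p k) * c k + complex_of_real (lag_a p k) * c (k + 1)"
    using assms[of k] assms[of "Suc k"] assms[of "k - 1"] by (cases k) (auto simp: not_less)
  finally show ?thesis .
qed

lemma laguerre_operator_min_iff: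
  "(f, g) \<in> laguerre_operator_min p \<longleftrightarrow> (\<exists>N. f = trunc_ell2 N f \<and> g = (\<Sum>n<N. ell2_nth f n *\<^sub>C jacobi_unit n))"
proof -
  have nth: "ell2_nth (\<Sum>n<N. ell2_nth f n *\<^sub>C jacobi_unit n) k =
      (if k = 0 then 0 else complex_of_real (lag_a p (k - 1)) * ell2_nth f (k - 1))
        + complex_of_real (lag_b p k) * ell2_nth f k + complex_of_real (lag_a p k) * ell2_nth f (k + 1)"
    if N: "f = trunc_ell2 N f" for N k
  proof (rule ell2_nth_jacobi_sum)
    show "ell2_nth f n = 0" if "n \<ge> N" for n using that by (subst N) (simp add: ell2_nth_trunc)
  qed
  show ?thesis
  proof
    assume fg: "(f, g) \<in> laguerre_operator_min p"
    then obtain N where N: "f = trunc_ell2 N f"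
      using finite_support_eq_sum unfolding laguerre_operator_min_def by auto
    have "g = (\<Sum>n<N. ell2_nth f n *\<^sub>C jacobi_unit n)"
      by (rule ell2_eqI) (use fg nth[OF N] in \<open>simp add: laguerre_operator_min_def\<close>)
    then show "\<exists>N. f = trunc_ell2 N f \<and> g = (\<Sum>n<N. ell2_nth f n *\<^sub>C jacobi_unit n)" using N by blast
  next
    assume "\<exists>N. f = trunc_ell2 N f \<and> g = (\<Sum>n<N. ell2_nth f n *\<^sub>C jacobi_unit n)"
    then obtain N where N: "f = trunc_ell2 N f" and g: "g = (\<Sum>n<N. ell2_nth f n *\<^sub>C jacobi_unit n)" by blast
    have "f \<in> finite_support" by (subst N) (rule trunc_ell2_finite_support)
    then show "(f, g) \<in> laguerre_operator_min p"
      using nth[OF N] by (simp add: laguerre_operator_min_def g)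
  qed
qed

lemma laguerre_operator_min_add:
  "(f, g) \<in> laguerre_operator_min p \<Longrightarrow> (f', g') \<in> laguerre_operator_min p \<Longrightarrow>
    (f + f', g + g') \<in> laguerre_operator_min p"
  unfolding laguerre_operator_min_def finite_support_def
  by (auto simp: algebra_simps intro: finite_subset[of _ "{n. ell2_nth f n \<noteq> 0} \<union> {n. ell2_nth f' n \<noteq> 0}"])

lemma laguerre_operator_min_scaleC:
  "(f, g) \<in> laguerre_operator_min p \<Longrightarrow> (a *\<^sub>C f, a *\<^sub>C g) \<in> laguerre_operator_min p"
  unfolding laguerre_operator_min_def finite_support_def
  by (auto simp: algebra_simps intro: finite_subset[of _ "{n. ell2_nth f n \<noteq> 0}"])

lemma jacobi_unit_min: "(unit_ell2 n, jacobi_unit n) \<in> laguerre_operator_min p"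
proof -
  have "ell2_nth (unit_ell2 n) m *\<^sub>C jacobi_unit m = (if m = n then jacobi_unit n else 0)" for m
    by simp
  moreover have "unit_ell2 n = trunc_ell2 (Suc n) (unit_ell2 n)"
    by (rule ell2_eqI) (simp add: ell2_nth_trunc)
  ultimately show ?thesis
    unfolding laguerre_operator_min_iff by (intro exI[of _ "Suc n"]) simp
qed

lemma laguerre_operator_min_subset: "laguerre_operator_min p \<subseteq> generator laguerre_group"
proof (rule subrelI)
  fix f g assume "(f, g) \<in> laguerre_operator_min p"
  then obtain N where f: "f = trunc_ell2 N f" and g: "g = (\<Sum>n<N. ell2_nth f n *\<^sub>C jacobi_unit n)"
    unfolding laguerre_operator_min_iff by blast
  have "((\<Sum>n<N. c n *\<^sub>C unit_ell2 n), (\<Sum>n<N. c n *\<^sub>C jacobi_unit n)) \<in> generator laguerre_group" for c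
  proof (induction N)
    case 0
    show ?case
      using generator_scaleC[OF unitary_group_laguerre jacobi_unit_generator, of 0] by simp
  next
    case (Suc N)
    then show ?case
      by (simp add: generator_add generator_scaleC unitary_group_laguerre jacobi_unit_generator)
  qed
  from this[of "ell2_nth f"] show "(f, g) \<in> generator laguerre_group"
    using f g by (simp add: trunc_ell2_def)
qed

text \<open>A function h orthogonal to the image of the range satisfies orthogonality of h (x -
  \<i>) to every Laguerre function, hence h (x - \<i>) = 0, and x - \<i> never vanishes. The
  argument runs in \<open>L2_half_line\<close>, whose completeness the projection theorem uses, and
  is pulled back by the inverse of \<open>Phi p\<close>.\<close>

lemma laguerre_operator_min_range_dense:
  "closure ((\<lambda>(f, g). g + \<i> *\<^sub>C f) ` laguerre_operator_min p) = UNIV"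
proof -
  define R where "R = (\<lambda>(f, g). g + \<i> *\<^sub>C f) ` laguerre_operator_min p"
  have RI: "g + \<i> *\<^sub>C f \<in> R" if "(f, g) \<in> laguerre_operator_min p" for f g
    using that unfolding R_def by force
  have R_add: "x + y \<in> R" if xy: "x \<in> R" "y \<in> R" for x y
  proof -
    obtain f g f' g' where "(f, g) \<in> laguerre_operator_min p" "(f', g') \<in> laguerre_operator_min p"
      "x = g + \<i> *\<^sub>C f" "y = g' + \<i> *\<^sub>C f'"
      using xy unfolding R_def by auto
    then show ?thesis
      using RI[OF laguerre_operator_min_add, of f g f' g'] by (simp add: scaleC_add_right algebra_simps)
  qed
  have R_scaleC: "a *\<^sub>C x \<in> R" if x: "x \<in> R" for x a
  proof -
    obtain f g where "(f, g) \<in> laguerre_operator_min p" "x = g + \<i> *\<^sub>C f"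
      using x unfolding R_def by auto
    then show ?thesis
      using RI[OF laguerre_operator_min_scaleC, of f g a]
      by (simp add: scaleC_add_right scaleC_scaleC mult.commute)
  qed
  have R_unit: "jacobi_unit n + \<i> *\<^sub>C unit_ell2 n \<in> R" for n by (rule RI[OF jacobi_unit_min])
  have lin: "clinear (Phi p)" by (rule unitary_clinear[OF unitary_Phi])
  have "subspace (Phi p ` R)"
  proof (rule subspaceI)
    have "0 *\<^sub>C (jacobi_unit 0 + \<i> *\<^sub>C unit_ell2 0) \<in> R" by (rule R_scaleC[OF R_unit])
    then show "0 \<in> Phi p ` R" using clinear_zero[OF lin] by (metis image_eqI scaleC_zero_left)
    show "x + y \<in> Phi p ` R" if "x \<in> Phi p ` R" "y \<in> Phi p ` R" for x y
      using that R_add by (auto simp flip: clinear_add[OF lin])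
    show "c *\<^sub>R x \<in> Phi p ` R" if "x \<in> Phi p ` R" for c x
      using that R_scaleC by (auto simp flip: scaleC_of_real clinear_scaleC[OF lin])
  qed
  moreover have "x = 0" if x: "\<And>y. y \<in> Phi p ` R \<Longrightarrow> inner x y = 0" for x
  proof -
    \<comment> \<open>Real orthogonality to both y and \<i> y controls the real and the imaginary
      part of the complex inner product.\<close>
    have c: "cinner x (Phi p y) = 0" if y: "y \<in> R" for y
    proof -
      have "Re (cinner x (Phi p y)) = 0"
        using x[of "Phi p y"] y by (simp add: inner_eq_Re_cinner)
      moreover have "Re (cinner x (Phi p (\<i> *\<^sub>C y))) = 0"
        using x[of "Phi p (\<i> *\<^sub>C y)"] R_scaleC[OF y] by (simp add: inner_eq_Re_cinner)
      ultimately show ?thesis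
        by (simp add: clinear_scaleC[OF lin] cinner_scaleC_right complex_eq_iff)
    qed
    show "x = 0"
    proof (rule L2_class_surj[of x])
      fix h assume h: "sq_integrable h" "x = L2_class h"
      let ?g = "\<lambda>x. complex_of_real x - \<i>"
      have s: "sq_integrable (\<lambda>x. complex_of_real x * complex_of_real (laguerre_fun p n x))" for n
        by (rule sq_integrable_laguerre_fun[OF subexponential_ident])
      have "AE x in half_line. h x * ?g x = 0"
      proof (rule AE_zero_of_orthogonal_laguerre[OF h(1)])
        show "?g \<in> borel_measurable borel" by measurable
        show "subexponential (\<lambda>x. norm (?g x))"
          unfolding subexponential_def
        proof (intro conjI allI impI)
          show "(\<lambda>x. norm (?g x)) \<in> borel_measurable borel" by measurable
          fix e :: real assume "e > 0"
          then obtain K where K: "\<And>x. x \<ge> 0 \<Longrightarrow> \<bar>x + 1\<bar> \<le> K * exp (e * x)"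
            using subexponentialE[OF subexponential_add[OF subexponential_ident subexponential_const]] by metis
          have "\<bar>norm (?g x)\<bar> \<le> K * exp (e * x)" if "x \<ge> 0" for x
            using K[OF that] norm_triangle_ineq4[of "complex_of_real x" \<i>] that by simp
          then show "\<exists>K. \<forall>x\<ge>0. \<bar>norm (?g x)\<bar> \<le> K * exp (e * x)" by blast
        qed
        fix n
        have "Phi p (jacobi_unit n + \<i> *\<^sub>C unit_ell2 n) =
            L2_class (\<lambda>x. complex_of_real x * complex_of_real (laguerre_fun p n x) + \<i> * complex_of_real (laguerre_fun p n x))"
          by (simp add: clinear_add[OF lin] clinear_scaleC[OF lin] Phi_jacobi_unit Phi_unit laguerre_vec_def
              L2_class_scaleC L2_class_add s sq_integrable_laguerre sq_integrable_cmult)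
        then have "(\<integral>x. h x * cnj (complex_of_real x * complex_of_real (laguerre_fun p n x) + \<i> * complex_of_real (laguerre_fun p n x)) \<partial>half_line) = 0"
          using c[OF R_unit[of n]]
          by (simp add: h(2) cinner_L2_class h(1) s sq_integrable_laguerre sq_integrable_cmult sq_integrable_add)
        then show "(\<integral>x. h x * ?g x * complex_of_real (laguerre_fun p n x) \<partial>half_line) = 0"
          by (simp add: algebra_simps)
      qed
      moreover have "complex_of_real x - \<i> \<noteq> 0" for x by (simp add: complex_eq_iff)
      ultimately have "AE x in half_line. h x = 0" by simp
      then show ?thesis by (simp add: h L2_class_eq_zero)
    qed
  qed
  ultimately have dense: "closure (Phi p ` R) = UNIV" by (rule dense_subspace_of_orthogonal_trivial)
  have "f \<in> closure R" for f
  proof -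
    have "Phi p f \<in> closure (Phi p ` R)" by (simp add: dense)
    then obtain y where y: "\<And>n. y n \<in> Phi p ` R" and lim: "y \<longlonglongrightarrow> Phi p f"
      unfolding closure_sequential by blast
    have "(\<lambda>n. inv (Phi p) (y n)) \<longlonglongrightarrow> f"
      using unitary_tendsto[OF unitary_inv[OF unitary_Phi] lim]
      by (simp add: inv_f_f[OF unitary_inj[OF unitary_Phi]])
    moreover have "inv (Phi p) (y n) \<in> R" for n
      using y[of n] by (auto simp: inv_f_f[OF unitary_inj[OF unitary_Phi]])
    ultimately show ?thesis
      unfolding closure_sequential by (intro exI[of _ "\<lambda>n. inv (Phi p) (y n)"]) blast
  qed
  then show ?thesis unfolding R_def by blast
qed

lemma laguerre_operator_eq_generator: "laguerre_operator p = generator laguerre_group"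
  unfolding laguerre_operator_def
  by (rule closure_eq_generator[OF unitary_group_laguerre laguerre_operator_min_subset
      laguerre_operator_min_range_dense])

text \<open>The definite description is resolved by exhibiting the multiplication group; a
  competitor agrees with it because the domain contains all finitely supported sequences and so is
  dense.\<close>

lemma exp_i_laguerre_operator: "exp_i (laguerre_operator p) = laguerre_group"
  unfolding exp_i_def
proof (rule the_equality)
  show "unitary_group laguerre_group \<and> generator laguerre_group = laguerre_operator p"
    by (simp add: unitary_group_laguerre laguerre_operator_eq_generator)
  fix U assume U: "unitary_group U \<and> generator U = laguerre_operator p"
  have "f \<in> fst ` laguerre_operator_min p" if "f \<in> finite_support" for f
    using finite_support_eq_sum[OF that] laguerre_operator_min_iff by (metis fst_conv image_eqI)
  then have "finite_support \<subseteq> fst ` generator U"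
    using laguerre_operator_min_subset U laguerre_operator_eq_generator by blast
  then have "closure (fst ` generator U) = UNIV"
    using closure_mono[of finite_support "fst ` generator U"] closure_finite_support by auto
  then show "U = laguerre_group"
    using U laguerre_operator_eq_generator
    by (intro unitary_group_unique[of U laguerre_group]) (auto simp: unitary_group_laguerre)
qed

end

section \<open>Asymptotics of the transition amplitudes\<close>

lemma shifted_ratio_tendsto_1:
  fixes a b :: real assumes "b > 0"
  shows "(\<lambda>n. (a + real n) / (b + real n)) \<longlonglongrightarrow> 1"
proof -
  have "filterlim (\<lambda>n. b + real n) at_top sequentially"
    by (intro filterlim_tendsto_add_at_top[OF tendsto_const] filterlim_real_sequentially)
  then have "(\<lambda>n. (a - b) / (b + real n)) \<longlonglongrightarrow> 0"
    by (intro tendsto_divide_0[OF tendsto_const] filterlim_at_top_imp_at_infinity)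
  then have "(\<lambda>n. 1 + (a - b) / (b + real n)) \<longlonglongrightarrow> 1 + 0" by (intro tendsto_intros)
  moreover have "1 + (a - b) / (b + real n) = (a + real n) / (b + real n)" for n
    using assms by (simp add: field_simps add_pos_nonneg)
  ultimately show ?thesis by simp
qed

text \<open>The limit formula \<open>Gamma_series\<close> is applied at \<beta>, p + 1 and q + 1.
  The powers of n cancel because 2 \<beta> = (p + 1) + (q + 1), which is what singles out this
  \<beta>.\<close>

lemma laguerre_coeff_product_asymp:
  assumes p: "p > -1" and q: "q > -1"
  defines "\<beta> \<equiv> (p + q) / 2 + 1"
  shows "(\<lambda>n. laguerre_coeff p n * laguerre_coeff q n / (pochhammer \<beta> n / fact n))
    \<longlonglongrightarrow> Gamma \<beta> / sqrt (Gamma (p + 1) * Gamma (q + 1))"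
proof -
  have b: "\<beta> > 0" using p q by (simp add: \<beta>_def field_simps)
  have pos: "p + 1 > 0" "q + 1 > 0" using p q by simp_all
  let ?G = "\<lambda>z::real. Gamma_series z"
  have G: "?G z n = fact n * exp (z * ln (real n)) / (pochhammer z n * (z + real n))" for z n
    by (simp add: Gamma_series_def pochhammer_Suc)
  have ph: "pochhammer z n > 0" if "z > 0" for z :: real and n using that by (rule pochhammer_pos)
  \<comment> \<open>\<open>Gamma_series z n\<close> contains a Pochhammer symbol with n + 1 factors;
    the two trailing quotients remove the surplus factor and tend to 1.\<close>
  let ?R = "\<lambda>n. (?G \<beta> n)\<^sup>2 / (?G (p + 1) n * ?G (q + 1) n) *
      (((\<beta> + real n) / (p + 1 + real n)) * ((\<beta> + real n) / (q + 1 + real n)))"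
  have "?R n = pochhammer (p + 1) n * pochhammer (q + 1) n / (pochhammer \<beta> n)\<^sup>2" for n
  proof -
    have e: "(exp (\<beta> * ln (real n)))\<^sup>2 = exp ((p + 1) * ln (real n)) * exp ((q + 1) * ln (real n))"
      unfolding power2_eq_square exp_add[symmetric] by (simp add: \<beta>_def field_simps)
    have nz: "pochhammer (p + 1) n \<noteq> 0" "pochhammer (q + 1) n \<noteq> 0" "pochhammer \<beta> n \<noteq> 0"
      "\<beta> + real n \<noteq> 0" "p + 1 + real n \<noteq> 0" "q + 1 + real n \<noteq> 0"
      using ph[OF b, of n] ph[OF pos(1), of n] ph[OF pos(2), of n] b pos by auto
    have GB: "(?G \<beta> n)\<^sup>2 = (fact n)\<^sup>2 * (exp ((p + 1) * ln (real n)) * exp ((q + 1) * ln (real n))) /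
        ((pochhammer \<beta> n)\<^sup>2 * (\<beta> + real n)\<^sup>2)"
      unfolding G power_divide power_mult_distrib e ..
    show ?thesis
      unfolding GB G[of "p + 1"] G[of "q + 1"] using nz by (simp add: divide_simps) (simp add: power2_eq_square)
  qed
  then have "laguerre_coeff p n * laguerre_coeff q n / (pochhammer \<beta> n / fact n) = sqrt (?R n)" for n
    using p q ph[OF b, of n] unfolding laguerre_coeff_def[OF p] laguerre_coeff_def[OF q]
    by (simp add: real_sqrt_divide real_sqrt_mult)
  moreover have "(\<lambda>n. sqrt (?R n)) \<longlonglongrightarrow> sqrt ((Gamma \<beta>)\<^sup>2 / (Gamma (p + 1) * Gamma (q + 1)) * (1 * 1))"
    using Gamma_nonzero[OF p] Gamma_nonzero[OF q] pos
    by (intro tendsto_real_sqrt tendsto_mult tendsto_divide tendsto_power Gamma_series_LIMSEQ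
        shifted_ratio_tendsto_1) auto
  moreover have "sqrt ((Gamma \<beta>)\<^sup>2 / (Gamma (p + 1) * Gamma (q + 1)) * (1 * 1)) =
      Gamma \<beta> / sqrt (Gamma (p + 1) * Gamma (q + 1))"
    using Gamma_real_pos[OF b] by (simp add: real_sqrt_divide)
  ultimately show ?thesis by simp
qed

section \<open>Binomial series and an Abelian estimate\<close>

lemma binomial_series_sums:
  fixes \<beta> :: real and x :: complex
  assumes "norm x < 1"
  shows "(\<lambda>n. complex_of_real (pochhammer \<beta> n / fact n) * x ^ n) sums (1 - x) powr (- of_real \<beta>)"
proof -
  have "((- complex_of_real \<beta>) gchoose n) * (- x) ^ n = complex_of_real (pochhammer \<beta> n / fact n) * x ^ n" for n
  proof -
    have "((- complex_of_real \<beta>) gchoose n) * (- x) ^ n =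
        ((-1) ^ n * (-1) ^ n) * (pochhammer (complex_of_real \<beta>) n / fact n * x ^ n)"
      by (simp add: gbinomial_pochhammer power_minus[of x] mult_ac)
    also have "(-1) ^ n * (-1) ^ n = (1 :: complex)" by (simp flip: power_mult_distrib)
    finally show ?thesis by (simp add: pochhammer_of_real)
  qed
  then show ?thesis
    using gen_binomial_complex[of "- x" "- complex_of_real \<beta>"] assms by simp
qed

lemma binomial_series_sums_real:
  fixes \<beta> :: real and r :: real
  assumes "0 \<le> r" "r < 1"
  shows "(\<lambda>n. pochhammer \<beta> n / fact n * r ^ n) sums (1 - r) powr (- \<beta>)"
proof -
  have "(\<lambda>n. complex_of_real (pochhammer \<beta> n / fact n) * complex_of_real r ^ n) sums
      (1 - complex_of_real r) powr (- of_real \<beta>)"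
    using assms by (intro binomial_series_sums) simp
  moreover have "(1 - complex_of_real r) powr (- of_real \<beta>) = complex_of_real ((1 - r) powr (- \<beta>))"
    using powr_of_real[of "1 - r" "- \<beta>"] assms by simp
  ultimately have "(\<lambda>n. complex_of_real (pochhammer \<beta> n / fact n * r ^ n)) sums complex_of_real ((1 - r) powr (- \<beta>))"
    by simp
  then show ?thesis by (simp only: sums_of_real_iff)
qed

text \<open>From some index on, the coefficients differ from C times the binomial ones by at most
  \<epsilon> times the binomial ones, which are positive and sum to
  \<open>(1 - norm x) powr (- \<beta>)\<close> when paired with the powers of \<open>norm x\<close>.
  The finitely many earlier terms are bounded by a constant M that does not depend on x.\<close>

lemma abelian_bound:
  fixes d :: "nat \<Rightarrow> real"
  assumes b: "\<beta> > 0" and lim: "(\<lambda>n. d n / (pochhammer \<beta> n / fact n)) \<longlonglongrightarrow> C" and "\<epsilon> > 0"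
  shows "\<exists>M. \<forall>x. norm x < 1 \<longrightarrow> summable (\<lambda>n. complex_of_real (d n) * x ^ n) \<and>
    norm ((\<Sum>n. complex_of_real (d n) * x ^ n) - of_real C * (1 - x) powr (- of_real \<beta>)) \<le>
      M + \<epsilon> * (1 - norm x) powr (- \<beta>)"
proof -
  define e where "e n = pochhammer \<beta> n / fact n" for n
  have e: "e n > 0" for n using b by (simp add: e_def pochhammer_pos)
  obtain N where N: "\<And>n. n \<ge> N \<Longrightarrow> norm (d n / e n - C) < \<epsilon>"
    using LIMSEQ_D[OF lim \<open>\<epsilon> > 0\<close>] unfolding e_def by blast
  have N': "\<bar>d n - C * e n\<bar> \<le> \<epsilon> * e n" if "n \<ge> N" for n
  proof -
    have "\<bar>d n - C * e n\<bar> = \<bar>d n / e n - C\<bar> * e n"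
      using e[of n] by (simp add: abs_mult_pos left_diff_distrib)
    also have "\<dots> \<le> \<epsilon> * e n" using N[OF that] e[of n] by (intro mult_right_mono) auto
    finally show ?thesis .
  qed
  define m where "m n = (if n < N then \<bar>d n - C * e n\<bar> else 0)" for n
  have m: "m sums (\<Sum>n<N. m n)" by (rule sums_finite) (auto simp: m_def)
  show ?thesis
  proof (intro exI[of _ "\<Sum>n<N. m n"] allI impI)
    fix x :: complex assume x: "norm x < 1"
    let ?f = "\<lambda>n. complex_of_real (d n - C * e n) * x ^ n"
    let ?g = "\<lambda>n. m n + \<epsilon> * (e n * norm x ^ n)"
    have fg: "norm (?f n) \<le> ?g n" for n
    proof (cases "n < N")
      case True
      have "\<bar>d n - C * e n\<bar> * norm x ^ n \<le> \<bar>d n - C * e n\<bar> * 1"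
        using x by (intro mult_left_mono power_le_one) auto
      also have "\<dots> \<le> ?g n" using True \<open>\<epsilon> > 0\<close> less_imp_le[OF e[of n]] by (simp add: m_def)
      finally show ?thesis by (simp add: norm_mult norm_power del: of_real_diff of_real_mult)
    next
      case False
      then have "\<bar>d n - C * e n\<bar> * norm x ^ n \<le> \<epsilon> * e n * norm x ^ n"
        by (intro mult_right_mono N') auto
      then show ?thesis using False
        by (simp add: norm_mult norm_power m_def mult.assoc del: of_real_diff of_real_mult)
    qed
    have g: "?g sums ((\<Sum>n<N. m n) + \<epsilon> * (1 - norm x) powr (- \<beta>))"
      using x unfolding e_def by (intro sums_add m sums_mult binomial_series_sums_real) auto
    have f: "summable ?f"
      using summable_comparison_test'[OF sums_summable[OF g], of 0 ?f] fg by blast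
    have E: "(\<lambda>n. of_real C * (complex_of_real (e n) * x ^ n)) sums (of_real C * (1 - x) powr (- of_real \<beta>))"
      unfolding e_def by (intro sums_mult binomial_series_sums x)
    have "(\<lambda>n. ?f n + of_real C * (complex_of_real (e n) * x ^ n)) sums
        (suminf ?f + of_real C * (1 - x) powr (- of_real \<beta>))"
      by (intro sums_add summable_sums[OF f] E)
    moreover have "?f n + of_real C * (complex_of_real (e n) * x ^ n) = complex_of_real (d n) * x ^ n" for n
      by (simp add: algebra_simps)
    ultimately have D: "(\<lambda>n. complex_of_real (d n) * x ^ n) sums
        (suminf ?f + of_real C * (1 - x) powr (- of_real \<beta>))" by simp
    have "norm (suminf ?f) \<le> suminf ?g"
      by (rule norm_suminf_le[OF fg sums_summable[OF g]])
    then have "norm (suminf ?f) \<le> (\<Sum>n<N. m n) + \<epsilon> * (1 - norm x) powr (- \<beta>)"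
      using sums_unique[OF g] by simp
    moreover have "(\<Sum>n. complex_of_real (d n) * x ^ n) - of_real C * (1 - x) powr (- of_real \<beta>) = suminf ?f"
      unfolding sums_unique[OF D, symmetric] by (rule add_diff_cancel_right')
    ultimately show "summable (\<lambda>n. complex_of_real (d n) * x ^ n) \<and>
      norm ((\<Sum>n. complex_of_real (d n) * x ^ n) - of_real C * (1 - x) powr (- of_real \<beta>)) \<le>
      (\<Sum>n<N. m n) + \<epsilon> * (1 - norm x) powr (- \<beta>)"
      using sums_summable[OF D] by (simp only:)
  qed
qed

section \<open>Moduli and phases along the line of real part 1\<close>

lemma powr_of_real_mult_complex:
  "r > 0 \<Longrightarrow> w \<noteq> 0 \<Longrightarrow> (complex_of_real r * w) powr s = complex_of_real r powr s * w powr s"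
  by (simp add: powr_def Ln_times_of_real Ln_of_real distrib_left exp_add)

lemma norm_powr_of_real: "z \<noteq> 0 \<Longrightarrow> norm (z powr complex_of_real s) = norm z powr s"
  by (simp add: powr_def norm_exp_eq_Re)

text \<open>Pulling the real factor s out of 1 + \<i> s leaves 1/s + \<i>, which tends to \<i>; the
  sign of s decides the sign of the limit.\<close>

lemma sgn_line_tendsto:
  "((\<lambda>t. sgn (1 + \<i> * complex_of_real (t + r))) \<longlongrightarrow> \<i>) at_top"
  "((\<lambda>t. sgn (1 + \<i> * complex_of_real (t + r))) \<longlongrightarrow> - \<i>) at_bot"
proof -
  have top: "filterlim (\<lambda>t. t + r) at_top at_top" and bot: "filterlim (\<lambda>t. t + r) at_bot at_bot"
  proof -
    have "\<forall>\<^sub>F t in at_top. Z \<le> t + r" for Z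
      using eventually_ge_at_top[of "Z - r"] by eventually_elim simp
    then show "filterlim (\<lambda>t. t + r) at_top at_top" by (simp add: filterlim_at_top)
    have "\<forall>\<^sub>F t in at_bot. t + r \<le> Z" for Z
      using eventually_le_at_bot[of "Z - r"] by eventually_elim simp
    then show "filterlim (\<lambda>t. t + r) at_bot at_bot" by (simp add: filterlim_at_bot)
  qed
  have eq: "sgn (1 + \<i> * complex_of_real s) = sgn s *\<^sub>R sgn (complex_of_real (inverse s) + \<i>)" if "s \<noteq> 0" for s :: real
  proof -
    have "1 + \<i> * complex_of_real s = s *\<^sub>R (complex_of_real (inverse s) + \<i>)"
      using that by (simp add: complex_eq_iff power2_eq_square)
    then show ?thesis by (simp only: sgn_scaleR)
  qed
  have lim: "((\<lambda>s. sgn (complex_of_real (inverse s) + \<i>)) \<longlongrightarrow> \<i>) F"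
    if "filterlim (\<lambda>s::real. s) at_infinity F" for F
  proof -
    have "((\<lambda>s::real. inverse s) \<longlongrightarrow> 0) F"
      using tendsto_inverse_0 that by (rule filterlim_compose)
    then have "((\<lambda>s. sgn (complex_of_real (inverse s) + \<i>)) \<longlongrightarrow> sgn (complex_of_real 0 + \<i>)) F"
      by (intro tendsto_sgn tendsto_add tendsto_of_real tendsto_const) auto
    then show ?thesis by (simp add: sgn_eq)
  qed
  have "((\<lambda>s. sgn (1 + \<i> * complex_of_real s)) \<longlongrightarrow> \<i>) at_top"
  proof (rule Lim_transform_eventually[OF lim])
    show "\<forall>\<^sub>F s in at_top. sgn (complex_of_real (inverse s) + \<i>) = sgn (1 + \<i> * complex_of_real s)"
      using eventually_gt_at_top[of 0] by eventually_elim (simp only: eq, simp)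
  qed (rule filterlim_at_top_imp_at_infinity[OF filterlim_ident])
  from filterlim_compose[OF this top]
  show "((\<lambda>t. sgn (1 + \<i> * complex_of_real (t + r))) \<longlongrightarrow> \<i>) at_top" .
  have "((\<lambda>s. sgn (1 + \<i> * complex_of_real s)) \<longlongrightarrow> - \<i>) at_bot"
  proof (rule Lim_transform_eventually)
    show "((\<lambda>s::real. - sgn (complex_of_real (inverse s) + \<i>)) \<longlongrightarrow> - \<i>) at_bot"
      by (intro tendsto_minus lim filterlim_at_bot_imp_at_infinity filterlim_ident)
    show "\<forall>\<^sub>F s in at_bot. - sgn (complex_of_real (inverse s) + \<i>) = sgn (1 + \<i> * complex_of_real s)"
      using eventually_gt_at_bot[of 0] by eventually_elim (simp only: eq, simp)
  qed
  from filterlim_compose[OF this bot]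
  show "((\<lambda>t. sgn (1 + \<i> * complex_of_real (t + r))) \<longlongrightarrow> - \<i>) at_bot" .
qed


lemma norm_line_at_top:
  assumes "F = at_top \<or> F = at_bot"
  shows "filterlim (\<lambda>t. norm (1 + \<i> * complex_of_real (t + r))) at_top F"
proof -
  have le: "\<bar>t\<bar> - \<bar>r\<bar> \<le> norm (1 + \<i> * complex_of_real (t + r))" for t
    using abs_Im_le_cmod[of "1 + \<i> * complex_of_real (t + r)"] by simp
  have "\<forall>\<^sub>F t in at_top. Z \<le> \<bar>t\<bar> - \<bar>r\<bar>" for Z
    using eventually_ge_at_top[of "\<bar>r\<bar> + \<bar>Z\<bar>"] by eventually_elim linarith
  moreover have "\<forall>\<^sub>F t in at_bot. Z \<le> \<bar>t\<bar> - \<bar>r\<bar>" for Z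
    using eventually_le_at_bot[of "- (\<bar>r\<bar> + \<bar>Z\<bar>)"] by eventually_elim linarith
  ultimately have "\<forall>\<^sub>F t in F. Z \<le> \<bar>t\<bar> - \<bar>r\<bar>" for Z using assms by auto
  then show ?thesis
    unfolding filterlim_at_top by (blast intro: eventually_mono order_trans[OF _ le])
qed

text \<open>With \<open>x = (1/Z - 1) (1/cnj Z' - 1)\<close> one has \<open>1 - x = (1 + i (r - r')) / (Z cnj Z')\<close>, while
  \<open>1 - |x|\<close> is at least \<open>1 / (2 |Z| |Z'|)\<close>: the argument of the series tends to \<open>1\<close> within a Stolz angle, and
  the phase of the limit is that of \<open>Z\<^sup>-\<^sup>p\<^sup>-\<^sup>1 (cnj Z')\<^sup>-\<^sup>q\<^sup>-\<^sup>1\<close>.\<close>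

lemma transition_amplitude_tendsto:
  fixes p q r r' :: real
  assumes p: "p > -1" and q: "q > -1"
    and F: "F = at_top \<and> j = \<i> \<or> F = at_bot \<and> j = - \<i>"
  defines "\<beta> \<equiv> (p + q) / 2 + 1"
  shows "((\<lambda>t. \<Sum>n. laguerre_transform p (laguerre p n) (t + r) * cnj (laguerre_transform q (laguerre q n) (t + r')))
    \<longlongrightarrow> exp (j * complex_of_real ((q - p) * pi / 2)) *
      (complex_of_real (Gamma \<beta> / sqrt (Gamma (p + 1) * Gamma (q + 1))) *
        (1 + \<i> * complex_of_real (r - r')) powr (- of_real \<beta>))) F"
proof -
  have b: "\<beta> > 0" using p q by (simp add: \<beta>_def field_simps)
  define Z where "Z t = 1 + \<i> * complex_of_real (t + r)" for t
  define Y where "Y t = 1 - \<i> * complex_of_real (t + r')" for t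
  define x where "x t = (1 / Z t - 1) * (1 / Y t - 1)" for t
  define d where "d n = laguerre_coeff p n * laguerre_coeff q n" for n
  define C where "C = Gamma \<beta> / sqrt (Gamma (p + 1) * Gamma (q + 1))"
  define \<zeta> where "\<zeta> = 1 + \<i> * complex_of_real (r - r')"
  define A where "A t = Z t powr (- of_real (p + 1)) * Y t powr (- of_real (q + 1))" for t
  define R where "R t = norm (Z t) * norm (Y t)" for t
  have j: "j = \<i> \<or> j = - \<i>" using F by auto
  have Znz: "Z t \<noteq> 0" and Ynz: "Y t \<noteq> 0" for t by (simp_all add: Z_def Y_def complex_eq_iff)
  have Y_cnj: "Y t = cnj (1 + \<i> * complex_of_real (t + r'))" for t by (simp add: Y_def)
  have normY: "norm (Y t) = norm (1 + \<i> * complex_of_real (t + r'))" for t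
    unfolding Y_cnj by (rule complex_mod_cnj)
  have Z1: "norm (Z t) \<ge> 1" and Y1: "norm (Y t) \<ge> 1" for t
    using abs_Re_le_cmod[of "Z t"] abs_Re_le_cmod[of "Y t"] by (simp_all add: Z_def Y_def)
  have R1: "R t \<ge> 1" for t using mult_mono[OF Z1 Y1, of t t] by (simp add: R_def)

  have x1: "1 - x t = \<zeta> / (Z t * Y t)" for t
  proof -
    have "1 - x t = (Z t + Y t - 1) / (Z t * Y t)"
      using Znz[of t] Ynz[of t] by (simp add: x_def field_simps)
    also have "Z t + Y t - 1 = \<zeta>" by (simp add: Z_def Y_def \<zeta>_def algebra_simps)
    finally show ?thesis .
  qed
  \<comment> \<open>The map 1/w - 1 sends the line of real part 1 into the unit disc, because there
    the squared modulus of 1 - w is that of w minus 1.\<close>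
  have norm_factor: "(norm (1 / w - 1))\<^sup>2 = 1 - 1 / (norm w)\<^sup>2" if "Re w = 1" for w
  proof -
    have "w \<noteq> 0" using that by auto
    then have "1 / w - 1 = (1 - w) / w" by (simp add: field_simps)
    then have "(norm (1 / w - 1))\<^sup>2 = (norm (1 - w))\<^sup>2 / (norm w)\<^sup>2"
      by (simp only: norm_divide power_divide)
    also have "(norm (1 - w))\<^sup>2 = (norm w)\<^sup>2 - 1" using that by (simp add: cmod_power2)
    finally show ?thesis using \<open>w \<noteq> 0\<close> by (simp add: diff_divide_distrib)
  qed
  have xn: "1 / (2 * R t) \<le> 1 - norm (x t)" for t
  proof -
    let ?a = "norm (Z t)" and ?b = "norm (Y t)"
    have xsq: "(norm (x t))\<^sup>2 = (1 - 1 / ?a\<^sup>2) * (1 - 1 / ?b\<^sup>2)"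
      unfolding x_def norm_mult power_mult_distrib by (subst (1 2) norm_factor) (simp_all add: Z_def Y_def)
    \<comment> \<open>Applied to u = 1/\<bar>Z\<bar> and v = 1/\<bar>Y\<bar>: the product expands to
      1 - (u\<twosuperior> + v\<twosuperior>) + u\<twosuperior> v\<twosuperior>, where the middle
      term costs at least 2 u v and the last gains at most u v. Passing from the square of
      \<open>norm (x t)\<close> to \<open>norm (x t)\<close> then accounts for the factor 2 in
      \<open>xn\<close>.\<close>
    have le: "(1 - u\<^sup>2) * (1 - v\<^sup>2) \<le> 1 - u * v" if "0 \<le> u" "u \<le> 1" "0 \<le> v" "v \<le> 1" for u v :: real
    proof -
      have "(u * v) * (u * v) \<le> (u * v) * 1" using that by (intro mult_left_mono mult_le_one) auto
      then have "u\<^sup>2 * v\<^sup>2 \<le> u * v" by (simp add: power2_eq_square mult_ac)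
      moreover have "2 * (u * v) \<le> u\<^sup>2 + v\<^sup>2" using sum_squares_bound[of u v] by simp
      ultimately show ?thesis by (simp add: algebra_simps)
    qed
    have "(norm (x t))\<^sup>2 \<le> 1 - (1 / ?a) * (1 / ?b)"
    proof -
      have "1 / ?a \<le> 1" "1 / ?b \<le> 1" using Z1[of t] Y1[of t] Znz[of t] Ynz[of t] by (auto simp: divide_le_eq)
      then have "(1 - (1 / ?a)\<^sup>2) * (1 - (1 / ?b)\<^sup>2) \<le> 1 - (1 / ?a) * (1 / ?b)" by (intro le) auto
      then show ?thesis unfolding xsq by (simp only: power_one_over)
    qed
    then have "(norm (x t))\<^sup>2 \<le> 1 - 1 / R t" by (simp add: R_def)
    moreover have "2 * norm (x t) \<le> (norm (x t))\<^sup>2 + 1" using sum_squares_bound[of "norm (x t)" 1] by simp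
    ultimately have "1 / R t \<le> 2 * (1 - norm (x t))" by simp
    then show ?thesis by simp
  qed
  have x_lt: "norm (x t) < 1" for t
  proof -
    have "0 < 1 / (2 * R t)" using R1[of t] by simp
    then show ?thesis using xn[of t] by linarith
  qed

  have S_eq: "(\<Sum>n. laguerre_transform p (laguerre p n) (t + r) * cnj (laguerre_transform q (laguerre q n) (t + r'))) =
      A t * (\<Sum>n. complex_of_real (d n) * x t ^ n)" if "summable (\<lambda>n. complex_of_real (d n) * x t ^ n)" for t
  proof -
    have "1 + \<i> * complex_of_real (t + r') \<notin> \<real>\<^sub>\<le>\<^sub>0"
      by (simp add: complex_nonpos_Reals_iff)
    then have c: "cnj ((1 + \<i> * complex_of_real (t + r')) powr (- of_real (q + 1))) = Y t powr (- of_real (q + 1))"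
      unfolding Y_cnj by (subst cnj_powr) simp_all
    have "laguerre_transform p (laguerre p n) (t + r) * cnj (laguerre_transform q (laguerre q n) (t + r')) =
        A t * (complex_of_real (d n) * x t ^ n)" for n
      unfolding laguerre_transform_laguerre[OF p] laguerre_transform_laguerre[OF q] complex_cnj_mult c
        complex_cnj_power complex_cnj_diff complex_cnj_divide complex_cnj_one Y_cnj[symmetric]
        complex_cnj_complex_of_real Z_def[symmetric]
      by (simp add: A_def d_def x_def power_mult_distrib)
    then show ?thesis using suminf_mult[OF that, of "A t"] by simp
  qed

  have sgnZ: "((\<lambda>t. sgn (Z t)) \<longlongrightarrow> j) F"
    using F sgn_line_tendsto unfolding Z_def by auto
  have sgnY: "((\<lambda>t. sgn (Y t)) \<longlongrightarrow> - j) F"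
  proof -
    have "((\<lambda>t. cnj (sgn (1 + \<i> * complex_of_real (t + r')))) \<longlongrightarrow> cnj j) F"
      using F sgn_line_tendsto by (intro tendsto_cnj) auto
    moreover have "cnj (sgn (1 + \<i> * complex_of_real (t + r'))) = sgn (Y t)" for t
      unfolding Y_cnj by (simp only: sgn_eq complex_cnj_divide complex_mod_cnj complex_cnj_complex_of_real)
    moreover have "cnj j = - j" using j by auto
    ultimately show ?thesis by simp
  qed
  have Ytop: "filterlim (\<lambda>t. norm (Y t)) at_top F"
    using F norm_line_at_top[of F r'] unfolding normY by auto
  have Rtop: "filterlim R at_top F"
  proof (rule filterlim_at_top_mono[OF Ytop])
    show "\<forall>\<^sub>F t in F. norm (Y t) \<le> R t"
      unfolding R_def using Z1 by (intro always_eventually allI mult_le_cancel_right1[THEN iffD2]) auto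
  qed
  \<comment> \<open>\<open>B t\<close> weighs the decay of the prefactor against the growth of the
    series. The exponents of \<bar>Z\<bar> and \<bar>Y\<bar> in it are opposite, (q - p) / 2 and its
    negative, so \<open>B t\<close> is a power of a ratio tending to 1.\<close>
  define B where "B t = norm (A t) * R t powr \<beta>" for t
  have normA: "norm (A t) = norm (Z t) powr (- (p + 1)) * norm (Y t) powr (- (q + 1))" for t
    using norm_powr_of_real[OF Znz, of t "- (p + 1)"] norm_powr_of_real[OF Ynz, of t "- (q + 1)"]
    by (simp add: A_def norm_mult)
  have "B t = (norm (Z t) / norm (Y t)) powr ((q - p) / 2)" for t
  proof -
    let ?a = "norm (Z t)" and ?b = "norm (Y t)"
    have "B t = (?a powr (- (p + 1)) * ?a powr \<beta>) * (?b powr (- (q + 1)) * ?b powr \<beta>)"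
      by (simp add: B_def normA R_def powr_mult)
    also have "\<dots> = ?a powr ((q - p) / 2) * ?b powr (- ((q - p) / 2))"
    proof -
      have "- (p + 1) + \<beta> = (q - p) / 2" "- (q + 1) + \<beta> = - ((q - p) / 2)"
        by (simp_all add: \<beta>_def field_simps)
      then show ?thesis by (simp only: powr_add[symmetric])
    qed
    also have "\<dots> = (?a / ?b) powr ((q - p) / 2)"
      by (simp add: powr_divide powr_minus_divide)
    finally show ?thesis .
  qed
  moreover have "((\<lambda>t. norm (Z t) / norm (Y t)) \<longlongrightarrow> 1) F"
  proof -
    \<comment> \<open>\<open>Z t\<close> and the conjugate of \<open>Y t\<close> differ by the fixed
      number \<i> (r - r'), while both moduli grow.\<close>
    have le: "norm (norm (Z t) / norm (Y t) - 1) \<le> \<bar>r - r'\<bar> / norm (Y t)" for t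
    proof -
      have "\<bar>norm (Z t) - norm (Y t)\<bar> \<le> norm (Z t - (1 + \<i> * complex_of_real (t + r')))"
        unfolding normY by (rule norm_triangle_ineq3)
      also have "Z t - (1 + \<i> * complex_of_real (t + r')) = \<i> * complex_of_real (r - r')"
        by (simp add: Z_def algebra_simps)
      also have "norm (\<i> * complex_of_real (r - r')) = \<bar>r - r'\<bar>" by (simp only: norm_mult norm_of_real) simp
      finally have "\<bar>norm (Z t) - norm (Y t)\<bar> / norm (Y t) \<le> \<bar>r - r'\<bar> / norm (Y t)"
        by (rule divide_right_mono) simp
      moreover have "norm (Z t) / norm (Y t) - 1 = (norm (Z t) - norm (Y t)) / norm (Y t)"
        using Ynz[of t] by (simp add: diff_divide_distrib)
      ultimately show ?thesis by (simp add: abs_divide)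
    qed
    have "((\<lambda>t. \<bar>r - r'\<bar> / norm (Y t)) \<longlongrightarrow> 0) F"
      by (intro tendsto_divide_0[OF tendsto_const] filterlim_at_top_imp_at_infinity Ytop)
    then have "((\<lambda>t. norm (Z t) / norm (Y t) - 1) \<longlongrightarrow> 0) F"
      by (rule Lim_null_comparison[rotated]) (use le in simp)
    then show ?thesis by (simp only: LIM_zero_iff)
  qed
  ultimately have "((\<lambda>t. B t) \<longlongrightarrow> 1 powr ((q - p) / 2)) F"
    by (simp only:) (intro tendsto_powr tendsto_const, simp_all)
  then have Blim: "(B \<longlongrightarrow> 1) F" by simp

  have main: "((\<lambda>t. A t * (of_real C * (1 - x t) powr (- of_real \<beta>))) \<longlongrightarrow>
      exp (j * complex_of_real ((q - p) * pi / 2)) * (of_real C * \<zeta> powr (- of_real \<beta>))) F"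
  proof -
    let ?p = "- complex_of_real (p + 1)" and ?q = "- complex_of_real (q + 1)" and ?b = "- complex_of_real \<beta>"
    have split: "w powr complex_of_real s = complex_of_real (norm w powr s) * sgn w powr complex_of_real s"
      if "w \<noteq> 0" for w and s :: real
    proof -
      have "w = complex_of_real (norm w) * sgn w" using that by (simp add: sgn_eq)
      then have "w powr complex_of_real s = (complex_of_real (norm w) * sgn w) powr complex_of_real s" by simp
      also have "\<dots> = complex_of_real (norm w) powr complex_of_real s * sgn w powr complex_of_real s"
        using that by (intro powr_of_real_mult_complex) (auto simp: sgn_zero_iff)
      also have "complex_of_real (norm w) powr complex_of_real s = complex_of_real (norm w powr s)"
        by (rule powr_of_real) auto
      finally show ?thesis .
    qed
    have \<zeta>nz: "\<zeta> \<noteq> 0" by (simp add: \<zeta>_def complex_eq_iff)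
    \<comment> \<open>Moduli and phases are separated: the moduli collect in \<open>B t\<close>. The
      phases stay on the unit circle and tend to j and -j, off the branch cut, where complex powers
      are continuous.\<close>
    have eq: "A t * (of_real C * (1 - x t) powr ?b) = complex_of_real (B t) *
        (sgn (Z t) powr ?p * sgn (Y t) powr ?q * (of_real C * (\<zeta> / (sgn (Z t) * sgn (Y t))) powr ?b))" for t
    proof -
      have Rp: "R t > 0" using R1[of t] by simp
      have "1 - x t = complex_of_real (1 / R t) * (\<zeta> / (sgn (Z t) * sgn (Y t)))"
        unfolding x1 R_def using Znz[of t] Ynz[of t] by (simp add: sgn_eq)
      then have "(1 - x t) powr ?b = complex_of_real (1 / R t) powr ?b * (\<zeta> / (sgn (Z t) * sgn (Y t))) powr ?b"
        using Rp \<zeta>nz Znz Ynz by (simp only:) (intro powr_of_real_mult_complex, auto simp: sgn_zero_iff)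
      also have "complex_of_real (1 / R t) powr ?b = complex_of_real ((1 / R t) powr (- \<beta>))"
        using powr_of_real[of "1 / R t" "- \<beta>"] Rp by simp
      also have "(1 / R t) powr (- \<beta>) = R t powr \<beta>"
        using Rp by (simp add: powr_minus powr_divide)
      finally have 1: "(1 - x t) powr ?b = complex_of_real (R t powr \<beta>) * (\<zeta> / (sgn (Z t) * sgn (Y t))) powr ?b" .
      have 2: "A t = complex_of_real (norm (A t)) * (sgn (Z t) powr ?p * sgn (Y t) powr ?q)"
        using split[OF Znz, of t "- (p + 1)"] split[OF Ynz, of t "- (q + 1)"] unfolding normA
        by (simp add: A_def)
      show ?thesis unfolding 1 B_def by (subst 2) (simp add: mult_ac)
    qed
    have jn: "j \<notin> \<real>\<^sub>\<le>\<^sub>0" "- j \<notin> \<real>\<^sub>\<le>\<^sub>0" "j \<noteq> 0" using j by (auto simp: complex_nonpos_Reals_iff)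
    have jj: "j * (- j) = 1" using j by auto
    have \<zeta>n: "\<zeta> / (j * (- j)) \<notin> \<real>\<^sub>\<le>\<^sub>0" unfolding jj by (simp add: \<zeta>_def complex_nonpos_Reals_iff)
    have L: "((\<lambda>t. complex_of_real (B t) *
        (sgn (Z t) powr ?p * sgn (Y t) powr ?q * (of_real C * (\<zeta> / (sgn (Z t) * sgn (Y t))) powr ?b))) \<longlongrightarrow>
        complex_of_real 1 * (j powr ?p * (- j) powr ?q * (of_real C * (\<zeta> / (j * (- j))) powr ?b))) F"
      using jn by (intro tendsto_mult tendsto_of_real Blim tendsto_powr_complex sgnZ sgnY tendsto_const tendsto_divide \<zeta>n) auto
    \<comment> \<open>The phases of \<open>Z t\<close> and \<open>Y t\<close> tend to opposite
      quarter turns, so the exponents p + 1 and q + 1 enter with opposite signs and only q - p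
      remains.\<close>
    have J: "j powr ?p * (- j) powr ?q = exp (j * complex_of_real ((q - p) * pi / 2))"
    proof -
      have Lj: "Ln j = j * (complex_of_real pi / 2)" "Ln (- j) = - j * (complex_of_real pi / 2)"
        using j by auto
      have "j powr ?p * (- j) powr ?q = exp (?p * Ln j) * exp (?q * Ln (- j))"
        using jn by (simp add: powr_def)
      also have "\<dots> = exp (?p * (j * (complex_of_real pi / 2)) + ?q * (- j * (complex_of_real pi / 2)))"
        unfolding Lj exp_add ..
      also have "?p * (j * (complex_of_real pi / 2)) + ?q * (- j * (complex_of_real pi / 2)) =
          j * complex_of_real ((q - p) * pi / 2)"
        by (simp add: field_simps)
      finally show ?thesis .
    qed
    show ?thesis
      unfolding eq using L[unfolded J jj] by (simp only: of_real_1 mult_1_left div_by_1)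
  qed

  have lim_d: "(\<lambda>n. d n / (pochhammer \<beta> n / fact n)) \<longlonglongrightarrow> C"
    unfolding d_def C_def \<beta>_def by (rule laguerre_coeff_product_asymp[OF p q])
  define E where "E t = (\<Sum>n. complex_of_real (d n) * x t ^ n) - of_real C * (1 - x t) powr (- of_real \<beta>)" for t
  have err: "((\<lambda>t. A t * E t) \<longlongrightarrow> 0) F"
  proof (rule tendstoI)
    fix e :: real assume e: "e > 0"
    \<comment> \<open>The Stolz bound costs a factor \<open>2 powr \<beta>\<close>, so the error
      bound tends to e / 4.\<close>
    define \<epsilon> where "\<epsilon> = e / (4 * 2 powr \<beta>)"
    have eps: "\<epsilon> > 0" using e by (simp add: \<epsilon>_def)
    obtain M where M: "\<And>w. norm w < 1 \<Longrightarrow> norm ((\<Sum>n. complex_of_real (d n) * w ^ n) -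
        of_real C * (1 - w) powr (- of_real \<beta>)) \<le> M + \<epsilon> * (1 - norm w) powr (- \<beta>)"
      using abelian_bound[OF b lim_d eps] by blast
    \<comment> \<open>Multiplying by \<open>norm (A t)\<close> turns \<open>R t powr \<beta>\<close>
      into the bounded factor \<open>B t\<close>; the constant M is then divided by a power of R
      that tends to infinity.\<close>
    have bound: "norm (A t * E t) \<le> B t * (\<bar>M\<bar> * R t powr (- \<beta>) + \<epsilon> * 2 powr \<beta>)" for t
    proof -
      have Rp: "R t > 0" using R1[of t] by simp
      have "(1 - norm (x t)) powr (- \<beta>) \<le> (1 / (2 * R t)) powr (- \<beta>)"
        using b Rp xn by (intro powr_mono2') auto
      also have "\<dots> = 2 powr \<beta> * R t powr \<beta>"
        using Rp by (simp add: powr_minus powr_divide powr_mult)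
      finally have le: "(1 - norm (x t)) powr (- \<beta>) \<le> 2 powr \<beta> * R t powr \<beta>" .
      have "norm (E t) \<le> M + \<epsilon> * (1 - norm (x t)) powr (- \<beta>)"
        unfolding E_def by (rule M[OF x_lt])
      also have "\<dots> \<le> \<bar>M\<bar> + \<epsilon> * (2 powr \<beta> * R t powr \<beta>)"
        using eps by (intro add_mono abs_ge_self mult_left_mono le) simp
      also have "\<dots> = R t powr \<beta> * (\<bar>M\<bar> * R t powr (- \<beta>) + \<epsilon> * 2 powr \<beta>)"
        using Rp by (simp add: powr_minus field_simps)
      finally have "norm (A t) * norm (E t) \<le> norm (A t) * (R t powr \<beta> * (\<bar>M\<bar> * R t powr (- \<beta>) + \<epsilon> * 2 powr \<beta>))"
        by (rule mult_left_mono) simp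
      then show ?thesis by (simp add: norm_mult B_def mult.assoc)
    qed
    have "((\<lambda>t. R t powr (- \<beta>)) \<longlongrightarrow> 0) F"
      using b by (intro tendsto_neg_powr Rtop) auto
    then have "((\<lambda>t. B t * (\<bar>M\<bar> * R t powr (- \<beta>) + \<epsilon> * 2 powr \<beta>)) \<longlongrightarrow> 1 * (\<bar>M\<bar> * 0 + \<epsilon> * 2 powr \<beta>)) F"
      by (intro tendsto_intros Blim)
    moreover have "1 * (\<bar>M\<bar> * 0 + \<epsilon> * 2 powr \<beta>) < e" using e by (simp add: \<epsilon>_def)
    ultimately have "\<forall>\<^sub>F t in F. B t * (\<bar>M\<bar> * R t powr (- \<beta>) + \<epsilon> * 2 powr \<beta>) < e"
      by (rule order_tendstoD)
    then show "\<forall>\<^sub>F t in F. dist (A t * E t) 0 < e"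
      by eventually_elim (simp only: dist_norm diff_zero le_less_trans[OF bound])
  qed

  have summ: "summable (\<lambda>n. complex_of_real (d n) * x t ^ n)" for t
    using abelian_bound[OF b lim_d zero_less_one] x_lt[of t] by blast
  have "A t * (\<Sum>n. complex_of_real (d n) * x t ^ n) =
      A t * (of_real C * (1 - x t) powr (- of_real \<beta>)) + A t * E t" for t
    by (simp add: E_def algebra_simps)
  then show ?thesis
    using tendsto_add[OF main err] unfolding S_eq[OF summ] C_def[symmetric] \<zeta>_def[symmetric] by simp
qed

section \<open>Wave operators\<close>

text \<open>Coordinate n is the inner product with basis vector n, computed on the function side.
  Since the polynomial of index 0 is 1, the product of the two Laguerre functions is the n-th
  polynomial times the weight.\<close>

lemma ell2_nth_laguerre_group:
  assumes p: "p > -1"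
  shows "ell2_nth (laguerre_group p (- s) (unit_ell2 0)) n = laguerre_transform p (laguerre p n) s"
proof -
  note sq = sq_integrable_laguerre[OF p]
  have "ell2_nth (laguerre_group p (- s) (unit_ell2 0)) n =
      cinner (Phi p (laguerre_group p (- s) (unit_ell2 0))) (Phi p (unit_ell2 n))"
    by (simp add: unitary_cinner[OF unitary_Phi[OF p]] cinner_unit_ell2)
  also have "\<dots> = (\<integral>x. iexp (- s * x) * complex_of_real (laguerre_fun p 0 x) * cnj (complex_of_real (laguerre_fun p n x)) \<partial>half_line)"
    unfolding Phi_laguerre_group[OF p] Phi_unit[OF p] laguerre_vec_def[OF p] mult_exp_L2_class[OF sq]
    by (rule cinner_L2_class[OF sq_integrable_mult_exp[OF sq] sq])
  also have "\<dots> = laguerre_transform p (laguerre p n) s"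
    unfolding laguerre_transform_def[OF p]
  proof (rule Bochner_Integration.integral_cong[OF refl])
    fix x
    have "laguerre_fun p 0 x * laguerre_fun p n x = laguerre p n x * laguerre_weight p x"
      using laguerre_weight_nonneg[OF p, of x] by (simp add: laguerre_fun_def mult_ac)
    then have eq: "complex_of_real (laguerre_fun p 0 x) * complex_of_real (laguerre_fun p n x) =
        complex_of_real (laguerre p n x * laguerre_weight p x)"
      by (simp only: of_real_mult[symmetric])
    show "iexp (- s * x) * complex_of_real (laguerre_fun p 0 x) * cnj (complex_of_real (laguerre_fun p n x)) =
        complex_of_real (laguerre p n x * laguerre_weight p x) * iexp (- s * x)"
      unfolding complex_cnj_complex_of_real mult.assoc eq by (rule mult.commute)
  qed
  finally show ?thesis .
qed

text \<open>The roots of the two weights multiply to a constant times the weight with parameter (p +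
  q) / 2, so the transform of the function 1 applies. The constant is the limit found in
  \<open>laguerre_coeff_product_asymp\<close>, which makes the moving and the stationary inner
  products agree up to the phase.\<close>

lemma cinner_Phi_laguerre_group:
  assumes p: "p > -1" and q: "q > -1"
  defines "\<beta> \<equiv> (p + q) / 2 + 1"
  shows "cinner (Phi p (laguerre_group p (- r) (unit_ell2 0))) (Phi q (laguerre_group q (- r') (unit_ell2 0))) =
    complex_of_real (Gamma \<beta> / sqrt (Gamma (p + 1) * Gamma (q + 1))) *
      (1 + \<i> * complex_of_real (r - r')) powr (- of_real \<beta>)"
proof -
  define a where "a = (p + q) / 2"
  have a: "a > -1" using p q by (simp add: a_def field_simps)
  have \<beta>: "\<beta> = a + 1" by (simp add: \<beta>_def a_def)
  define C where "C = Gamma \<beta> / sqrt (Gamma (p + 1) * Gamma (q + 1))"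
  have w: "laguerre_fun p 0 x * laguerre_fun q 0 x = C * laguerre_weight a x" if x: "x > 0" for x
  proof -
    have "laguerre_fun p 0 x * laguerre_fun q 0 x = sqrt (laguerre_weight p x * laguerre_weight q x)"
      by (simp add: laguerre_fun_def real_sqrt_mult)
    also have "laguerre_weight p x * laguerre_weight q x =
        (x powr a * exp (- x))\<^sup>2 / (Gamma (p + 1) * Gamma (q + 1))"
    proof -
      have "x powr p * x powr q = (x powr a)\<^sup>2"
        by (simp add: power2_eq_square a_def flip: powr_add)
      then show ?thesis by (simp add: laguerre_weight_def power_mult_distrib power2_eq_square)
    qed
    also have "sqrt \<dots> = x powr a * exp (- x) / sqrt (Gamma (p + 1) * Gamma (q + 1))"
      by (simp add: real_sqrt_divide)
    also have "\<dots> = C * laguerre_weight a x"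
      using Gamma_nonzero[OF a] by (simp add: C_def laguerre_weight_def \<beta>)
    finally show ?thesis .
  qed
  have "cinner (Phi p (laguerre_group p (- r) (unit_ell2 0))) (Phi q (laguerre_group q (- r') (unit_ell2 0))) =
      (\<integral>x. (iexp (- r * x) * complex_of_real (laguerre_fun p 0 x)) * cnj (iexp (- r' * x) * complex_of_real (laguerre_fun q 0 x)) \<partial>half_line)"
    unfolding Phi_laguerre_group[OF p] Phi_laguerre_group[OF q] Phi_unit[OF p] Phi_unit[OF q] laguerre_vec_def[OF p] laguerre_vec_def[OF q]
      mult_exp_L2_class[OF sq_integrable_laguerre[OF p]] mult_exp_L2_class[OF sq_integrable_laguerre[OF q]]
    by (intro cinner_L2_class sq_integrable_mult_exp sq_integrable_laguerre p q)
  also have "\<dots> = (\<integral>x. complex_of_real C * (complex_of_real (1 * laguerre_weight a x) * iexp (- (r - r') * x)) \<partial>half_line)"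
  proof (rule Bochner_Integration.integral_cong[OF refl])
    fix x assume "x \<in> space half_line"
    then have x: "x > 0" by (simp add: space_restrict_space)
    have e: "iexp (- r * x) * cnj (iexp (- r' * x)) = iexp (- (r - r') * x)"
      by (simp add: exp_cnj algebra_simps flip: exp_add)
    have "(iexp (- r * x) * complex_of_real (laguerre_fun p 0 x)) * cnj (iexp (- r' * x) * complex_of_real (laguerre_fun q 0 x)) =
        complex_of_real (laguerre_fun p 0 x * laguerre_fun q 0 x) * (iexp (- r * x) * cnj (iexp (- r' * x)))"
      by (simp only: complex_cnj_mult complex_cnj_complex_of_real of_real_mult mult_ac)
    then show "(iexp (- r * x) * complex_of_real (laguerre_fun p 0 x)) * cnj (iexp (- r' * x) * complex_of_real (laguerre_fun q 0 x)) =
        complex_of_real C * (complex_of_real (1 * laguerre_weight a x) * iexp (- (r - r') * x))"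
      unfolding e w[OF x] by (simp only: of_real_mult mult_1_left mult.assoc)
  qed
  also have "\<dots> = complex_of_real C * laguerre_transform a (\<lambda>_. 1) (r - r')"
    unfolding laguerre_transform_def[OF a] by (rule integral_mult_right_zero)
  also have "\<dots> = complex_of_real C * (1 + \<i> * complex_of_real (r - r')) powr (- of_real \<beta>)"
    unfolding laguerre_transform_one[OF a] \<beta> ..
  finally show ?thesis unfolding C_def .
qed

text \<open>A closed subspace containing the orbit of the first basis vector is invariant under the generator,
  and the recurrence produces all other basis vectors.\<close>

lemma laguerre_group_cyclic:
  assumes p: "p > -1" and S: "closed S"
    and add: "\<And>f g. f \<in> S \<Longrightarrow> g \<in> S \<Longrightarrow> f + g \<in> S" and scaleC: "\<And>a f. f \<in> S \<Longrightarrow> a *\<^sub>C f \<in> S"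
    and orbit: "\<And>s. laguerre_group p s (unit_ell2 0) \<in> S"
  shows "f \<in> S"
proof -
  let ?U = "laguerre_group p"
  note U = unitary_group_laguerre[OF p]
  have lin: "clinear (?U s)" for s by (rule unitary_clinear[OF unitary_group_unitary[OF U]])
  have diff: "f - g \<in> S" if "f \<in> S" "g \<in> S" for f g
    using add[OF that(1) scaleC[OF that(2), of "-1"]] by (simp add: scaleC_minus_one)
  \<comment> \<open>Difference quotients at f involve the vectors \<open>?U t f\<close>, which may
    leave \<open>S\<close>. \<open>S'\<close> keeps the vectors whose entire orbit lies in
    \<open>S\<close>, so it is stable under the generator.\<close>
  define S' where "S' = {f. \<forall>s. ?U s f \<in> S}"
  have add': "f + g \<in> S'" if "f \<in> S'" "g \<in> S'" for f g
    using that add by (simp add: S'_def clinear_add[OF lin])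
  have scaleC': "a *\<^sub>C f \<in> S'" if "f \<in> S'" for a f
    using that scaleC by (simp add: S'_def clinear_scaleC[OF lin])
  have diff': "f - g \<in> S'" if "f \<in> S'" "g \<in> S'" for f g
    using that diff by (simp add: S'_def clinear_diff[OF lin])
  have gen: "g \<in> S'" if f: "f \<in> S'" and fg: "(f, g) \<in> generator ?U" for f g
    unfolding S'_def
  proof (intro CollectI allI)
    fix s
    have lim: "((\<lambda>t. (1 / (\<i> * complex_of_real t)) *\<^sub>C (?U t (?U s f) - ?U s f)) \<longlongrightarrow> ?U s g) (at 0)"
      using generator_invariant[OF U fg, of s] by (simp only: generator_iff)
    have "(1 / (\<i> * complex_of_real t)) *\<^sub>C (?U t (?U s f) - ?U s f) \<in> S" for t
    proof -
      have "?U t (?U s f) \<in> S" "?U s f \<in> S"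
        using f by (simp_all add: S'_def flip: unitary_group_add[OF U])
      then show ?thesis by (intro scaleC diff)
    qed
    then show "?U s g \<in> S"
      using Lim_in_closed_set[OF S _ _ lim] by simp
  qed
  have unit: "unit_ell2 n \<in> S'" for n
  proof (induction n rule: less_induct)
    case (less n)
    show ?case
    proof (cases n)
      case 0
      then show ?thesis using orbit by (simp add: S'_def)
    next
      case (Suc m)
      have m: "unit_ell2 m \<in> S'" using less Suc by simp
      have z: "0 \<in> S'" using scaleC'[OF m, of 0] by simp
      define r where "r = (if m = 0 then 0 else complex_of_real (lag_a p (m - 1)) *\<^sub>C unit_ell2 (m - 1))"
      have r: "r \<in> S'" using less Suc z by (auto simp: r_def intro!: scaleC')
      have J: "jacobi_unit p m \<in> S'" by (rule gen[OF m jacobi_unit_generator[OF p]])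
      have "complex_of_real (lag_a p m) *\<^sub>C unit_ell2 (Suc m) =
          jacobi_unit p m - (r + complex_of_real (lag_b p m) *\<^sub>C unit_ell2 m)"
        by (simp add: jacobi_unit_def[OF p] r_def)
      also have "\<dots> \<in> S'" by (intro diff' add' scaleC' J r m)
      finally have "complex_of_real (1 / lag_a p m) *\<^sub>C complex_of_real (lag_a p m) *\<^sub>C unit_ell2 (Suc m) \<in> S'"
        by (rule scaleC')
      then show ?thesis using lag_a_pos[OF p, of m] Suc by (simp add: scaleC_scaleC)
    qed
  qed
  have zero: "0 \<in> S'" using scaleC'[OF unit[of 0], of 0] by simp
  have "trunc_ell2 N f \<in> S'" for N
    unfolding trunc_ell2_def by (induction N) (auto intro: zero add' scaleC' unit)
  then have "trunc_ell2 N f \<in> S" for N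
    unfolding S'_def using unitary_group_0[OF U] by (metis (mono_tags, lifting) id_apply mem_Collect_eq)
  then show ?thesis
    using closed_sequentially[OF S _ trunc_ell2_tendsto] by blast
qed

text \<open>An \<epsilon>/3 argument: the common bound K makes the functionals equicontinuous. The
  abstract form serves both slots of the inner product.\<close>

lemma closed_weak_limit_set:
  fixes T :: "'c \<Rightarrow> 'a::real_normed_vector \<Rightarrow> complex"
  assumes T: "\<And>t x y. T t (x - y) = T t x - T t y" and L: "\<And>x y. L (x - y) = L x - L y"
    and Tb: "\<And>t x. norm (T t x) \<le> K * norm x" and Lb: "\<And>x. norm (L x) \<le> K * norm x" and K: "K \<ge> 0"
  shows "closed {x. ((\<lambda>t. T t x) \<longlongrightarrow> L x) F}"
  unfolding closed_sequential_limits
proof (intro allI impI, elim conjE, intro CollectI tendstoI)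
  fix x l and e :: real
  assume x: "\<forall>n. x n \<in> {x. ((\<lambda>t. T t x) \<longlongrightarrow> L x) F}" and lim: "x \<longlonglongrightarrow> l" and e: "e > 0"
  have "(\<lambda>n. K * norm (x n - l)) \<longlonglongrightarrow> K * norm (l - l)" by (intro tendsto_intros lim)
  then have "\<forall>\<^sub>F n in sequentially. K * norm (x n - l) < e / 3" using e by (intro order_tendstoD) auto
  then obtain n where n: "K * norm (x n - l) < e / 3" by (auto simp: eventually_sequentially)
  have "\<forall>\<^sub>F t in F. dist (T t (x n)) (L (x n)) < e / 3" using x e by (intro tendstoD) auto
  then show "\<forall>\<^sub>F t in F. dist (T t l) (L l) < e"
  proof eventually_elim
    case (elim t)
    have "T t l - L l = (T t (x n) - L (x n)) - T t (x n - l) + L (x n - l)" by (simp add: T L)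
    also have "norm \<dots> \<le> norm (T t (x n) - L (x n)) + norm (T t (x n - l)) + norm (L (x n - l))"
      by (meson add_right_mono norm_triangle_ineq norm_triangle_ineq4 order_trans)
    also have "\<dots> < e / 3 + e / 3 + e / 3"
      using elim Tb[of t "x n - l"] Lb[of "x n - l"] n by (simp add: dist_norm)
    finally show ?case by (simp add: dist_norm)
  qed
qed

text \<open>The matrix elements between the orbits of the first basis vectors converge by the asymptotics above;
  weak convergence extends by density, and weak convergence of unitary operators to an isometry is
  strong.\<close>

lemma wave_family_tendsto:
  assumes p: "p > -1" and q: "q > -1" and F: "F = at_top \<and> j = \<i> \<or> F = at_bot \<and> j = - \<i>"
  shows "((\<lambda>t. wave_family (laguerre_operator q) (laguerre_operator p) t f) \<longlongrightarrow>
    exp (j * complex_of_real ((q - p) * pi / 2)) *\<^sub>C cadjoint (Phi q) (Phi p f)) F"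
proof -
  define c where "c = exp (j * complex_of_real ((q - p) * pi / 2))"
  define V where "V t f = laguerre_group q t (laguerre_group p (- t) f)" for t f
  define W where "W f = c *\<^sub>C inv (Phi q) (Phi p f)" for f
  note Up = unitary_group_laguerre[OF p] and Uq = unitary_group_laguerre[OF q]
  have lin: "clinear (laguerre_group p t)" "clinear (laguerre_group q t)" for t
    by (rule unitary_clinear[OF unitary_group_unitary] Up Uq)+
  have linP: "clinear (Phi p)" "clinear (inv (Phi q))"
    by (rule unitary_clinear unitary_Phi[OF p] unitary_inv[OF unitary_Phi[OF q]])+
  have c: "norm c = 1" using F by (auto simp: c_def norm_exp_eq_Re)
  have Vn: "norm (V t f) = norm f" for t f
    by (simp add: V_def unitary_norm[OF unitary_group_unitary] Up Uq)
  have Wn: "norm (W f) = norm f" for f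
    by (simp add: W_def norm_scaleC c unitary_norm unitary_inv unitary_Phi p q)
  have V_add: "V t (f + g) = V t f + V t g" and V_scaleC: "V t (a *\<^sub>C f) = a *\<^sub>C V t f"
    and V_diff: "V t (f - g) = V t f - V t g" for t f g a
    by (simp_all add: V_def clinear_add[OF lin(1)] clinear_add[OF lin(2)] clinear_diff[OF lin(1)]
        clinear_diff[OF lin(2)] clinear_scaleC[OF lin(1)] clinear_scaleC[OF lin(2)])
  have W_add: "W (f + g) = W f + W g" and W_scaleC: "W (a *\<^sub>C f) = a *\<^sub>C W f"
    and W_diff: "W (f - g) = W f - W g" for f g a
    by (simp_all add: W_def clinear_add[OF linP(1)] clinear_add[OF linP(2)] clinear_diff[OF linP(1)]
        clinear_diff[OF linP(2)] clinear_scaleC[OF linP(1)] clinear_scaleC[OF linP(2)]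
        scaleC_add_right scaleC_diff_right scaleC_scaleC mult.commute)
  let ?e = "unit_ell2 0"
  have base: "((\<lambda>t. cinner (V t (laguerre_group p (- r) ?e)) (laguerre_group q (- r') ?e)) \<longlongrightarrow>
      cinner (W (laguerre_group p (- r) ?e)) (laguerre_group q (- r') ?e)) F" for r r'
  proof -
    have "cinner (W (laguerre_group p (- r) ?e)) (laguerre_group q (- r') ?e) =
        c * cinner (Phi p (laguerre_group p (- r) ?e)) (Phi q (laguerre_group q (- r') ?e))"
      unfolding W_def cinner_scaleC_left
      using unitary_cinner[OF unitary_Phi[OF q], of "inv (Phi q) (Phi p (laguerre_group p (- r) ?e))" "laguerre_group q (- r') ?e"]
      by (simp add: surj_f_inv_f[OF unitary_surj[OF unitary_Phi[OF q]]])
    moreover have "cinner (V t (laguerre_group p (- r) ?e)) (laguerre_group q (- r') ?e) =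
        (\<Sum>n. laguerre_transform p (laguerre p n) (t + r) * cnj (laguerre_transform q (laguerre q n) (t + r')))" for t
    proof -
      \<comment> \<open>Unitarity moves the q-evolution to the right-hand vector, so the same t is
        added to both orbit times.\<close>
      have "cinner (V t (laguerre_group p (- r) ?e)) (laguerre_group q (- r') ?e) =
          cinner (laguerre_group p (- (t + r)) ?e) (laguerre_group q (- (t + r')) ?e)"
        unfolding V_def unitary_group_cinner[OF Uq] by (simp flip: unitary_group_add[OF Up] unitary_group_add[OF Uq])
      then show ?thesis
        unfolding cinner_ell2_def ell2_nth_laguerre_group[OF p] ell2_nth_laguerre_group[OF q] .
    qed
    ultimately show ?thesis
      using transition_amplitude_tendsto[OF p q F, of r r'] cinner_Phi_laguerre_group[OF p q, of r r']
      by (simp only: c_def)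
  qed
  have step1: "((\<lambda>t. cinner (V t f) (laguerre_group q (- r') ?e)) \<longlongrightarrow> cinner (W f) (laguerre_group q (- r') ?e)) F" for f r'
  proof -
    let ?h = "laguerre_group q (- r') ?e"
    let ?S = "{f. ((\<lambda>t. cinner (V t f) ?h) \<longlongrightarrow> cinner (W f) ?h) F}"
    have "f \<in> ?S"
    proof (rule laguerre_group_cyclic[OF p])
      show "closed ?S"
        by (rule closed_weak_limit_set[where K = "norm ?h"])
          (auto simp: V_diff W_diff cinner_diff_left mult.commute intro: order_trans[OF norm_cinner_le] simp: Vn Wn)
      show "f + g \<in> ?S" if "f \<in> ?S" "g \<in> ?S" for f g
        using that by (auto simp: V_add W_add cinner_add_left intro: tendsto_add)
      show "a *\<^sub>C f \<in> ?S" if "f \<in> ?S" for a f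
        using that by (auto simp: V_scaleC W_scaleC cinner_scaleC_left intro: tendsto_mult_left)
      show "laguerre_group p s ?e \<in> ?S" for s using base[of "- s" r'] by simp
    qed
    then show ?thesis by simp
  qed
  \<comment> \<open>The test vector h sits in the first slot, where the inner product is linear; the
    case of an orbit is the conjugate of the previous step.\<close>
  have weak: "((\<lambda>t. cinner h (V t f)) \<longlongrightarrow> cinner h (W f)) F" for h
  proof -
    let ?S = "{h. ((\<lambda>t. cinner h (V t f)) \<longlongrightarrow> cinner h (W f)) F}"
    have "h \<in> ?S"
    proof (rule laguerre_group_cyclic[OF q])
      show "closed ?S"
        by (rule closed_weak_limit_set[where K = "norm f"])
          (auto simp: cinner_diff_left mult.commute intro: order_trans[OF norm_cinner_le] simp: Vn Wn)
      show "g + h \<in> ?S" if "g \<in> ?S" "h \<in> ?S" for g h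
        using that by (auto simp: cinner_add_left intro: tendsto_add)
      show "a *\<^sub>C h \<in> ?S" if "h \<in> ?S" for a h
        using that by (auto simp: cinner_scaleC_left intro: tendsto_mult_left)
      show "laguerre_group q s ?e \<in> ?S" for s
        using tendsto_cnj[OF step1[of f "- s"]] by (simp flip: cinner_commute)
    qed
    then show ?thesis by simp
  qed
  \<comment> \<open>The norms of \<open>V t f\<close> and \<open>W f\<close> both equal
    \<open>norm f\<close>, so the squared distance depends on t only through the inner product,
    whose limit is the squared norm of \<open>W f\<close>.\<close>
  have "((\<lambda>t. (norm (W f))\<^sup>2 + (norm (V t f))\<^sup>2 - 2 * Re (cinner (W f) (V t f))) \<longlongrightarrow>
      (norm (W f))\<^sup>2 + (norm f)\<^sup>2 - 2 * Re (cinner (W f) (W f))) F"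
    unfolding Vn by (intro tendsto_intros weak)
  then have "((\<lambda>t. (norm (W f - V t f))\<^sup>2) \<longlongrightarrow> 0) F"
    by (simp add: norm_diff_sq_cinner cinner_self Wn)
  then have "((\<lambda>t. sqrt ((norm (V t f - W f))\<^sup>2)) \<longlongrightarrow> sqrt 0) F"
    by (intro tendsto_real_sqrt) (simp add: norm_minus_commute)
  then have "((\<lambda>t. norm (V t f - W f)) \<longlongrightarrow> 0) F" by simp
  then have "((\<lambda>t. V t f) \<longlongrightarrow> W f) F" by (simp only: tendsto_norm_zero_iff LIM_zero_iff)
  then show ?thesis
    by (simp add: V_def W_def c_def wave_family_def exp_i_laguerre_operator p q
        cadjoint_unitary[OF unitary_Phi[OF q]])
qed

theorem theorem3p1:
  fixes p q :: real
  assumes "p > -1" and "q > -1"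
  shows "strongly_convergent (wave_family (laguerre_operator q) (laguerre_operator p)) at_top \<and>
    strongly_convergent (wave_family (laguerre_operator q) (laguerre_operator p)) at_bot \<and>
    wave_plus (laguerre_operator q) (laguerre_operator p) =
      (\<lambda>f. exp (\<i> * complex_of_real ((q - p) * pi / 2)) *\<^sub>C cadjoint (Phi q) (Phi p f)) \<and>
    wave_minus (laguerre_operator q) (laguerre_operator p) =
      (\<lambda>f. exp (- \<i> * complex_of_real ((q - p) * pi / 2)) *\<^sub>C cadjoint (Phi q) (Phi p f))"
  \<comment> \<open>The choices j = \<i> and j = -\<i> give the two time directions; convergence
    along a nontrivial filter determines the value of \<open>Lim\<close>.\<close>
  using wave_family_tendsto[OF assms, of at_top \<i>] wave_family_tendsto[OF assms, of at_bot "- \<i>"]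
  by (auto simp: strongly_convergent_def wave_plus_def wave_minus_def s_lim_def fun_eq_iff
      simp del: of_real_mult of_real_divide of_real_diff intro!: tendsto_Lim)

end
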